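(* Let $\mathbb{X}$ be an exact Mal'tsev category and $n\geq 1$. The adjunction $\mathrm{arr}^n\dashv \mathrm{EqFork}^n$, where $\mathrm{arr}^n\colon \mathsf{Fork}^n(\mathbb{X})\to\mathsf{Arr}^n(\mathbb{X})$ and $\mathrm{EqFork}^n\colon\mathsf{Arr}^n(\mathbb{X})\to\mathsf{Fork}^n(\mathbb{X})$, restricts to an adjoint equivalence $\mathsf{EFork}^n(\mathbb{X})\simeq\mathsf{Ext}^n(\mathbb{X})$ between the category of exact $n$-forks ($3^n$-diagrams) and the category of $n$-cubic extensions.
   Context: An exact Mal'tsev category is a Barr exact category in which every (internal) reflexive relation is an equivalence relation. $\mathsf{Arr}(\mathbb{X})$ is the category of arrows and $\mathsf{Arr}^n(\mathbb{X})=\mathsf{Arr}(\mathsf{Arr}^{n-1}(\mathbb{X}))$ the category of $n$-fold arrows (commutative $n$-cubes). Forks: a (reflexive) fork $F$ in a category consists of arrows $d,c\colon F_2\rightrightarrows F_1$, $e\colon F_1\to F_2$, $f\colon F_1\to F_0$ with $fd=fc$ and $de=1_{F_1}=ce$; equivalently, it is a functor $(\mathsf{3}^+)^{\mathrm{op}}\to\mathbb{X}$ where $\mathsf{3}^+$ is the full subcategory of the category of finite ordinals and order-preserving maps on the objects $0,1,2$. The fork is exact when $(d,c)$ is the kernel pair of $f$ (with $e$ the diagonal) and $f$ is the coequaliser of $(d,c)$. $\mathsf{Fork}(\mathbb{X})$ is the category of forks and natural transformations; $\mathsf{Fork}^n(\mathbb{X})=\mathsf{Fork}(\mathsf{Fork}^{n-1}(\mathbb{X}))\simeq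 \mathrm{Fun}(((\mathsf{3}^+)^{\mathrm{op}})^n,\mathbb{X})$ is the category of $n$-forks. An $n$-fork $F$ is exact, also called a $3^n$-diagram, when for each of the $n$ directions and each choice of values in $\{0,1,2\}$ for the other $n-1$ coordinates, the resulting fork in $\mathbb{X}$ is exact. $\mathsf{EFork}^n(\mathbb{X})$ is the full subcategory of exact $n$-forks. Functors: $\mathrm{arr}$ sends a fork to the arrow $f$; its right adjoint $\mathrm{EqFork}$ sends an arrow $f$ to the fork consisting of $f$ and its kernel pair. For $n\geq 2$, $\mathrm{arr}^n=\mathsf{Arr}(\mathrm{arr}^{n-1})\circ\mathrm{arr}$ and $\mathrm{EqFork}^n=\mathrm{EqFork}\circ\mathsf{Arr}(\mathrm{EqFork}^{n-1})$. Cubic extensions: a $1$-cubic extension is a regular epimorphism in $\mathbb{X}$. For $n\geq 2$, an $n$-fold arrow, viewed as a commutative square in $\mathsf{Arr}^{n-2}(\mathbb{X})$, is an $n$-cubic extension when its four sides and the induced comparison from its initial corner to the pullback are all $(n-1)$-cubic extensions. $\mathsf{Ext}^n(\mathbb{X})$ is the full subcategory of $\mathsf{Arr}^n(\mathbb{X})$ determined by the $n$-cubic extensions. *)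

theory Defs
  imports Main
begin

record ('o, 'm) precat =
  Obj :: "'o set"
  Mor :: "'m set"
  Dom :: "'m \<Rightarrow> 'o"
  Cod :: "'m \<Rightarrow> 'o"
  Idt :: "'o \<Rightarrow> 'm"
  Cmp :: "'m \<Rightarrow> 'm \<Rightarrow> 'm"  (infixl "\<odot>\<index>" 70)

definition hom_set :: "('o, 'm) precat \<Rightarrow> 'o \<Rightarrow> 'o \<Rightarrow> 'm set" where
  "hom_set C A B = {f \<in> Mor C. Dom C f = A \<and> Cod C f = B}"

locale category =
  fixes C :: "('o, 'm) precat" (structure)
  assumes Dom_Obj: "f \<in> Mor C \<Longrightarrow> Dom C f \<in> Obj C"
    and Cod_Obj: "f \<in> Mor C \<Longrightarrow> Cod C f \<in> Obj C"
    and Idt_hom: "A \<in> Obj C \<Longrightarrow> Idt C A \<in> hom_set C A A"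
    and Cmp_hom: "\<lbrakk>f \<in> Mor C; g \<in> Mor C; Dom C g = Cod C f\<rbrakk>
      \<Longrightarrow> g \<odot> f \<in> hom_set C (Dom C f) (Cod C g)"
    and Cmp_Idt: "f \<in> Mor C \<Longrightarrow> f \<odot> Idt C (Dom C f) = f"
    and Idt_Cmp: "f \<in> Mor C \<Longrightarrow> Idt C (Cod C f) \<odot> f = f"
    and Cmp_assoc: "\<lbrakk>f \<in> Mor C; g \<in> Mor C; h \<in> Mor C; Dom C g = Cod C f; Dom C h = Cod C g\<rbrakk>
      \<Longrightarrow> (h \<odot> g) \<odot> f = h \<odot> (g \<odot> f)"

definition is_iso :: "('o, 'm) precat \<Rightarrow> 'm \<Rightarrow> bool" where
  "is_iso C f \<longleftrightarrow> f \<in> Mor C \<and>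
     (\<exists>g \<in> hom_set C (Cod C f) (Dom C f).
        g \<odot>\<^bsub>C\<^esub> f = Idt C (Dom C f) \<and> f \<odot>\<^bsub>C\<^esub> g = Idt C (Cod C f))"

definition full_sub :: "('o, 'm) precat \<Rightarrow> ('o \<Rightarrow> bool) \<Rightarrow> ('o, 'm) precat" where
  "full_sub C P = C\<lparr>Obj := {A \<in> Obj C. P A},
                    Mor := {f \<in> Mor C. P (Dom C f) \<and> P (Cod C f)}\<rparr>"

record ('o, 'm, 'p, 'q) prefunctor =
  OMap :: "'o \<Rightarrow> 'p"
  MMap :: "'m \<Rightarrow> 'q"

definition id_functor :: "('o, 'm, 'o, 'm) prefunctor" where
  "id_functor = \<lparr>OMap = (\<lambda>A. A), MMap = (\<lambda>f. f)\<rparr>"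

definition comp_functor ::
  "('p, 'q, 'r, 's) prefunctor \<Rightarrow> ('o, 'm, 'p, 'q) prefunctor \<Rightarrow> ('o, 'm, 'r, 's) prefunctor"
  (infixl "\<circ>\<^sub>F" 55) where
  "G \<circ>\<^sub>F F = \<lparr>OMap = OMap G \<circ> OMap F, MMap = MMap G \<circ> MMap F\<rparr>"

locale is_functor = dom: category C + cod: category D
  for C :: "('o, 'm) precat" and D :: "('p, 'q) precat" and F :: "('o, 'm, 'p, 'q) prefunctor" +
  assumes OMap_Obj: "A \<in> Obj C \<Longrightarrow> OMap F A \<in> Obj D"
    and MMap_hom: "f \<in> Mor C
      \<Longrightarrow> MMap F f \<in> hom_set D (OMap F (Dom C f)) (OMap F (Cod C f))"
    and MMap_Idt: "A \<in> Obj C \<Longrightarrow> MMap F (Idt C A) = Idt D (OMap F A)"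
    and MMap_Cmp: "\<lbrakk>f \<in> Mor C; g \<in> Mor C; Dom C g = Cod C f\<rbrakk>
      \<Longrightarrow> MMap F (g \<odot>\<^bsub>C\<^esub> f) = MMap F g \<odot>\<^bsub>D\<^esub> MMap F f"

locale is_nat_trans = dom: is_functor C D F + cod: is_functor C D G
  for C :: "('o, 'm) precat" and D :: "('p, 'q) precat"
    and F G :: "('o, 'm, 'p, 'q) prefunctor" and t :: "'o \<Rightarrow> 'q" +
  assumes component: "A \<in> Obj C \<Longrightarrow> t A \<in> hom_set D (OMap F A) (OMap G A)"
    and naturality: "f \<in> Mor C
      \<Longrightarrow> MMap G f \<odot>\<^bsub>D\<^esub> t (Dom C f) = t (Cod C f) \<odot>\<^bsub>D\<^esub> MMap F f"

locale adjunction =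
  unit: is_nat_trans C C id_functor "G \<circ>\<^sub>F F" \<eta> +
  counit: is_nat_trans D D "F \<circ>\<^sub>F G" id_functor \<epsilon> +
  left: is_functor C D F + right: is_functor D C G
  for C :: "('o, 'm) precat" and D :: "('p, 'q) precat"
    and F :: "('o, 'm, 'p, 'q) prefunctor" and G :: "('p, 'q, 'o, 'm) prefunctor"
    and \<eta> :: "'o \<Rightarrow> 'm" and \<epsilon> :: "'p \<Rightarrow> 'q" +
  assumes triangle_left: "A \<in> Obj C
      \<Longrightarrow> \<epsilon> (OMap F A) \<odot>\<^bsub>D\<^esub> MMap F (\<eta> A) = Idt D (OMap F A)"
    and triangle_right: "B \<in> Obj D
      \<Longrightarrow> MMap G (\<epsilon> B) \<odot>\<^bsub>C\<^esub> \<eta> (OMap G B) = Idt C (OMap G B)"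

locale adjoint_equivalence = adjunction +
  assumes unit_iso: "A \<in> Obj C \<Longrightarrow> is_iso C (\<eta> A)"
    and counit_iso: "B \<in> Obj D \<Longrightarrow> is_iso D (\<epsilon> B)"

definition is_terminal :: "('o, 'm) precat \<Rightarrow> 'o \<Rightarrow> bool" where
  "is_terminal C T \<longleftrightarrow> T \<in> Obj C \<and> (\<forall>A \<in> Obj C. \<exists>!f. f \<in> hom_set C A T)"

definition is_pullback :: "('o, 'm) precat \<Rightarrow> 'm \<Rightarrow> 'm \<Rightarrow> 'm \<Rightarrow> 'm \<Rightarrow> bool" where
  "is_pullback C f g p q \<longleftrightarrow>
     f \<in> Mor C \<and> g \<in> Mor C \<and> p \<in> Mor C \<and> q \<in> Mor C \<and>
     Cod C f = Cod C g \<and> Cod C p = Dom C f \<and> Cod C q = Dom C g \<and> Dom C p = Dom C q \<and>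
     f \<odot>\<^bsub>C\<^esub> p = g \<odot>\<^bsub>C\<^esub> q \<and>
     (\<forall>a \<in> Mor C. \<forall>b \<in> Mor C.
        Dom C a = Dom C b \<and> Cod C a = Dom C f \<and> Cod C b = Dom C g \<and>
        f \<odot>\<^bsub>C\<^esub> a = g \<odot>\<^bsub>C\<^esub> b \<longrightarrow>
        (\<exists>!h. h \<in> hom_set C (Dom C a) (Dom C p) \<and> p \<odot>\<^bsub>C\<^esub> h = a \<and> q \<odot>\<^bsub>C\<^esub> h = b))"

abbreviation is_kernel_pair :: "('o, 'm) precat \<Rightarrow> 'm \<Rightarrow> 'm \<Rightarrow> 'm \<Rightarrow> bool" where
  "is_kernel_pair C f d c \<equiv> is_pullback C f f d c"

definition is_coequaliser :: "('o, 'm) precat \<Rightarrow> 'm \<Rightarrow> 'm \<Rightarrow> 'm \<Rightarrow> bool" where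
  "is_coequaliser C d c f \<longleftrightarrow>
     d \<in> Mor C \<and> c \<in> Mor C \<and> f \<in> Mor C \<and>
     Dom C d = Dom C c \<and> Cod C d = Cod C c \<and> Dom C f = Cod C d \<and>
     f \<odot>\<^bsub>C\<^esub> d = f \<odot>\<^bsub>C\<^esub> c \<and>
     (\<forall>g \<in> Mor C. Dom C g = Cod C d \<and> g \<odot>\<^bsub>C\<^esub> d = g \<odot>\<^bsub>C\<^esub> c \<longrightarrow>
        (\<exists>!h. h \<in> hom_set C (Cod C f) (Cod C g) \<and> h \<odot>\<^bsub>C\<^esub> f = g))"

definition regular_epi :: "('o, 'm) precat \<Rightarrow> 'm \<Rightarrow> bool" where
  "regular_epi C f \<longleftrightarrow> (\<exists>d c. is_coequaliser C d c f)"

text \<open>Finite completeness is taken in the form: terminal object and pullbacks.\<close>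

locale finitely_complete_category = category +
  assumes ex_terminal: "\<exists>T. is_terminal C T"
    and ex_pullback: "\<lbrakk>f \<in> Mor C; g \<in> Mor C; Cod C f = Cod C g\<rbrakk> \<Longrightarrow> \<exists>p q. is_pullback C f g p q"

locale regular_category = finitely_complete_category +
  assumes ex_coequaliser: "is_kernel_pair C f d c \<Longrightarrow> \<exists>q. is_coequaliser C d c q"
    and regular_epi_stable: "\<lbrakk>is_pullback C f g p q; regular_epi C f\<rbrakk> \<Longrightarrow> regular_epi C q"

definition is_relation :: "('o, 'm) precat \<Rightarrow> 'm \<Rightarrow> 'm \<Rightarrow> bool" where
  "is_relation C r s \<longleftrightarrow>
     r \<in> Mor C \<and> s \<in> Mor C \<and> Dom C r = Dom C s \<and> Cod C r = Cod C s \<and>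
     (\<forall>a \<in> Mor C. \<forall>b \<in> Mor C.
        Dom C a = Dom C b \<and> Cod C a = Dom C r \<and> Cod C b = Dom C r \<and>
        r \<odot>\<^bsub>C\<^esub> a = r \<odot>\<^bsub>C\<^esub> b \<and> s \<odot>\<^bsub>C\<^esub> a = s \<odot>\<^bsub>C\<^esub> b \<longrightarrow> a = b)"

definition is_reflexive_relation :: "('o, 'm) precat \<Rightarrow> 'm \<Rightarrow> 'm \<Rightarrow> bool" where
  "is_reflexive_relation C r s \<longleftrightarrow> is_relation C r s \<and>
     (\<exists>e \<in> hom_set C (Cod C r) (Dom C r).
        r \<odot>\<^bsub>C\<^esub> e = Idt C (Cod C r) \<and> s \<odot>\<^bsub>C\<^esub> e = Idt C (Cod C r))"

definition is_symmetric_relation :: "('o, 'm) precat \<Rightarrow> 'm \<Rightarrow> 'm \<Rightarrow> bool" where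
  "is_symmetric_relation C r s \<longleftrightarrow> is_relation C r s \<and>
     (\<exists>t \<in> hom_set C (Dom C r) (Dom C r). r \<odot>\<^bsub>C\<^esub> t = s \<and> s \<odot>\<^bsub>C\<^esub> t = r)"

definition is_transitive_relation :: "('o, 'm) precat \<Rightarrow> 'm \<Rightarrow> 'm \<Rightarrow> bool" where
  "is_transitive_relation C r s \<longleftrightarrow> is_relation C r s \<and>
     (\<forall>p q. is_pullback C s r p q \<longrightarrow>
        (\<exists>t \<in> hom_set C (Dom C p) (Dom C r).
           r \<odot>\<^bsub>C\<^esub> t = r \<odot>\<^bsub>C\<^esub> p \<and> s \<odot>\<^bsub>C\<^esub> t = s \<odot>\<^bsub>C\<^esub> q))"

definition is_equivalence_relation :: "('o, 'm) precat \<Rightarrow> 'm \<Rightarrow> 'm \<Rightarrow> bool" where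
  "is_equivalence_relation C r s \<longleftrightarrow>
     is_reflexive_relation C r s \<and> is_symmetric_relation C r s \<and> is_transitive_relation C r s"

locale barr_exact_category = regular_category +
  assumes effective: "is_equivalence_relation C r s \<Longrightarrow> \<exists>f. is_kernel_pair C f r s"

locale exact_maltsev_category = barr_exact_category +
  assumes maltsev: "is_reflexive_relation C r s \<Longrightarrow> is_equivalence_relation C r s"

text \<open>
  The constructions of arrow and fork categories have to be iterated \<open>n\<close> times for a variable \<open>n\<close>,
  so all iterates must live over one type. The objects and morphisms of the given category are
  embedded by \<open>Ob0\<close> and \<open>Mor0\<close>. An object of an arrow category is just a morphism of the underlying
  category; \<open>Square f g u v\<close> is the morphism \<open>(u, v)\<close> from \<open>f\<close> to \<open>g\<close>. \<open>Fork d c e f\<close> is a fork, and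
  \<open>ForkMap F G u2 u1 u0\<close> is the natural transformation from \<open>F\<close> to \<open>G\<close> with the displayed
  components.
\<close>

datatype ('o, 'm) cell =
    Ob0 'o
  | Mor0 'm
  | Square "('o, 'm) cell" "('o, 'm) cell" "('o, 'm) cell" "('o, 'm) cell"
  | Fork (fork_d: "('o, 'm) cell") (fork_c: "('o, 'm) cell") (fork_e: "('o, 'm) cell")
      (fork_f: "('o, 'm) cell")
  | ForkMap "('o, 'm) cell" "('o, 'm) cell" "('o, 'm) cell" "('o, 'm) cell" "('o, 'm) cell"

type_synonym ('o, 'm) cell_cat = "(('o, 'm) cell, ('o, 'm) cell) precat"
type_synonym ('o, 'm) cell_functor =
  "(('o, 'm) cell, ('o, 'm) cell, ('o, 'm) cell, ('o, 'm) cell) prefunctor"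

text \<open>An isomorphic copy of the category \<open>X\<close>.\<close>

definition base :: "('o, 'm) precat \<Rightarrow> ('o, 'm) cell_cat" where
  "base X =
     \<lparr>Obj = Ob0 ` Obj X,
      Mor = Mor0 ` Mor X,
      Dom = (\<lambda>x. case x of Mor0 f \<Rightarrow> Ob0 (Dom X f)),
      Cod = (\<lambda>x. case x of Mor0 f \<Rightarrow> Ob0 (Cod X f)),
      Idt = (\<lambda>x. case x of Ob0 A \<Rightarrow> Mor0 (Idt X A)),
      Cmp = (\<lambda>y x. case y of Mor0 g \<Rightarrow> (case x of Mor0 f \<Rightarrow> Mor0 (g \<odot>\<^bsub>X\<^esub> f)))\<rparr>"

definition Arr :: "('o, 'm) cell_cat \<Rightarrow> ('o, 'm) cell_cat" where
  "Arr C =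
     \<lparr>Obj = Mor C,
      Mor = {Square f g u v | f g u v.
               f \<in> Mor C \<and> g \<in> Mor C \<and>
               u \<in> hom_set C (Dom C f) (Dom C g) \<and> v \<in> hom_set C (Cod C f) (Cod C g) \<and>
               g \<odot>\<^bsub>C\<^esub> u = v \<odot>\<^bsub>C\<^esub> f},
      Dom = (\<lambda>x. case x of Square f g u v \<Rightarrow> f),
      Cod = (\<lambda>x. case x of Square f g u v \<Rightarrow> g),
      Idt = (\<lambda>f. Square f f (Idt C (Dom C f)) (Idt C (Cod C f))),
      Cmp = (\<lambda>y x. case y of Square g' h u' v' \<Rightarrow> (case x of Square f g u v \<Rightarrow>
               Square f h (u' \<odot>\<^bsub>C\<^esub> u) (v' \<odot>\<^bsub>C\<^esub> v)))\<rparr>"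

definition is_fork :: "('o, 'm) cell_cat \<Rightarrow> ('o, 'm) cell \<Rightarrow> bool" where
  "is_fork C F \<longleftrightarrow> (\<exists>d c e f. F = Fork d c e f \<and>
     d \<in> Mor C \<and> c \<in> Mor C \<and> f \<in> Mor C \<and>
     Dom C c = Dom C d \<and> Cod C c = Cod C d \<and> Dom C f = Cod C d \<and>
     e \<in> hom_set C (Cod C d) (Dom C d) \<and>
     f \<odot>\<^bsub>C\<^esub> d = f \<odot>\<^bsub>C\<^esub> c \<and>
     d \<odot>\<^bsub>C\<^esub> e = Idt C (Cod C d) \<and> c \<odot>\<^bsub>C\<^esub> e = Idt C (Cod C d))"

text \<open>The objects \<open>F\<^sub>0\<close>, \<open>F\<^sub>1\<close>, \<open>F\<^sub>2\<close> of a fork \<open>F\<close>.\<close>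

definition fork_ob :: "('o, 'm) cell_cat \<Rightarrow> nat \<Rightarrow> ('o, 'm) cell \<Rightarrow> ('o, 'm) cell" where
  "fork_ob C k F =
     (if k = 0 then Cod C (fork_f F) else if k = 1 then Dom C (fork_f F) else Dom C (fork_d F))"

definition ForkC :: "('o, 'm) cell_cat \<Rightarrow> ('o, 'm) cell_cat" where
  "ForkC C =
     \<lparr>Obj = {F. is_fork C F},
      Mor = {ForkMap F G u2 u1 u0 | F G u2 u1 u0.
               is_fork C F \<and> is_fork C G \<and>
               u2 \<in> hom_set C (fork_ob C 2 F) (fork_ob C 2 G) \<and>
               u1 \<in> hom_set C (fork_ob C 1 F) (fork_ob C 1 G) \<and>
               u0 \<in> hom_set C (fork_ob C 0 F) (fork_ob C 0 G) \<and>
               fork_d G \<odot>\<^bsub>C\<^esub> u2 = u1 \<odot>\<^bsub>C\<^esub> fork_d F \<and>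
               fork_c G \<odot>\<^bsub>C\<^esub> u2 = u1 \<odot>\<^bsub>C\<^esub> fork_c F \<and>
               fork_e G \<odot>\<^bsub>C\<^esub> u1 = u2 \<odot>\<^bsub>C\<^esub> fork_e F \<and>
               fork_f G \<odot>\<^bsub>C\<^esub> u1 = u0 \<odot>\<^bsub>C\<^esub> fork_f F},
      Dom = (\<lambda>x. case x of ForkMap F G u2 u1 u0 \<Rightarrow> F),
      Cod = (\<lambda>x. case x of ForkMap F G u2 u1 u0 \<Rightarrow> G),
      Idt = (\<lambda>F. ForkMap F F (Idt C (fork_ob C 2 F)) (Idt C (fork_ob C 1 F))
                   (Idt C (fork_ob C 0 F))),
      Cmp = (\<lambda>y x. case y of ForkMap G' H v2 v1 v0 \<Rightarrow> (case x of ForkMap F G u2 u1 u0 \<Rightarrow>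
               ForkMap F H (v2 \<odot>\<^bsub>C\<^esub> u2) (v1 \<odot>\<^bsub>C\<^esub> u1) (v0 \<odot>\<^bsub>C\<^esub> u0)))\<rparr>"

primrec Arr_n :: "nat \<Rightarrow> ('o, 'm) precat \<Rightarrow> ('o, 'm) cell_cat" where
  "Arr_n 0 X = base X"
| "Arr_n (Suc n) X = Arr (Arr_n n X)"

primrec Fork_n :: "nat \<Rightarrow> ('o, 'm) precat \<Rightarrow> ('o, 'm) cell_cat" where
  "Fork_n 0 X = base X"
| "Fork_n (Suc n) X = ForkC (Fork_n n X)"

text \<open>The 2-functor \<open>Arr\<close> on functors and on natural transformations.\<close>

definition Arr_functor :: "('o, 'm) cell_functor \<Rightarrow> ('o, 'm) cell_functor" where
  "Arr_functor F =
     \<lparr>OMap = MMap F,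
      MMap = (\<lambda>x. case x of Square f g u v \<Rightarrow> Square (MMap F f) (MMap F g) (MMap F u) (MMap F v))\<rparr>"

definition Arr_nat_trans ::
  "('o, 'm) cell_cat \<Rightarrow> ('o, 'm) cell_functor \<Rightarrow> ('o, 'm) cell_functor \<Rightarrow>
   (('o, 'm) cell \<Rightarrow> ('o, 'm) cell) \<Rightarrow> ('o, 'm) cell \<Rightarrow> ('o, 'm) cell" where
  "Arr_nat_trans C F G t f = Square (MMap F f) (MMap G f) (t (Dom C f)) (t (Cod C f))"

definition arr :: "('o, 'm) cell_functor" where
  "arr =
     \<lparr>OMap = fork_f,
      MMap = (\<lambda>x. case x of ForkMap F G u2 u1 u0 \<Rightarrow> Square (fork_f F) (fork_f G) u1 u0)\<rparr>"

text \<open>This is meaningful only when \<open>C\<close> has kernel pairs, one of which is chosen for each \<open>f\<close>.\<close>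

definition EqFork_ob :: "('o, 'm) cell_cat \<Rightarrow> ('o, 'm) cell \<Rightarrow> ('o, 'm) cell" where
  "EqFork_ob C f =
     (let (d, c) = (SOME (d, c). is_kernel_pair C f d c);
          e = (THE e. e \<in> hom_set C (Dom C f) (Dom C d) \<and>
                 d \<odot>\<^bsub>C\<^esub> e = Idt C (Dom C f) \<and> c \<odot>\<^bsub>C\<^esub> e = Idt C (Dom C f))
      in Fork d c e f)"

text \<open>The map \<open>F\<^sub>2 \<rightarrow> G\<^sub>2\<close> induced by \<open>u : F\<^sub>1 \<rightarrow> G\<^sub>1\<close>, where \<open>G\<^sub>2\<close> is a kernel pair.\<close>

definition kernel_map ::
  "('o, 'm) cell_cat \<Rightarrow> ('o, 'm) cell \<Rightarrow> ('o, 'm) cell \<Rightarrow> ('o, 'm) cell \<Rightarrow> ('o, 'm) cell" where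
  "kernel_map C F G u =
     (THE w. w \<in> hom_set C (fork_ob C 2 F) (fork_ob C 2 G) \<and>
        fork_d G \<odot>\<^bsub>C\<^esub> w = u \<odot>\<^bsub>C\<^esub> fork_d F \<and>
        fork_c G \<odot>\<^bsub>C\<^esub> w = u \<odot>\<^bsub>C\<^esub> fork_c F)"

definition EqFork :: "('o, 'm) cell_cat \<Rightarrow> ('o, 'm) cell_functor" where
  "EqFork C =
     \<lparr>OMap = EqFork_ob C,
      MMap = (\<lambda>x. case x of Square f g u v \<Rightarrow>
        ForkMap (EqFork_ob C f) (EqFork_ob C g)
          (kernel_map C (EqFork_ob C f) (EqFork_ob C g) u) u v)\<rparr>"

definition arr_unit :: "('o, 'm) cell_cat \<Rightarrow> ('o, 'm) cell \<Rightarrow> ('o, 'm) cell" where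
  "arr_unit C F =
     (let G = EqFork_ob C (fork_f F)
      in ForkMap F G (kernel_map C F G (Idt C (fork_ob C 1 F)))
           (Idt C (fork_ob C 1 F)) (Idt C (fork_ob C 0 F)))"

text \<open>Since \<open>arr \<circ>\<^sub>F EqFork C\<close> is the identity, so is the counit.\<close>

definition arr_counit :: "('o, 'm) cell_cat \<Rightarrow> ('o, 'm) cell \<Rightarrow> ('o, 'm) cell" where
  "arr_counit C f = Idt (Arr C) f"

text \<open>
  Starting the recursions at \<open>0\<close> with identities is harmless: on the objects and morphisms of the
  respective categories, \<open>arr_n 1\<close> is \<open>arr\<close> and \<open>EqFork_n 1 X\<close> is \<open>EqFork (base X)\<close>.
\<close>

primrec arr_n :: "nat \<Rightarrow> ('o, 'm) cell_functor" where
  "arr_n 0 = id_functor"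
| "arr_n (Suc n) = Arr_functor (arr_n n) \<circ>\<^sub>F arr"

primrec EqFork_n :: "nat \<Rightarrow> ('o, 'm) precat \<Rightarrow> ('o, 'm) cell_functor" where
  "EqFork_n 0 X = id_functor"
| "EqFork_n (Suc n) X = EqFork (Fork_n n X) \<circ>\<^sub>F Arr_functor (EqFork_n n X)"

text \<open>
  Unit and counit of the composite of the adjunction \<open>arr \<stileturn> EqFork\<close> between \<open>Fork\<^sup>n\<^sup>+\<^sup>1(X)\<close> and
  \<open>Arr(Fork\<^sup>n(X))\<close> with the image under \<open>Arr\<close> of the adjunction \<open>arr\<^sup>n \<stileturn> EqFork\<^sup>n\<close>.
\<close>

primrec unit_n :: "nat \<Rightarrow> ('o, 'm) precat \<Rightarrow> ('o, 'm) cell \<Rightarrow> ('o, 'm) cell" where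
  "unit_n 0 X = Idt (base X)"
| "unit_n (Suc n) X = (\<lambda>F.
     MMap (EqFork (Fork_n n X))
       (Arr_nat_trans (Fork_n n X) id_functor (EqFork_n n X \<circ>\<^sub>F arr_n n) (unit_n n X) (OMap arr F))
     \<odot>\<^bsub>Fork_n (Suc n) X\<^esub> arr_unit (Fork_n n X) F)"

primrec counit_n :: "nat \<Rightarrow> ('o, 'm) precat \<Rightarrow> ('o, 'm) cell \<Rightarrow> ('o, 'm) cell" where
  "counit_n 0 X = Idt (base X)"
| "counit_n (Suc n) X = (\<lambda>f.
     Arr_nat_trans (Arr_n n X) (arr_n n \<circ>\<^sub>F EqFork_n n X) id_functor (counit_n n X) f
     \<odot>\<^bsub>Arr_n (Suc n) X\<^esub>
     MMap (Arr_functor (arr_n n))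
       (arr_counit (Fork_n n X) (OMap (Arr_functor (EqFork_n n X)) f)))"

definition exact_fork :: "('o, 'm) cell_cat \<Rightarrow> ('o, 'm) cell \<Rightarrow> bool" where
  "exact_fork C F \<longleftrightarrow> is_fork C F \<and>
     is_kernel_pair C (fork_f F) (fork_d F) (fork_c F) \<and>
     is_coequaliser C (fork_d F) (fork_c F) (fork_f F)"

text \<open>Evaluation of a morphism of \<open>n\<close>-forks at a vertex, given as a list over \<open>{0, 1, 2}\<close> of length \<open>n\<close>
  whose head belongs to the outermost direction.\<close>

fun eval_mor :: "nat list \<Rightarrow> ('o, 'm) cell \<Rightarrow> ('o, 'm) cell" where
  "eval_mor [] x = x"
| "eval_mor (k # v) (ForkMap F G u2 u1 u0) =
     eval_mor v (if k = 0 then u0 else if k = 1 then u1 else u2)"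

text \<open>The fork in \<open>X\<close> that an \<open>n\<close>-fork restricts to in the \<open>i\<close>-th direction (counted from \<open>0\<close>, the
  outermost one), when the list \<open>v\<close> gives the values of the other \<open>n - 1\<close> coordinates in order.\<close>

fun fork_line ::
  "nat \<Rightarrow> ('o, 'm) precat \<Rightarrow> nat \<Rightarrow> nat list \<Rightarrow> ('o, 'm) cell \<Rightarrow> ('o, 'm) cell" where
  "fork_line (Suc n) X 0 v (Fork d c e f) =
     Fork (eval_mor v d) (eval_mor v c) (eval_mor v e) (eval_mor v f)"
| "fork_line (Suc n) X (Suc i) (k # v) F = fork_line n X i v (fork_ob (Fork_n n X) k F)"

definition exact_n_fork :: "nat \<Rightarrow> ('o, 'm) precat \<Rightarrow> ('o, 'm) cell \<Rightarrow> bool" where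
  "exact_n_fork n X F \<longleftrightarrow> F \<in> Obj (Fork_n n X) \<and>
     (\<forall>i v. i < n \<and> length v = n - 1 \<and> set v \<subseteq> {0, 1, 2} \<longrightarrow>
        exact_fork (base X) (fork_line n X i v F))"

definition EFork_n :: "nat \<Rightarrow> ('o, 'm) precat \<Rightarrow> ('o, 'm) cell_cat" where
  "EFork_n n X = full_sub (Fork_n n X) (exact_n_fork n X)"

text \<open>
  An \<open>(n + 2)\<close>-fold arrow is \<open>Square f g u v\<close>, where \<open>f : A \<rightarrow> B\<close>, \<open>g : C \<rightarrow> D\<close>, \<open>u : A \<rightarrow> C\<close> and
  \<open>v : B \<rightarrow> D\<close> are \<open>(n + 1)\<close>-fold arrows, that is, morphisms of \<open>n\<close>-fold arrows; \<open>w\<close> is the comparison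
  from \<open>A\<close> to the pullback of \<open>g\<close> and \<open>v\<close>. The case \<open>0\<close> is a dummy.
\<close>

fun cubic_ext :: "nat \<Rightarrow> ('o, 'm) precat \<Rightarrow> ('o, 'm) cell \<Rightarrow> bool" where
  "cubic_ext 0 X x \<longleftrightarrow> False"
| "cubic_ext (Suc 0) X x \<longleftrightarrow> regular_epi (base X) x"
| "cubic_ext (Suc (Suc n)) X x \<longleftrightarrow>
     (\<exists>f g u v. x = Square f g u v \<and> x \<in> Obj (Arr_n (Suc (Suc n)) X) \<and>
        cubic_ext (Suc n) X f \<and> cubic_ext (Suc n) X g \<and>
        cubic_ext (Suc n) X u \<and> cubic_ext (Suc n) X v \<and>
        (\<exists>p q w. is_pullback (Arr_n n X) g v p q \<and>
           w \<in> hom_set (Arr_n n X) (Dom (Arr_n n X) f) (Dom (Arr_n n X) p) \<and>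
           p \<odot>\<^bsub>Arr_n n X\<^esub> w = u \<and> q \<odot>\<^bsub>Arr_n n X\<^esub> w = f \<and>
           cubic_ext (Suc n) X w))"

definition Ext_n :: "nat \<Rightarrow> ('o, 'm) precat \<Rightarrow> ('o, 'm) cell_cat" where
  "Ext_n n X = full_sub (Arr_n n X) (cubic_ext n X)"

end

theory Submission
  imports Defs
begin

text \<open>
  On \<open>n\<close>-fold arrows the \<open>(n + 1)\<close>-cubic extensions are the double extensions relative to the
  \<open>n\<close>-cubic ones. The key property of a class of extensions is that a square of extensions has an
  extension as its comparison to the pullback if and only if the induced map between the kernel
  pairs in one direction is an extension. For regular epimorphisms this is Bourn's lemma in a regular
  Mal'tsev category, and it is inherited by double extensions: the kernel pairs of the edges of a cube
  form a square of extensions, to which the property applies once more.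

  Call a morphism of exact \<open>n\<close>-forks an extension if it is a pointwise regular epimorphism and its
  kernel pair is exact. Then an exact \<open>(n + 1)\<close>-fork is the kernel pair fork of an extension, and
  by induction a morphism between exact \<open>n\<close>-forks is an extension if and only if its image under
  \<open>arr\<^sup>n\<close> is an \<open>(n + 1)\<close>-cubic extension, because \<open>arr\<^sup>n\<close> preserves the pointwise kernel pairs.
\<close>

subsection \<open>Pullbacks and squares\<close>

text \<open>The two sides are defined in ways that do not match: exactness is tested on kernel
  pairs, one direction at a time, and knows no comparison to a pullback, while a cubic extension has
  a comparison and no kernel pair. Only the key property of extensions translates between them, and
  its two halves differ in nature. From the comparison to the map of kernel pairs
  (\<open>E_pair_map\<close>), stability under pullback and composition suffice. The way back is
  where the Mal'tsev condition enters: it is proved for regular epimorphisms in X by means of a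
  reflexive relation and is then the axiom \<open>E_comparison\<close> of
  \<open>relative_maltsev\<close>. It has to be an axiom, re-established for each arrow category,
  because cubic extensions are defined by recursion and not as coequalisers in the category of
  n-fold arrows, so that the argument with relations cannot be repeated there.

  A commutative square can be read along either pair of opposite sides, and many steps consist in
  transposing it: the comparison stays the same, while the kernel pairs become those of the other
  direction.\<close>

lemma in_hom_set [simp]: "f \<in> hom_set C A B \<longleftrightarrow> f \<in> Mor C \<and> Dom C f = A \<and> Cod C f = B"
  by (simp add: hom_set_def)

context category
begin

lemma Mor_Idt [simp]: "A \<in> Obj C \<Longrightarrow> Idt C A \<in> Mor C"
  and Dom_Idt [simp]: "A \<in> Obj C \<Longrightarrow> Dom C (Idt C A) = A"
  and Cod_Idt [simp]: "A \<in> Obj C \<Longrightarrow> Cod C (Idt C A) = A"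
  using Idt_hom by simp_all

lemma Mor_Cmp [simp]: "\<lbrakk>f \<in> Mor C; g \<in> Mor C; Dom C g = Cod C f\<rbrakk> \<Longrightarrow> g \<odot> f \<in> Mor C"
  and Dom_Cmp [simp]: "\<lbrakk>f \<in> Mor C; g \<in> Mor C; Dom C g = Cod C f\<rbrakk> \<Longrightarrow> Dom C (g \<odot> f) = Dom C f"
  and Cod_Cmp [simp]: "\<lbrakk>f \<in> Mor C; g \<in> Mor C; Dom C g = Cod C f\<rbrakk> \<Longrightarrow> Cod C (g \<odot> f) = Cod C g"
  using Cmp_hom by simp_all

lemma Cmp_Idt_right [simp]: "\<lbrakk>f \<in> Mor C; Dom C f = A\<rbrakk> \<Longrightarrow> f \<odot> Idt C A = f"
  and Cmp_Idt_left [simp]: "\<lbrakk>f \<in> Mor C; Cod C f = A\<rbrakk> \<Longrightarrow> Idt C A \<odot> f = f"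
  using Cmp_Idt Idt_Cmp by auto

declare Dom_Obj [simp] Cod_Obj [simp] Cmp_assoc [simp]

text \<open>As a simp rule \<open>Cmp_assoc\<close> moves brackets to the right, so a known equation
  between composites no longer matches once something is composed on the right. This lemma and
  \<open>reassoc1\<close> supply the equation with such a tail \<open>x\<close>.\<close>

lemma reassoc:
  "\<lbrakk>g \<odot> f = k \<odot> h; f \<in> Mor C; g \<in> Mor C; h \<in> Mor C; k \<in> Mor C; x \<in> Mor C;
    Dom C g = Cod C f; Dom C k = Cod C h; Dom C f = Cod C x; Dom C h = Cod C x\<rbrakk>
   \<Longrightarrow> g \<odot> (f \<odot> x) = k \<odot> (h \<odot> x)"
  by (metis Cmp_assoc)

lemma reassoc1:
  "\<lbrakk>g \<odot> f = k; f \<in> Mor C; g \<in> Mor C; x \<in> Mor C;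
    Dom C g = Cod C f; Dom C f = Cod C x\<rbrakk>
   \<Longrightarrow> g \<odot> (f \<odot> x) = k \<odot> x"
  by (metis Cmp_assoc)

lemma isoI:
  "\<lbrakk>f \<in> Mor C; g \<in> Mor C; Dom C g = Cod C f; Cod C g = Dom C f;
    g \<odot> f = Idt C (Dom C f); f \<odot> g = Idt C (Cod C f)\<rbrakk> \<Longrightarrow> is_iso C f"
  unfolding is_iso_def by auto

lemma isoE:
  assumes "is_iso C f"
  obtains g where "f \<in> Mor C" "g \<in> Mor C" "Dom C g = Cod C f" "Cod C g = Dom C f"
    "g \<odot> f = Idt C (Dom C f)" "f \<odot> g = Idt C (Cod C f)"
  using assms unfolding is_iso_def by auto

lemma iso_Idt: "A \<in> Obj C \<Longrightarrow> is_iso C (Idt C A)"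
  by (rule isoI[where g = "Idt C A"]) auto

lemma iso_Cmp:
  assumes "is_iso C f" "is_iso C g" "Dom C g = Cod C f"
  shows "is_iso C (g \<odot> f)"
proof -
  obtain f' where f: "f \<in> Mor C" "f' \<in> Mor C" "Dom C f' = Cod C f" "Cod C f' = Dom C f"
    "f' \<odot> f = Idt C (Dom C f)" "f \<odot> f' = Idt C (Cod C f)" using assms(1) by (rule isoE)
  obtain g' where g: "g \<in> Mor C" "g' \<in> Mor C" "Dom C g' = Cod C g" "Cod C g' = Dom C g"
    "g' \<odot> g = Idt C (Dom C g)" "g \<odot> g' = Idt C (Cod C g)" using assms(2) by (rule isoE)
  show ?thesis
    using f g assms(3) by (intro isoI[of _ "f' \<odot> g'"]) (auto simp: reassoc1)
qed

lemma pullbackD: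
  assumes "is_pullback C f g p q"
  shows "f \<in> Mor C" "g \<in> Mor C" "p \<in> Mor C" "q \<in> Mor C" "Cod C f = Cod C g"
    "Cod C p = Dom C f" "Cod C q = Dom C g" "Dom C p = Dom C q" "f \<odot> p = g \<odot> q"
  using assms unfolding is_pullback_def by auto

text \<open>The ends of the lift are expressed by \<open>b\<close> and \<open>q\<close>, not by
  \<open>a\<close> and \<open>p\<close>: as rewrite rules, \<open>Dom C a = Dom C b\<close> and
  \<open>Dom C p = Dom C q\<close> make this the normal form.\<close>

lemma pullback_lift:
  assumes "is_pullback C f g p q" "a \<in> Mor C" "b \<in> Mor C" "Dom C a = Dom C b"
    "Cod C a = Dom C f" "Cod C b = Dom C g" "f \<odot> a = g \<odot> b"
  obtains h where "h \<in> Mor C" "Dom C h = Dom C b" "Cod C h = Dom C q" "p \<odot> h = a" "q \<odot> h = b"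
proof -
  have "\<exists>!h. h \<in> hom_set C (Dom C a) (Dom C p) \<and> p \<odot> h = a \<and> q \<odot> h = b"
    using assms unfolding is_pullback_def by blast
  then show ?thesis
    using that pullbackD(8)[OF assms(1)] assms(4) by auto
qed

lemma pullback_unique:
  assumes "is_pullback C f g p q" "h \<in> Mor C" "h' \<in> Mor C" "Dom C h = Dom C h'"
    "Cod C h = Dom C p" "Cod C h' = Dom C p" "p \<odot> h = p \<odot> h'" "q \<odot> h = q \<odot> h'"
  shows "h = h'"
proof -
  note D = pullbackD[OF assms(1)]
  have *: "f \<odot> (p \<odot> h) = g \<odot> (q \<odot> h)"
    using D(9) by (rule reassoc) (use D assms(2-6) in simp_all)
  have mor: "p \<odot> h \<in> Mor C" "q \<odot> h \<in> Mor C" and "Dom C (p \<odot> h) = Dom C h" "Dom C (q \<odot> h) = Dom C h"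
    "Cod C (p \<odot> h) = Dom C f" "Cod C (q \<odot> h) = Dom C g"
    using D assms(2-6) by simp_all
  moreover have "Dom C (p \<odot> h) = Dom C (q \<odot> h) \<and> Cod C (p \<odot> h) = Dom C f \<and> Cod C (q \<odot> h) = Dom C g \<and>
      f \<odot> (p \<odot> h) = g \<odot> (q \<odot> h) \<longrightarrow>
     (\<exists>!x. x \<in> hom_set C (Dom C (p \<odot> h)) (Dom C p) \<and> p \<odot> x = p \<odot> h \<and> q \<odot> x = q \<odot> h)"
    using assms(1) mor unfolding is_pullback_def by blast
  ultimately have "\<exists>!x. x \<in> hom_set C (Dom C h) (Dom C p) \<and> p \<odot> x = p \<odot> h \<and> q \<odot> x = q \<odot> h"
    using * by simp
  moreover have "h \<in> hom_set C (Dom C h) (Dom C p)" "h' \<in> hom_set C (Dom C h) (Dom C p)"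
    using assms(2-6) by simp_all
  ultimately show ?thesis
    using assms(7,8) by metis
qed

lemma pullbackI:
  assumes "f \<in> Mor C" "g \<in> Mor C" "p \<in> Mor C" "q \<in> Mor C" "Cod C f = Cod C g"
    "Cod C p = Dom C f" "Cod C q = Dom C g" "Dom C p = Dom C q" "f \<odot> p = g \<odot> q"
    and lift: "\<And>a b. \<lbrakk>a \<in> Mor C; b \<in> Mor C; Dom C a = Dom C b; Cod C a = Dom C f; Cod C b = Dom C g;
      f \<odot> a = g \<odot> b\<rbrakk> \<Longrightarrow> \<exists>h. h \<in> Mor C \<and> Dom C h = Dom C b \<and> Cod C h = Dom C q \<and> p \<odot> h = a \<and> q \<odot> h = b"
    and mono: "\<And>h h'. \<lbrakk>h \<in> Mor C; h' \<in> Mor C; Dom C h = Dom C h'; Cod C h = Dom C q; Cod C h'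
      = Dom C q;
      p \<odot> h = p \<odot> h'; q \<odot> h = q \<odot> h'\<rbrakk> \<Longrightarrow> h = h'"
  shows "is_pullback C f g p q"
  unfolding is_pullback_def
proof (intro conjI ballI impI assms(1-9))
  fix a b assume "a \<in> Mor C" "b \<in> Mor C"
    and *: "Dom C a = Dom C b \<and> Cod C a = Dom C f \<and> Cod C b = Dom C g \<and> f \<odot> a = g \<odot> b"
  then obtain h where "h \<in> Mor C" "Dom C h = Dom C b" "Cod C h = Dom C q" "p \<odot> h = a" "q \<odot> h = b"
    using lift by blast
  then show "\<exists>!h. h \<in> hom_set C (Dom C a) (Dom C p) \<and> p \<odot> h = a \<and> q \<odot> h = b"
    using * assms(8) by (intro ex1I[of _ h]) (auto intro: mono)
qed

lemma pullback_sym: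
  assumes pb: "is_pullback C f g p q"
  shows "is_pullback C g f q p"
proof (rule pullbackI)
  note D = pullbackD[OF pb]
  fix a b assume "a \<in> Mor C" "b \<in> Mor C" "Dom C a = Dom C b" "Cod C a = Dom C g" "Cod C b = Dom C f"
    "g \<odot> a = f \<odot> b"
  then obtain h where "h \<in> Mor C" "Dom C h = Dom C a" "Cod C h = Dom C q" "p \<odot> h = b" "q \<odot> h = a"
    using pullback_lift[OF pb, of b a] by metis
  then show "\<exists>h. h \<in> Mor C \<and> Dom C h = Dom C b \<and> Cod C h = Dom C p \<and> q \<odot> h = a \<and> p \<odot> h = b"
    using D(8) \<open>Dom C a = Dom C b\<close> by auto
next
  fix h h' assume "h \<in> Mor C" "h' \<in> Mor C" "Dom C h = Dom C h'" "Cod C h = Dom C p"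
    "Cod C h' = Dom C p"
    "q \<odot> h = q \<odot> h'" "p \<odot> h = p \<odot> h'"
  then show "h = h'" using pullback_unique[OF pb, of h h'] by simp
qed (use pullbackD[OF pb] in simp_all)

lemma pullback_iso:
  assumes pb: "is_pullback C f g p q" and pb': "is_pullback C f g p' q'"
  obtains i where "is_iso C i" "Dom C i = Dom C q'" "Cod C i = Dom C q" "p \<odot> i = p'" "q \<odot> i = q'"
proof -
  note D = pullbackD[OF pb] pullbackD[OF pb']
  obtain i where i: "i \<in> Mor C" "Dom C i = Dom C q'" "Cod C i = Dom C q" "p \<odot> i = p'" "q \<odot> i = q'"
    using pullback_lift[OF pb, of p' q'] D by auto
  obtain j where j: "j \<in> Mor C" "Dom C j = Dom C q" "Cod C j = Dom C q'" "p' \<odot> j = p" "q' \<odot> j = q"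
    using pullback_lift[OF pb', of p q] D by auto
  have "i \<odot> j = Idt C (Dom C q)"
    by (rule pullback_unique[OF pb]) (use D i j in \<open>auto simp: reassoc1\<close>)
  moreover have "j \<odot> i = Idt C (Dom C q')"
    by (rule pullback_unique[OF pb']) (use D i j in \<open>auto simp: reassoc1\<close>)
  ultimately show ?thesis using i j by (intro that[of i] isoI[of i j]) auto
qed

text \<open>Serves to carry a description of one pullback over to every other pullback of the same
  cospan.\<close>

lemma pullback_Cmp_iso:
  assumes pb: "is_pullback C f g p q" and i: "is_iso C i" "Cod C i = Dom C q"
  shows "is_pullback C f g (p \<odot> i) (q \<odot> i)"
proof -
  note D = pullbackD[OF pb]
  obtain j where j: "i \<in> Mor C" "j \<in> Mor C" "Dom C j = Cod C i" "Cod C j = Dom C i"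
    "j \<odot> i = Idt C (Dom C i)" "i \<odot> j = Idt C (Cod C i)" using i(1) by (rule isoE)
  show ?thesis
  proof (rule pullbackI)
    show "f \<odot> (p \<odot> i) = g \<odot> (q \<odot> i)" using D j i by (intro reassoc) auto
  next
    fix a b assume ab: "a \<in> Mor C" "b \<in> Mor C" "Dom C a = Dom C b" "Cod C a = Dom C f"
      "Cod C b = Dom C g" "f \<odot> a = g \<odot> b"
    then obtain h where h: "h \<in> Mor C" "Dom C h = Dom C b" "Cod C h = Dom C q" "p \<odot> h = a" "q \<odot> h = b"
      using pullback_lift[OF pb] by metis
    then show "\<exists>h. h \<in> Mor C \<and> Dom C h = Dom C b \<and> Cod C h = Dom C (q \<odot> i) \<and>
        (p \<odot> i) \<odot> h = a \<and> (q \<odot> i) \<odot> h = b"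
      using D i j by (intro exI[of _ "j \<odot> h"]) (auto simp: reassoc1[of i j])
  next
    fix h h' assume h: "h \<in> Mor C" "h' \<in> Mor C" "Dom C h = Dom C h'" "Cod C h = Dom C (q \<odot> i)"
      "Cod C h' = Dom C (q \<odot> i)" "(p \<odot> i) \<odot> h = (p \<odot> i) \<odot> h'" "(q \<odot> i) \<odot> h = (q \<odot> i) \<odot> h'"
    have "i \<odot> h = i \<odot> h'" by (rule pullback_unique[OF pb]) (use D i j h in auto)
    then have "j \<odot> (i \<odot> h) = j \<odot> (i \<odot> h')" by simp
    then show "h = h'" using D i j h by (simp add: reassoc1[of j i])
  qed (use D i j in auto)
qed

end

section \<open>Commutative squares, comparisons to pullbacks, maps of kernel pairs\<close>

definition comm_square :: "('o, 'm) precat \<Rightarrow> 'm \<Rightarrow> 'm \<Rightarrow> 'm \<Rightarrow> 'm \<Rightarrow> bool" where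
  "comm_square C f g u v \<longleftrightarrow> f \<in> Mor C \<and> g \<in> Mor C \<and> u \<in> Mor C \<and> v \<in> Mor C \<and>
     Dom C u = Dom C f \<and> Cod C u = Dom C g \<and> Dom C v = Cod C f \<and> Cod C v = Cod C g \<and>
     g \<odot>\<^bsub>C\<^esub> u = v \<odot>\<^bsub>C\<^esub> f"

text \<open>No pullback is chosen, so \<open>w\<close> is fixed only up to an isomorphism of its
  codomain.\<close>

definition comparison :: "('o, 'm) precat \<Rightarrow> 'm \<Rightarrow> 'm \<Rightarrow> 'm \<Rightarrow> 'm \<Rightarrow> 'm \<Rightarrow> bool" where
  "comparison C f g u v w \<longleftrightarrow> (\<exists>p q. is_pullback C g v p q \<and>
     w \<in> hom_set C (Dom C f) (Dom C p) \<and> p \<odot>\<^bsub>C\<^esub> w = u \<and> q \<odot>\<^bsub>C\<^esub> w = f)"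

definition pair_map :: "('o, 'm) precat \<Rightarrow> 'm \<Rightarrow> 'm \<Rightarrow> 'm \<Rightarrow> 'm \<Rightarrow> 'm \<Rightarrow> 'm \<Rightarrow> bool" where
  "pair_map C u d c d' c' k \<longleftrightarrow> k \<in> Mor C \<and> Dom C k = Dom C d \<and> Cod C k = Dom C d' \<and>
     d' \<odot>\<^bsub>C\<^esub> k = u \<odot>\<^bsub>C\<^esub> d \<and> c' \<odot>\<^bsub>C\<^esub> k = u \<odot>\<^bsub>C\<^esub> c"

lemma comm_squareD:
  assumes "comm_square C f g u v"
  shows "f \<in> Mor C" "g \<in> Mor C" "u \<in> Mor C" "v \<in> Mor C" "Dom C u = Dom C f" "Cod C u = Dom C g"
    "Dom C v = Cod C f" "Cod C v = Cod C g" "g \<odot>\<^bsub>C\<^esub> u = v \<odot>\<^bsub>C\<^esub> f"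
  using assms unfolding comm_square_def by auto

lemma pair_mapD:
  assumes "pair_map C u d c d' c' k"
  shows "k \<in> Mor C" "Dom C k = Dom C d" "Cod C k = Dom C d'"
     "d' \<odot>\<^bsub>C\<^esub> k = u \<odot>\<^bsub>C\<^esub> d" "c' \<odot>\<^bsub>C\<^esub> k = u \<odot>\<^bsub>C\<^esub> c"
  using assms unfolding pair_map_def by auto

lemma comm_square_sym: "comm_square C f g u v \<Longrightarrow> comm_square C u v f g"
  unfolding comm_square_def by auto

context category
begin

text \<open>A pullback of \<open>g\<close> and \<open>v\<close> is also one of \<open>v\<close> and
  \<open>g\<close>. Transposing is needed because \<open>E_comparison\<close> and
  \<open>E_pair_map\<close> speak about the kernel pairs of \<open>u\<close> and \<open>v\<close>
  only.\<close>

lemma comparison_sym: "comparison C f g u v w \<Longrightarrow> comm_square C f g u v \<Longrightarrow> comparison C u v f g w"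
  unfolding comparison_def using pullback_sym comm_squareD pullbackD by (metis in_hom_set)

lemma ex_pair_map:
  assumes sq: "comm_square C f g u v" and k: "is_kernel_pair C u d c" "is_kernel_pair C v d' c'"
  obtains k where "pair_map C f d c d' c' k"
proof -
  note D = comm_squareD[OF sq] pullbackD[OF k(1)] pullbackD[OF k(2)]
  have "v \<odot> (f \<odot> d) = v \<odot> (f \<odot> c)"
    using D reassoc[of v f g u d] reassoc[of v f g u c] by simp
  then obtain h where "h \<in> Mor C" "Dom C h = Dom C (f \<odot> c)" "Cod C h = Dom C c'"
      "d' \<odot> h = f \<odot> d" "c' \<odot> h = f \<odot> c"
    using pullback_lift[OF k(2), of "f \<odot> d" "f \<odot> c"] D by auto
  then show ?thesis using D by (intro that[of h]) (auto simp: pair_map_def)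
qed

text \<open>Limits commute with limits: kernel pairs of the four objects of a pullback square in the arrow
  category again form a pullback square.\<close>

lemma pullback_pair_maps:
  assumes pb1: "is_pullback C g1 v1 p1 q1" and pb0: "is_pullback C g0 v0 p0 q0"
    and sq: "comm_square C c d g1 g0" "comm_square C b d v1 v0"
      "comm_square C r c p1 p0" "comm_square C r b q1 q0"
    and kb: "is_kernel_pair C b b1 b2" and kc: "is_kernel_pair C c c1 c2"
    and kd: "is_kernel_pair C d d1 d2" and kr: "is_kernel_pair C r r1 r2"
    and g: "pair_map C g1 c1 c2 d1 d2 g" and v: "pair_map C v1 b1 b2 d1 d2 v"
    and p: "pair_map C p1 r1 r2 c1 c2 p" and q: "pair_map C q1 r1 r2 b1 b2 q"
  shows "is_pullback C g v p q"
proof -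
  note D [simp] = pullbackD(1-8)[OF pb1] pullbackD(1-8)[OF pb0] pullbackD(1-4,6-8)[OF kb]
    pullbackD(1-4,6-8)[OF kc]
    pullbackD(1-4,6-8)[OF kd] pullbackD(1-4,6-8)[OF kr] comm_squareD(1-8)[OF sq(1)]
      comm_squareD(1-8)[OF sq(2)]
    comm_squareD(1-8)[OF sq(3)] comm_squareD(1-8)[OF sq(4)] pair_mapD(1-3)[OF g] pair_mapD(1-3)[OF v]
    pair_mapD(1-3)[OF p] pair_mapD(1-3)[OF q]
  note E = pullbackD(9)[OF pb1] pullbackD(9)[OF pb0] pullbackD(9)[OF kb] pullbackD(9)[OF kc]
    pullbackD(9)[OF kd] pullbackD(9)[OF kr] comm_squareD(9)[OF sq(1)] comm_squareD(9)[OF sq(2)]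
    comm_squareD(9)[OF sq(3)] comm_squareD(9)[OF sq(4)] pair_mapD(4,5)[OF g] pair_mapD(4,5)[OF v]
    pair_mapD(4,5)[OF p] pair_mapD(4,5)[OF q]
  show ?thesis
  proof (rule pullbackI)
    show "g \<odot> p = v \<odot> q"
    proof (rule pullback_unique[OF kd])
      show "d1 \<odot> (g \<odot> p) = d1 \<odot> (v \<odot> q)"
        using E by (simp add: reassoc[of d1 g g1 c1] reassoc[of d1 v v1 b1] reassoc[of g1 p1 v1 q1])
      show "d2 \<odot> (g \<odot> p) = d2 \<odot> (v \<odot> q)"
        using E by (simp add: reassoc[of d2 g g1 c2] reassoc[of d2 v v1 b2] reassoc[of g1 p1 v1 q1])
    qed simp_all
  next
    fix x y assume [simp]: "x \<in> Mor C" "y \<in> Mor C" "Dom C x = Dom C y" "Cod C x = Dom C g"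
      "Cod C y = Dom C v"
      and eq: "g \<odot> x = v \<odot> y"
    have "g1 \<odot> (c1 \<odot> x) = v1 \<odot> (b1 \<odot> y)"
      using E eq by (simp add: reassoc[of g1 c1 d1 g] reassoc[of v1 b1 d1 v])
    then obtain h1 where h1 [simp]: "h1 \<in> Mor C" "Dom C h1 = Dom C y" "Cod C h1 = Dom C r"
      "p1 \<odot> h1 = c1 \<odot> x" "q1 \<odot> h1 = b1 \<odot> y"
      using pullback_lift[OF pb1, of "c1 \<odot> x" "b1 \<odot> y"] by auto
    have "g1 \<odot> (c2 \<odot> x) = v1 \<odot> (b2 \<odot> y)"
      using E eq by (simp add: reassoc[of g1 c2 d2 g] reassoc[of v1 b2 d2 v])
    then obtain h2 where h2 [simp]: "h2 \<in> Mor C" "Dom C h2 = Dom C y" "Cod C h2 = Dom C r"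
      "p1 \<odot> h2 = c2 \<odot> x" "q1 \<odot> h2 = b2 \<odot> y"
      using pullback_lift[OF pb1, of "c2 \<odot> x" "b2 \<odot> y"] by auto
    \<comment> \<open>This lets the pair \<open>h1\<close>, \<open>h2\<close> factor through the
      kernel pair of \<open>r\<close>. It is tested with the jointly monic projections
      \<open>p0\<close> and \<open>q0\<close>.\<close>
    have "r \<odot> h1 = r \<odot> h2"
    proof (rule pullback_unique[OF pb0])
      show "p0 \<odot> (r \<odot> h1) = p0 \<odot> (r \<odot> h2)"
      proof -
        have "p0 \<odot> (r \<odot> h1) = c \<odot> (p1 \<odot> h1)" by (rule reassoc[OF E(9)[symmetric]]) simp_all
        also have "\<dots> = c \<odot> (c1 \<odot> x)" by (simp only: h1)
        also have "\<dots> = c \<odot> (c2 \<odot> x)" by (rule reassoc[OF E(4)]) simp_all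
        also have "\<dots> = c \<odot> (p1 \<odot> h2)" by (simp only: h2)
        also have "\<dots> = p0 \<odot> (r \<odot> h2)" by (rule reassoc[OF E(9)]) simp_all
        finally show ?thesis .
      qed
      show "q0 \<odot> (r \<odot> h1) = q0 \<odot> (r \<odot> h2)"
      proof -
        have "q0 \<odot> (r \<odot> h1) = b \<odot> (q1 \<odot> h1)" by (rule reassoc[OF E(10)[symmetric]]) simp_all
        also have "\<dots> = b \<odot> (b1 \<odot> y)" by (simp only: h1)
        also have "\<dots> = b \<odot> (b2 \<odot> y)" by (rule reassoc[OF E(3)]) simp_all
        also have "\<dots> = b \<odot> (q1 \<odot> h2)" by (simp only: h2)
        also have "\<dots> = q0 \<odot> (r \<odot> h2)" by (rule reassoc[OF E(10)]) simp_all
        finally show ?thesis .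
      qed
    qed simp_all
    then obtain h where h [simp]: "h \<in> Mor C" "Dom C h = Dom C y" "Cod C h = Dom C r2" "r1 \<odot> h = h1"
      "r2 \<odot> h = h2"
      using pullback_lift[OF kr, of h1 h2] by auto
    have "p \<odot> h = x"
      by (rule pullback_unique[OF kc]) (use E in
        \<open>simp_all add: reassoc[of c1 p p1 r1] reassoc[of c2 p p1 r2]\<close>)
    moreover have "q \<odot> h = y"
      by (rule pullback_unique[OF kb]) (use E in
        \<open>simp_all add: reassoc[of b1 q q1 r1] reassoc[of b2 q q1 r2]\<close>)
    ultimately show "\<exists>h. h \<in> Mor C \<and> Dom C h = Dom C y \<and> Cod C h = Dom C q \<and> p \<odot> h = x \<and> q \<odot> h = y"
      by (intro exI[of _ h]) simp
  next
    fix h h' assume [simp]: "h \<in> Mor C" "h' \<in> Mor C" "Dom C h = Dom C h'" "Cod C h = Dom C q"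
      "Cod C h' = Dom C q"
      and eq: "p \<odot> h = p \<odot> h'" "q \<odot> h = q \<odot> h'"
    have "r1 \<odot> h = r1 \<odot> h'"
      by (rule pullback_unique[OF pb1]) (use E eq in
        \<open>simp_all add: reassoc[of p1 r1 c1 p] reassoc[of q1 r1 b1 q]\<close>)
    moreover have "r2 \<odot> h = r2 \<odot> h'"
      by (rule pullback_unique[OF pb1]) (use E eq in
        \<open>simp_all add: reassoc[of p1 r2 c2 p] reassoc[of q1 r2 b2 q]\<close>)
    ultimately show "h = h'" using pullback_unique[OF kr, of h h'] by simp
  qed simp_all
qed

end

subsection \<open>Classes of extensions\<close>

context category
begin

lemma pullback_Idt:
  assumes "e \<in> Mor C"
  shows "is_pullback C e (Idt C (Cod C e)) (Idt C (Dom C e)) e"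
  by (rule pullbackI) (use assms in auto)

text \<open>Exhibits the composite of \<open>e\<close> with an isomorphism \<open>i\<close> as a
  pullback of \<open>e\<close> along the inverse of \<open>i\<close>, so that pullback stability
  covers such composites.\<close>

lemma pullback_inverse:
  assumes e: "e \<in> Mor C" "Dom C i = Cod C e"
    and i: "i \<in> Mor C" "j \<in> Mor C" "Dom C j = Cod C i" "Cod C j = Dom C i"
      "j \<odot> i = Idt C (Dom C i)" "i \<odot> j = Idt C (Cod C i)"
  shows "is_pullback C e j (Idt C (Dom C e)) (i \<odot> e)"
proof (rule pullbackI)
  show "e \<odot> Idt C (Dom C e) = j \<odot> (i \<odot> e)"
    using e i by (simp add: reassoc1[of j i])
next
  fix a b assume ab: "a \<in> Mor C" "b \<in> Mor C" "Dom C a = Dom C b" "Cod C a = Dom C e"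
    "Cod C b = Dom C j"
    "e \<odot> a = j \<odot> b"
  have "i \<odot> (e \<odot> a) = b" unfolding ab(6) using e i ab(1-5) by (simp add: reassoc1[of i j])
  then show "\<exists>h. h \<in> Mor C \<and> Dom C h = Dom C b \<and> Cod C h = Dom C (i \<odot> e) \<and>
      Idt C (Dom C e) \<odot> h = a \<and> (i \<odot> e) \<odot> h = b"
    using e i ab(1-5) by (intro exI[of _ a]) simp
qed (use e i in auto)

lemma comparisonI:
  "\<lbrakk>is_pullback C g v p q; w \<in> Mor C; Dom C w = Dom C f; Cod C w = Dom C q; p \<odot> w = u; q \<odot> w = f\<rbrakk>
    \<Longrightarrow> comparison C f g u v w"
  unfolding comparison_def using pullbackD(8) by (metis in_hom_set)

lemma comm_square_Cmp:
  assumes "comm_square C f g u v" "comm_square C g h u' v'"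
  shows "comm_square C f h (u' \<odot> u) (v' \<odot> v)"
proof -
  note D = comm_squareD[OF assms(1)] comm_squareD[OF assms(2)]
  have "h \<odot> (u' \<odot> u) = v' \<odot> (g \<odot> u)" using D(1-8,10-18) by (intro reassoc) simp_all
  then show ?thesis unfolding comm_square_def using D by simp
qed

lemma comm_square_Idt: "f \<in> Mor C \<Longrightarrow> comm_square C f f (Idt C (Dom C f)) (Idt C (Cod C f))"
  unfolding comm_square_def by simp

lemma comm_square_inverse:
  assumes sq: "comm_square C f g u v"
    and u: "u' \<in> Mor C" "Dom C u' = Cod C u" "Cod C u' = Dom C u" "u \<odot> u' = Idt C (Cod C u)"
    and v: "v' \<in> Mor C" "Dom C v' = Cod C v" "Cod C v' = Dom C v" "v' \<odot> v = Idt C (Dom C v)"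
  shows "comm_square C g f u' v'"
proof -
  note D = comm_squareD[OF sq]
  have "f \<odot> u' = (v' \<odot> v) \<odot> (f \<odot> u')" using D u v(4) by simp
  also have "\<dots> = v' \<odot> ((v \<odot> f) \<odot> u')" using D u v(1-3) by simp
  also have "\<dots> = v' \<odot> (g \<odot> (u \<odot> u'))" using D(1-8) D(9)[symmetric] u(1-3) by simp
  also have "\<dots> = v' \<odot> g" using D u v by simp
  finally show ?thesis unfolding comm_square_def using D u v by simp
qed

text \<open>Joint monicity of \<open>p0\<close> and \<open>q0\<close> forces the two lifts to be
  compatible. This is the common core of the componentwise pullbacks of arrows and of forks.\<close>

lemma comm_square_lift:
  assumes sq: "comm_square C r c p1 p0" "comm_square C r b q1 q0"
    and pb1: "is_pullback C g1 v1 p1 q1" and pb0: "is_pullback C g0 v0 p0 q0"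
    and x: "comm_square C z c x1 x0" and y: "comm_square C z b y1 y0"
    and h1: "h1 \<in> Mor C" "Dom C h1 = Dom C z" "Cod C h1 = Dom C r" "p1 \<odot> h1 = x1" "q1 \<odot> h1 = y1"
    and h0: "h0 \<in> Mor C" "Dom C h0 = Cod C z" "Cod C h0 = Cod C r" "p0 \<odot> h0 = x0" "q0 \<odot> h0 = y0"
  shows "comm_square C z r h1 h0"
proof -
  note [simp] = comm_squareD(1-8)[OF sq(1)] comm_squareD(1-8)[OF sq(2)] comm_squareD(1-8)[OF x]
    comm_squareD(1-8)[OF y] h1 h0
  have "r \<odot> h1 = h0 \<odot> z"
    by (rule pullback_unique[OF pb0])
      (simp_all add: reassoc[OF comm_squareD(9)[OF sq(1), symmetric]] reassoc1[OF h0(4)]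
        reassoc[OF comm_squareD(9)[OF sq(2), symmetric]] reassoc1[OF h0(5)] comm_squareD(9)[OF x]
          comm_squareD(9)[OF y])
  then show ?thesis unfolding comm_square_def by simp
qed

lemma ex_comm_square_pullback:
  assumes g: "comm_square C c d g1 g0" and v: "comm_square C b d v1 v0"
    and pb1: "is_pullback C g1 v1 p1 q1" and pb0: "is_pullback C g0 v0 p0 q0"
  obtains r where "comm_square C r c p1 p0" "comm_square C r b q1 q0"
proof -
  note [simp] = comm_squareD(1-8)[OF g] comm_squareD(1-8)[OF v] pullbackD(1-8)[OF pb1]
    pullbackD(1-8)[OF pb0]
  have "g0 \<odot> (c \<odot> p1) = d \<odot> (g1 \<odot> p1)"
    by (rule reassoc[OF comm_squareD(9)[OF g, symmetric]]) simp_all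
  also have "\<dots> = d \<odot> (v1 \<odot> q1)" by (simp only: pullbackD(9)[OF pb1])
  also have "\<dots> = v0 \<odot> (b \<odot> q1)"
    by (rule reassoc[OF comm_squareD(9)[OF v]]) simp_all
  finally obtain r where r: "r \<in> Mor C" "Dom C r = Dom C q1" "Cod C r = Dom C q0" "p0 \<odot> r = c \<odot> p1"
    "q0 \<odot> r = b \<odot> q1"
    using pullback_lift[OF pb0, of "c \<odot> p1" "b \<odot> q1"] by auto
  have "comm_square C r c p1 p0" "comm_square C r b q1 q0" unfolding comm_square_def using r
    by simp_all
  then show ?thesis by (rule that)
qed

text \<open>Functoriality of kernel pairs. Together with \<open>pair_map_unique\<close> it reduces
  equations between induced maps to equations between the maps that induce them.\<close>

lemma pair_map_Cmp:
  assumes "is_kernel_pair C r d c" "is_kernel_pair C r' d' c'" "is_kernel_pair C r'' d'' c''"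
    and "pair_map C u d c d' c' k" "pair_map C u' d' c' d'' c'' k'"
    and "u \<in> Mor C" "Dom C u = Dom C r" "Cod C u = Dom C r'"
    and "u' \<in> Mor C" "Dom C u' = Dom C r'" "Cod C u' = Dom C r''"
  shows "pair_map C (u' \<odot> u) d c d'' c'' (k' \<odot> k)"
proof -
  note D [simp] = pullbackD(1-4,6-8)[OF assms(1)] pullbackD(1-4,6-8)[OF assms(2)]
    pullbackD(1-4,6-8)[OF assms(3)] pair_mapD(1-3)[OF assms(4)] pair_mapD(1-3)[OF assms(5)] assms(6-)
  have "d'' \<odot> (k' \<odot> k) = u' \<odot> (u \<odot> d)"
    by (subst reassoc[OF pair_mapD(4)[OF assms(5)]]) (simp_all add: pair_mapD(4)[OF assms(4)])
  moreover have "c'' \<odot> (k' \<odot> k) = u' \<odot> (u \<odot> c)"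
    by (subst reassoc[OF pair_mapD(5)[OF assms(5)]]) (simp_all add: pair_mapD(5)[OF assms(4)])
  ultimately show ?thesis unfolding pair_map_def by simp
qed

lemma pair_map_unique:
  assumes "is_kernel_pair C r d' c'" "pair_map C u d c d' c' k" "pair_map C u d c d' c' k'"
  shows "k = k'"
  using pair_mapD[OF assms(2)] pair_mapD[OF assms(3)]
    by (intro pullback_unique[OF assms(1), of k k']) simp_all

end

section \<open>Axioms for a class of extensions and their first consequences\<close>

locale pullback_category = category +
  assumes ex_pullback: "\<lbrakk>f \<in> Mor C; g \<in> Mor C; Cod C f = Cod C g\<rbrakk> \<Longrightarrow> \<exists>p q. is_pullback C f g p q"
begin

lemma ex_comparison:
  assumes "comm_square C f g u v"
  obtains w where "comparison C f g u v w"
proof -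
  note D = comm_squareD[OF assms]
  obtain p q where pb: "is_pullback C g v p q" using ex_pullback D by metis
  then obtain w where "w \<in> Mor C" "Dom C w = Dom C f" "Cod C w = Dom C q" "p \<odot> w = u" "q \<odot> w = f"
    using pullback_lift[OF pb, of u f] D by auto
  then show ?thesis using that comparisonI pb by metis
qed

end

text \<open>\<open>E\<close> is the class of extensions. Since double extensions are stable under pullback only along
  morphisms between extensions, a class \<open>P\<close> of objects is carried along; for the arrow category
  it consists of the extensions of the previous level. The last axiom is the relative Mal'tsev axiom.\<close>

locale relative_maltsev = pullback_category C for C :: "('o, 'm) precat" (structure) +
  fixes P :: "'o \<Rightarrow> bool" and E :: "'m \<Rightarrow> bool"
  assumes E_Mor: "E e \<Longrightarrow> e \<in> Mor C"
    and E_Dom: "E e \<Longrightarrow> P (Dom C e)"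
    and E_Cod: "E e \<Longrightarrow> P (Cod C e)"
    and P_iso: "\<lbrakk>is_iso C i; P (Dom C i)\<rbrakk> \<Longrightarrow> P (Cod C i)"
    and E_pullback: "\<lbrakk>is_pullback C e g p q; E e; P (Dom C g)\<rbrakk> \<Longrightarrow> E q"
    and E_Cmp: "\<lbrakk>E e; E e'; Dom C e' = Cod C e\<rbrakk> \<Longrightarrow> E (e' \<odot> e)"
    and E_comparison: "\<lbrakk>comm_square C f g u v; E f; E g; E u; E v; is_kernel_pair C u d c;
      is_kernel_pair C v d' c'; pair_map C f d c d' c' k; E k; comparison C f g u v w\<rbrakk> \<Longrightarrow> E w"
begin

lemma E_pullback': "\<lbrakk>is_pullback C g e p q; E e; P (Dom C g)\<rbrakk> \<Longrightarrow> E p"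
  using E_pullback pullback_sym by blast

text \<open>The axioms do not make isomorphisms extensions, so \<open>E_Cmp\<close> does not apply;
  instead \<open>e \<odot> i\<close> is a pullback of \<open>e\<close> along an identity.\<close>

lemma E_Cmp_iso_right: "\<lbrakk>E e; is_iso C i; Cod C i = Dom C e\<rbrakk> \<Longrightarrow> E (e \<odot> i)"
  using pullback_Cmp_iso[OF pullback_Idt, of e i] E_pullback[of e "Idt C (Cod C e)"] E_Mor E_Cod
    by simp

lemma E_Cmp_iso_left:
  assumes "E e" "is_iso C i" "Dom C i = Cod C e"
  shows "E (i \<odot> e)"
proof -
  obtain j where j: "i \<in> Mor C" "j \<in> Mor C" "Dom C j = Cod C i" "Cod C j = Dom C i"
    "j \<odot> i = Idt C (Dom C i)" "i \<odot> j = Idt C (Cod C i)" using assms(2) by (rule isoE)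
  show ?thesis
    using pullback_inverse[OF _ _ j] E_pullback[of e j] assms P_iso E_Mor E_Cod j by metis
qed

lemma E_iso_square:
  assumes sq: "comm_square C f g u v" and iso: "is_iso C u" "is_iso C v" and "E f"
  shows "E g"
proof -
  note D = comm_squareD[OF sq]
  obtain w where w: "w \<in> Mor C" "Dom C w = Cod C u" "Cod C w = Dom C u"
    "w \<odot> u = Idt C (Dom C u)" "u \<odot> w = Idt C (Cod C u)" using iso(1) by (rule isoE)
  have "is_iso C w" using w D by (intro isoI[of w u]) simp_all
  then have "E (f \<odot> w)" using \<open>E f\<close> w D by (intro E_Cmp_iso_right) simp_all
  then have "E (v \<odot> (f \<odot> w))" by (rule E_Cmp_iso_left[OF _ iso(2)]) (use D(1-8) w in simp)
  also have "v \<odot> (f \<odot> w) = g"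
    using D w reassoc[OF D(9)[symmetric], of w] by simp
  finally show ?thesis .
qed

text \<open>The converse of \<open>E_comparison\<close>. In terms of elements, let T consist of the
  (x, y) with v f x = v y. Sending (x, x') to (x, f x') is a map \<open>m\<close> from the kernel
  pair of \<open>u\<close> to T, sending (x, y) to (f x, y) is a map \<open>l\<close> from T to the
  kernel pair of \<open>v\<close>, and \<open>l \<odot> m\<close> is \<open>k\<close>. Now
  \<open>m\<close> is a pullback of the comparison \<open>w\<close> and \<open>l\<close> is a
  pullback of \<open>f\<close>.\<close>

lemma E_pair_map:
  assumes sq: "comm_square C f g u v" and E: "E f" "E v" "E w"
    and ku: "is_kernel_pair C u d c" and kv: "is_kernel_pair C v d' c'"
    and k: "pair_map C f d c d' c' k" and comp: "comparison C f g u v w"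
  shows "E k"
proof -
  obtain p q where pb: "is_pullback C g v p q"
    and w: "w \<in> hom_set C (Dom C f) (Dom C p)" "p \<odot> w = u" "q \<odot> w = f"
    using comp unfolding comparison_def by auto
  note D [simp] = comm_squareD(1-8)[OF sq] pullbackD(1-4,6-8)[OF ku] pullbackD(1-4,6-8)[OF kv]
    pullbackD(1-4,6-8)[OF pb]
    pair_mapD(1-3)[OF k]
  note Eq = comm_squareD(9)[OF sq] pullbackD(9)[OF ku] pullbackD(9)[OF kv] pullbackD(9)[OF pb]
    pair_mapD(4,5)[OF k]
  have [simp]: "w \<in> Mor C" "Dom C w = Dom C f" "Cod C w = Dom C q" using w by simp_all
  obtain s t where st: "is_pullback C (v \<odot> f) v s t" using ex_pullback[of "v \<odot> f" v] by auto
  have [simp]: "s \<in> Mor C" "t \<in> Mor C" "Cod C s = Dom C f" "Cod C t = Cod C f" "Dom C s = Dom C t"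
    using pullbackD(1-8)[OF st] by simp_all
  have vfs: "v \<odot> (f \<odot> s) = v \<odot> t" using pullbackD(9)[OF st] by simp
  \<comment> \<open>Side conditions of \<open>E_pullback\<close>: the two pullbacks below are taken
    along \<open>n\<close>, whose domain is T, and along \<open>d'\<close>.\<close>
  have Pd: "P (Dom C d')" and Pt: "P (Dom C t)"
    using E_pullback[OF kv] E_pullback'[OF st] E E_Cod[OF E(1)] E_Dom[OF E(1)] E_Dom[of c']
      E_Dom[of s] by simp_all
  have gus: "g \<odot> (u \<odot> s) = v \<odot> t" using vfs by (simp add: reassoc[OF Eq(1)])
  obtain n where n [simp]: "n \<in> Mor C" "Dom C n = Dom C t" "Cod C n = Dom C q" "p \<odot> n = u \<odot> s"
    "q \<odot> n = t"
    using pullback_lift[OF pb, of "u \<odot> s" t] gus by auto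
  have vfd: "v \<odot> (f \<odot> x) = v \<odot> (f \<odot> y)" if "x \<in> Mor C" "y \<in> Mor C" "Dom C x = Dom C y"
    "Cod C x = Dom C f"
    "Cod C y = Dom C f" "u \<odot> x = u \<odot> y" for x y
    using that by (simp add: reassoc[OF Eq(1)[symmetric]])
  obtain m where m [simp]: "m \<in> Mor C" "Dom C m = Dom C c" "Cod C m = Dom C t" "s \<odot> m = d"
    "t \<odot> m = f \<odot> c"
    using pullback_lift[OF st, of d "f \<odot> c"] vfd[of d c] Eq(2) by auto
  obtain l where l [simp]: "l \<in> Mor C" "Dom C l = Dom C t" "Cod C l = Dom C c'" "d' \<odot> l = f \<odot> s"
    "c' \<odot> l = t"
    using pullback_lift[OF kv, of "f \<odot> s" t] vfs by auto
  \<comment> \<open>The map \<open>n\<close> sends (x, y) to (u x, y). Hence w x' = n (x, y) means u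
    x' = u x and y = f x', so that x' and (x, y) amount to a point (x, x') of the kernel pair of
    \<open>u\<close>.\<close>
  have "is_pullback C w n c m"
  proof (rule pullbackI)
    show "w \<odot> c = n \<odot> m"
      by (rule pullback_unique[OF pb])
        (simp_all add: reassoc1[OF w(2)] reassoc1[OF w(3)] reassoc1[OF n(5)] reassoc[of p n u s]
          Eq(2))
  next
    fix a x assume ax [simp]: "a \<in> Mor C" "x \<in> Mor C" "Dom C a = Dom C x" "Cod C a = Dom C w"
      "Cod C x = Dom C n"
      and eq: "w \<odot> a = n \<odot> x"
    have 1: "u \<odot> (s \<odot> x) = u \<odot> a"
      using arg_cong[OF eq, of "\<lambda>z. p \<odot> z"] by (simp add: reassoc1[OF w(2)] reassoc[OF n(4)])
    have 2: "f \<odot> a = t \<odot> x"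
      using arg_cong[OF eq, of "\<lambda>z. q \<odot> z"] by (simp add: reassoc1[OF w(3)] reassoc1[OF n(5)])
    obtain h where h [simp]: "h \<in> Mor C" "Dom C h = Dom C x" "Cod C h = Dom C c" "d \<odot> h = s \<odot> x"
      "c \<odot> h = a"
      using pullback_lift[OF ku, of "s \<odot> x" a] 1 by auto
    have "m \<odot> h = x"
      by (rule pullback_unique[OF st]) (simp_all add: reassoc1[OF m(4)] reassoc[OF m(5)] 2)
    then show "\<exists>h. h \<in> Mor C \<and> Dom C h = Dom C x \<and> Cod C h = Dom C m \<and> c \<odot> h = a \<and> m \<odot> h = x"
      by (intro exI[of _ h]) simp
  next
    fix h h' assume hh [simp]: "h \<in> Mor C" "h' \<in> Mor C" "Dom C h = Dom C h'" "Cod C h = Dom C m"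
      "Cod C h' = Dom C m"
      and eq: "c \<odot> h = c \<odot> h'" "m \<odot> h = m \<odot> h'"
    have "d \<odot> h = d \<odot> h'"
      using arg_cong[OF eq(2), of "\<lambda>z. s \<odot> z"] by (simp add: reassoc1[OF m(4)])
    then show "h = h'" using pullback_unique[OF ku, of h h'] eq by simp
  qed simp_all
  then have "E m" using E_pullback E(3) Pt by simp
  have "is_pullback C f d' s l"
  proof (rule pullbackI)
    fix a x assume ax [simp]: "a \<in> Mor C" "x \<in> Mor C" "Dom C a = Dom C x" "Cod C a = Dom C f"
      "Cod C x = Dom C d'"
      and eq: "f \<odot> a = d' \<odot> x"
    have "v \<odot> (f \<odot> a) = v \<odot> (c' \<odot> x)" by (simp add: eq reassoc[OF Eq(3)])
    then obtain h where h [simp]: "h \<in> Mor C" "Dom C h = Dom C x" "Cod C h = Dom C t" "s \<odot> h = a"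
      "t \<odot> h = c' \<odot> x"
      using pullback_lift[OF st, of a "c' \<odot> x"] by auto
    have "l \<odot> h = x"
      by (rule pullback_unique[OF kv]) (simp_all add: reassoc1[OF l(5)] reassoc[OF l(4)] eq)
    then show "\<exists>h. h \<in> Mor C \<and> Dom C h = Dom C x \<and> Cod C h = Dom C l \<and> s \<odot> h = a \<and> l \<odot> h = x"
      by (intro exI[of _ h]) simp
  next
    fix h h' assume hh [simp]: "h \<in> Mor C" "h' \<in> Mor C" "Dom C h = Dom C h'" "Cod C h = Dom C l"
      "Cod C h' = Dom C l"
      and eq: "s \<odot> h = s \<odot> h'" "l \<odot> h = l \<odot> h'"
    have "t \<odot> h = t \<odot> h'"
      using arg_cong[OF eq(2), of "\<lambda>z. c' \<odot> z"] by (simp add: reassoc1[OF l(5)])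
    then show "h = h'" using pullback_unique[OF st, of h h'] eq by simp
  qed simp_all
  then have "E l" using E_pullback E(1) Pd by simp
  have "l \<odot> m = k"
    by (rule pullback_unique[OF kv]) (simp_all add: reassoc1[OF l(5)] reassoc[OF l(4)] Eq)
  then show ?thesis using E_Cmp[OF \<open>E m\<close> \<open>E l\<close>] by simp
qed

end

subsection \<open>Arrow categories\<close>

locale cell_category = category C for C :: "('o, 'm) cell_cat" (structure)
begin

lemma Obj_Arr [simp]: "Obj (Arr C) = Mor C"
  and Square_Mor_Arr [simp]: "Square f g u v \<in> Mor (Arr C) \<longleftrightarrow> comm_square C f g u v"
  and Dom_Arr [simp]: "Dom (Arr C) (Square f g u v) = f"
  and Cod_Arr [simp]: "Cod (Arr C) (Square f g u v) = g"
  and Idt_Arr [simp]: "Idt (Arr C) f = Square f f (Idt C (Dom C f)) (Idt C (Cod C f))"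
  and Cmp_Arr [simp]: "Square g' h u' v' \<odot>\<^bsub>Arr C\<^esub> Square f g u v = Square f h (u' \<odot> u) (v' \<odot> v)"
  by (auto simp: Arr_def comm_square_def)

lemma Mor_ArrE:
  assumes "x \<in> Mor (Arr C)"
  obtains f g u v where "x = Square f g u v" "comm_square C f g u v"
  using assms by (auto simp: Arr_def comm_square_def)

lemma category_Arr: "category (Arr C)"
proof (unfold_locales, goal_cases)
  case (4 f g)
  then show ?case by (auto elim!: Mor_ArrE intro: comm_square_Cmp)
next
  case (7 f g h)
  then show ?case by (auto elim!: Mor_ArrE simp: comm_square_def)
qed (auto elim!: Mor_ArrE simp: comm_square_def)

end

sublocale cell_category \<subseteq> Arr: category "Arr C"
  by (rule category_Arr)

context cell_category
begin

lemma iso_Arr_iff: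
  "is_iso (Arr C) (Square f g u v) \<longleftrightarrow> comm_square C f g u v \<and> is_iso C u \<and> is_iso C v"
proof safe
  assume "is_iso (Arr C) (Square f g u v)"
  then obtain y where y: "Square f g u v \<in> Mor (Arr C)" "y \<in> Mor (Arr C)" "Dom (Arr C) y = g"
    "Cod (Arr C) y = f"
    "y \<odot>\<^bsub>Arr C\<^esub> Square f g u v = Idt (Arr C) f" "Square f g u v \<odot>\<^bsub>Arr C\<^esub> y = Idt (Arr C) g"
    using Arr.isoE by (metis Dom_Arr Cod_Arr)
  then obtain u' v' where y': "y = Square g f u' v'" "comm_square C g f u' v'"
    by (metis Mor_ArrE Dom_Arr Cod_Arr)
  show "comm_square C f g u v" using y by simp
  show "is_iso C u" using y y' by (intro isoI[of u u']) (auto simp: comm_square_def)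
  show "is_iso C v" using y y' by (intro isoI[of v v']) (auto simp: comm_square_def)
next
  assume sq: "comm_square C f g u v" and "is_iso C u" "is_iso C v"
  then obtain u' v' where u: "u \<in> Mor C" "u' \<in> Mor C" "Dom C u' = Cod C u" "Cod C u' = Dom C u"
    "u' \<odot> u = Idt C (Dom C u)" "u \<odot> u' = Idt C (Cod C u)"
    and v: "v \<in> Mor C" "v' \<in> Mor C" "Dom C v' = Cod C v" "Cod C v' = Dom C v"
    "v' \<odot> v = Idt C (Dom C v)" "v \<odot> v' = Idt C (Cod C v)"
    by (metis isoE)
  note D = comm_squareD[OF sq]
  have "comm_square C g f u' v'" by (rule comm_square_inverse[OF sq]) (use u v in simp_all)
  then show "is_iso (Arr C) (Square f g u v)"
    using sq D u v by (intro Arr.isoI[of _ "Square g f u' v'"]) simp_all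
qed

lemma pullback_ArrI:
  assumes sq: "comm_square C c d g1 g0" "comm_square C b d v1 v0"
      "comm_square C r c p1 p0" "comm_square C r b q1 q0"
    and pb1: "is_pullback C g1 v1 p1 q1" and pb0: "is_pullback C g0 v0 p0 q0"
  shows "is_pullback (Arr C) (Square c d g1 g0) (Square b d v1 v0) (Square r c p1 p0)
    (Square r b q1 q0)"
proof (rule Arr.pullbackI)
  note D [simp] = pullbackD(1-8)[OF pb1] pullbackD(1-8)[OF pb0] comm_squareD(1-8)[OF sq(1)]
    comm_squareD(1-8)[OF sq(2)]
    comm_squareD(1-8)[OF sq(3)] comm_squareD(1-8)[OF sq(4)]
  fix x y assume "x \<in> Mor (Arr C)" "y \<in> Mor (Arr C)" "Dom (Arr C) x = Dom (Arr C) y"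
    "Cod (Arr C) x = Dom (Arr C) (Square c d g1 g0)" "Cod (Arr C) y = Dom (Arr C) (Square b d v1 v0)"
    and eq: "Square c d g1 g0 \<odot>\<^bsub>Arr C\<^esub> x = Square b d v1 v0 \<odot>\<^bsub>Arr C\<^esub> y"
  then obtain z x1 x0 y1 y0 where xy: "x = Square z c x1 x0" "y = Square z b y1 y0"
    and x: "comm_square C z c x1 x0" and y: "comm_square C z b y1 y0"
    by (metis Mor_ArrE Dom_Arr Cod_Arr)
  note [simp] = comm_squareD(1-8)[OF x] comm_squareD(1-8)[OF y]
  obtain h1 where h1 [simp]: "h1 \<in> Mor C" "Dom C h1 = Dom C y1" "Cod C h1 = Dom C q1" "p1 \<odot> h1 = x1"
    "q1 \<odot> h1 = y1"
    by (rule pullback_lift[OF pb1, of x1 y1]) (use eq xy in auto)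
  obtain h0 where h0 [simp]: "h0 \<in> Mor C" "Dom C h0 = Dom C y0" "Cod C h0 = Dom C q0" "p0 \<odot> h0 = x0"
    "q0 \<odot> h0 = y0"
    by (rule pullback_lift[OF pb0, of x0 y0]) (use eq xy in auto)
  have "comm_square C z r h1 h0" by (rule comm_square_lift[OF sq(3,4) pb1 pb0 x y]) simp_all
  then show "\<exists>h. h \<in> Mor (Arr C) \<and> Dom (Arr C) h = Dom (Arr C) y \<and> Cod (Arr C) h
    = Dom (Arr C) (Square r b q1 q0) \<and>
      Square r c p1 p0 \<odot>\<^bsub>Arr C\<^esub> h = x \<and> Square r b q1 q0 \<odot>\<^bsub>Arr C\<^esub> h = y"
    by (intro exI[of _ "Square z r h1 h0"]) (simp add: xy)
next
  note D = pullbackD[OF pb1] pullbackD[OF pb0]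
  fix h h' assume "h \<in> Mor (Arr C)" "h' \<in> Mor (Arr C)" "Dom (Arr C) h = Dom (Arr C) h'"
    "Cod (Arr C) h = Dom (Arr C) (Square r b q1 q0)" "Cod (Arr C) h' = Dom (Arr C) (Square r b q1 q0)"
    and eq: "Square r c p1 p0 \<odot>\<^bsub>Arr C\<^esub> h = Square r c p1 p0 \<odot>\<^bsub>Arr C\<^esub> h'"
    "Square r b q1 q0 \<odot>\<^bsub>Arr C\<^esub> h = Square r b q1 q0 \<odot>\<^bsub>Arr C\<^esub> h'"
  then obtain z h1 h0 h1' h0' where hh: "h = Square z r h1 h0" "h' = Square z r h1' h0'"
    and "comm_square C z r h1 h0" "comm_square C z r h1' h0'"
    by (metis Mor_ArrE Dom_Arr Cod_Arr)
  moreover from this have "h1 = h1'"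
    using eq comm_squareD[OF sq(3)] comm_squareD[OF sq(4)] comm_squareD[of C z r]
    by (intro pullback_unique[OF pb1, of h1 h1']) auto
  moreover from calculation have "h0 = h0'"
    using eq comm_squareD[OF sq(3)] comm_squareD[OF sq(4)] comm_squareD[of C z r]
    by (intro pullback_unique[OF pb0, of h0 h0']) auto
  ultimately show "h = h'" by simp
qed (use sq pullbackD[OF pb1] pullbackD[OF pb0] in auto)

end

locale cell_pullbacks = pullback_category C for C :: "('o, 'm) cell_cat" (structure)

sublocale cell_pullbacks \<subseteq> cell_category ..

context cell_pullbacks
begin

lemma ex_pullback_Arr:
  assumes g: "comm_square C c d g1 g0" and v: "comm_square C b d v1 v0"
  obtains r p1 p0 q1 q0 where
    "comm_square C r c p1 p0" "comm_square C r b q1 q0"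
    "is_pullback C g1 v1 p1 q1" "is_pullback C g0 v0 p0 q0"
    "is_pullback (Arr C) (Square c d g1 g0) (Square b d v1 v0) (Square r c p1 p0) (Square r b q1 q0)"
proof -
  note [simp] = comm_squareD(1-8)[OF g] comm_squareD(1-8)[OF v]
  obtain p1 q1 where pb1: "is_pullback C g1 v1 p1 q1" using ex_pullback[of g1 v1] by auto
  obtain p0 q0 where pb0: "is_pullback C g0 v0 p0 q0" using ex_pullback[of g0 v0] by auto
  obtain r where "comm_square C r c p1 p0" "comm_square C r b q1 q0"
    using ex_comm_square_pullback[OF g v pb1 pb0] .
  then show ?thesis using pb1 pb0 pullback_ArrI[OF g v _ _ pb1 pb0] by (intro that)
qed

lemma pullback_category_Arr: "pullback_category (Arr C)"
proof unfold_locales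
  fix f g assume "f \<in> Mor (Arr C)" "g \<in> Mor (Arr C)" "Cod (Arr C) f = Cod (Arr C) g"
  then obtain c d g1 g0 b v1 v0 where "f = Square c d g1 g0" "comm_square C c d g1 g0"
      "g = Square b d v1 v0" "comm_square C b d v1 v0"
    by (metis Mor_ArrE Cod_Arr)
  then show "\<exists>p q. is_pullback (Arr C) f g p q" using ex_pullback_Arr by metis
qed

text \<open>Two pullbacks of one cospan are isomorphic, and an isomorphism of arrows is an
  isomorphism in each component; so the componentwise pullback of \<open>ex_pullback_Arr\<close> can
  be carried over to the given one.\<close>

lemma pullback_ArrE:
  assumes "is_pullback (Arr C) g v p q"
  obtains b c d r g1 g0 v1 v0 p1 p0 q1 q0 where
    "g = Square c d g1 g0" "v = Square b d v1 v0" "p = Square r c p1 p0" "q = Square r b q1 q0"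
    "comm_square C c d g1 g0" "comm_square C b d v1 v0" "comm_square C r c p1 p0"
      "comm_square C r b q1 q0"
    "is_pullback C g1 v1 p1 q1" "is_pullback C g0 v0 p0 q0"
proof -
  note D = Arr.pullbackD[OF assms]
  obtain c d g1 g0 where g: "g = Square c d g1 g0" "comm_square C c d g1 g0"
    using D(1) by (rule Mor_ArrE)
  obtain b v1 v0 where v: "v = Square b d v1 v0" "comm_square C b d v1 v0"
    using D(2,5) g by (metis Mor_ArrE Cod_Arr)
  obtain r p1 p0 where p: "p = Square r c p1 p0" "comm_square C r c p1 p0"
    using D(3,6) g by (metis Mor_ArrE Cod_Arr Dom_Arr)
  obtain q1 q0 where q: "q = Square r b q1 q0" "comm_square C r b q1 q0"
    using D(4,7,8) v p by (metis Mor_ArrE Cod_Arr Dom_Arr)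
  obtain r' p1' p0' q1' q0' where pb: "comm_square C r' c p1' p0'" "comm_square C r' b q1' q0'"
    "is_pullback C g1 v1 p1' q1'" "is_pullback C g0 v0 p0' q0'"
      and pb': "is_pullback (Arr C) g v (Square r' c p1' p0') (Square r' b q1' q0')"
    using ex_pullback_Arr[OF g(2) v(2)] g v by metis
  obtain i where i: "is_iso (Arr C) i" "Dom (Arr C) i = r" "Cod (Arr C) i = r'"
    "Square r' c p1' p0' \<odot>\<^bsub>Arr C\<^esub> i = p" "Square r' b q1' q0' \<odot>\<^bsub>Arr C\<^esub> i = q"
    using Arr.pullback_iso[OF pb' assms] q by auto
  then obtain i1 i0 where i': "i = Square r r' i1 i0"
    unfolding is_iso_def by (metis Mor_ArrE Dom_Arr Cod_Arr)
  have "is_iso C i1" "is_iso C i0" "comm_square C r r' i1 i0" using i(1) unfolding i' iso_Arr_iff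
    by auto
  moreover have "p1 = p1' \<odot> i1" "p0 = p0' \<odot> i0" "q1 = q1' \<odot> i1" "q0 = q0' \<odot> i0"
    using i(4,5) p(1) q(1) unfolding i' by auto
  ultimately have "is_pullback C g1 v1 p1 q1" "is_pullback C g0 v0 p0 q0"
    using pullback_Cmp_iso[OF pb(3)] pullback_Cmp_iso[OF pb(4)] comm_squareD(6,8)
      comm_squareD(5,7)[OF pb(2)] by metis+
  with g v p q show ?thesis by (intro that)
qed

end

sublocale cell_pullbacks \<subseteq> Arr: pullback_category "Arr C"
  by (rule pullback_category_Arr)

section \<open>Double extensions\<close>

definition double_ext :: "('o, 'm) precat \<Rightarrow> ('m \<Rightarrow> bool) \<Rightarrow> 'm \<Rightarrow> 'm \<Rightarrow> 'm \<Rightarrow> 'm \<Rightarrow> bool" where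
  "double_ext C E f g u v \<longleftrightarrow> comm_square C f g u v \<and> E f \<and> E g \<and> E u \<and> E v \<and>
     (\<exists>w. comparison C f g u v w \<and> E w)"

definition arr_ext :: "('o, 'm) cell_cat \<Rightarrow> (('o, 'm) cell \<Rightarrow> bool) \<Rightarrow> ('o, 'm) cell \<Rightarrow> bool" where
  "arr_ext C E x \<longleftrightarrow> (\<exists>f g u v. x = Square f g u v \<and> double_ext C E f g u v)"

lemma arr_ext_Square [simp]: "arr_ext C E (Square f g u v) \<longleftrightarrow> double_ext C E f g u v"
  unfolding arr_ext_def by simp

locale cell_relative_maltsev = relative_maltsev C P E for C :: "('o, 'm) cell_cat" (structure) and P E

sublocale cell_relative_maltsev \<subseteq> cell_pullbacks C ..

context cell_relative_maltsev
begin

text \<open>Let T be the pullback of \<open>d\<close> and \<open>g0\<close>, and S that of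
  \<open>b\<close> and \<open>q0\<close>. The comparison \<open>y\<close> into S is a pullback of
  the comparison \<open>x\<close> into T, along the induced map \<open>n\<close> from S to T. Then
  \<open>r\<close> is an extension too, as \<open>t \<odot> y\<close> with \<open>t\<close> a
  pullback of \<open>b\<close>.\<close>

lemma double_ext_pullback:
  assumes e: "double_ext C E c d g1 g0" and v: "comm_square C b d v1 v0" "E b"
    and sq: "comm_square C r c p1 p0" "comm_square C r b q1 q0"
    and pb1: "is_pullback C g1 v1 p1 q1" and pb0: "is_pullback C g0 v0 p0 q0"
  shows "double_ext C E r b q1 q0"
proof -
  have g: "comm_square C c d g1 g0" using e unfolding double_ext_def by auto
  note D [simp] = pullbackD(1-8)[OF pb1] pullbackD(1-8)[OF pb0] comm_squareD(1-8)[OF g]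
    comm_squareD(1-8)[OF v(1)]
    comm_squareD(1-8)[OF sq(1)] comm_squareD(1-8)[OF sq(2)]
  note Eq = pullbackD(9)[OF pb1] pullbackD(9)[OF pb0] comm_squareD(9)[OF g] comm_squareD(9)[OF v(1)]
    comm_squareD(9)[OF sq(1)] comm_squareD(9)[OF sq(2)]
  obtain x where x: "comparison C c d g1 g0 x" "E x" using e unfolding double_ext_def by auto
  then obtain \<tau>1 \<tau>2 where T: "is_pullback C d g0 \<tau>1 \<tau>2" and x': "x \<in> hom_set C (Dom C c) (Dom C \<tau>1)"
    "\<tau>1 \<odot> x = g1" "\<tau>2 \<odot> x = c" unfolding comparison_def by auto
  note [simp] = pullbackD(1-4,6-8)[OF T]
  have [simp]: "x \<in> Mor C" "Dom C x = Dom C c" "Cod C x = Dom C \<tau>2" using x' by simp_all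
  have q: "E q1" "E q0"
    using E_pullback[OF pb1] E_pullback[OF pb0] E_Dom[of b] E_Cod[of b] v(2) e
      unfolding double_ext_def by simp_all
  obtain s t where S: "is_pullback C b q0 s t" using ex_pullback[of b q0] by auto
  note [simp] = pullbackD(1-4,6-8)[OF S]
  have "E s" using E_pullback'[OF S] q(2) E_Dom[OF v(2)] by simp
  then have PS: "P (Dom C t)" using E_Dom[of s] by simp
  have Et: "E t" using E_pullback[OF S] v(2) E_Dom[OF q(2)] by simp
  obtain y where y [simp]: "y \<in> Mor C" "Dom C y = Dom C r" "Cod C y = Dom C t" "s \<odot> y = q1"
    "t \<odot> y = r"
    using pullback_lift[OF S, of q1 r] Eq(6) by auto
  have "d \<odot> (v1 \<odot> s) = v0 \<odot> (b \<odot> s)" by (rule reassoc[OF Eq(4)]) simp_all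
  also have "\<dots> = v0 \<odot> (q0 \<odot> t)" by (simp only: pullbackD(9)[OF S])
  also have "\<dots> = g0 \<odot> (p0 \<odot> t)" by (rule reassoc[OF Eq(2)[symmetric]]) simp_all
  finally obtain n where n [simp]: "n \<in> Mor C" "Dom C n = Dom C t" "Cod C n = Dom C \<tau>2"
    "\<tau>1 \<odot> n = v1 \<odot> s" "\<tau>2 \<odot> n = p0 \<odot> t"
    using pullback_lift[OF T, of "v1 \<odot> s" "p0 \<odot> t"] by auto
  have "is_pullback C x n p1 y"
  proof (rule pullbackI)
    show "x \<odot> p1 = n \<odot> y"
      by (rule pullback_unique[OF T])
        (simp_all add: reassoc1[OF x'(2)] reassoc1[OF x'(3)] reassoc[OF n(4)] reassoc[OF n(5)] Eq)
  next
    fix \<alpha> \<beta> assume [simp]: "\<alpha> \<in> Mor C" "\<beta> \<in> Mor C" "Dom C \<alpha> = Dom C \<beta>" "Cod C \<alpha> = Dom C x"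
      "Cod C \<beta> = Dom C n"
      and eq: "x \<odot> \<alpha> = n \<odot> \<beta>"
    have 1: "g1 \<odot> \<alpha> = v1 \<odot> (s \<odot> \<beta>)"
      using arg_cong[OF eq, of "\<lambda>z. \<tau>1 \<odot> z"] by (simp add: reassoc1[OF x'(2)] reassoc[OF n(4)])
    have 2: "c \<odot> \<alpha> = p0 \<odot> (t \<odot> \<beta>)"
      using arg_cong[OF eq, of "\<lambda>z. \<tau>2 \<odot> z"] by (simp add: reassoc1[OF x'(3)] reassoc[OF n(5)])
    obtain h where h [simp]: "h \<in> Mor C" "Dom C h = Dom C \<beta>" "Cod C h = Dom C q1" "p1 \<odot> h = \<alpha>"
      "q1 \<odot> h = s \<odot> \<beta>"
      using pullback_lift[OF pb1, of \<alpha> "s \<odot> \<beta>"] 1 by auto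
    have "t \<odot> (y \<odot> h) = t \<odot> \<beta>"
      by (rule pullback_unique[OF pb0])
        (simp_all add: reassoc1[OF y(5)] reassoc[OF Eq(5)[symmetric]] reassoc[OF Eq(6)[symmetric]]
           reassoc[OF pullbackD(9)[OF S]] 2)
    then have "y \<odot> h = \<beta>"
      by (intro pullback_unique[OF S, of "y \<odot> h" \<beta>]) (simp_all add: reassoc1[OF y(4)])
    then show "\<exists>h. h \<in> Mor C \<and> Dom C h = Dom C \<beta> \<and> Cod C h = Dom C y \<and> p1 \<odot> h = \<alpha> \<and> y \<odot> h = \<beta>"
      by (intro exI[of _ h]) simp
  next
    fix h h' assume [simp]: "h \<in> Mor C" "h' \<in> Mor C" "Dom C h = Dom C h'" "Cod C h = Dom C y"
      "Cod C h' = Dom C y"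
      and eq: "p1 \<odot> h = p1 \<odot> h'" "y \<odot> h = y \<odot> h'"
    have "q1 \<odot> h = q1 \<odot> h'"
      using arg_cong[OF eq(2), of "\<lambda>z. s \<odot> z"] by (simp add: reassoc1[OF y(4)])
    then show "h = h'" using pullback_unique[OF pb1, of h h'] eq by simp
  qed simp_all
  then have Ey: "E y" using E_pullback x(2) PS by simp
  then have "E r" using E_Cmp[OF Ey Et] by simp
  moreover have "comparison C r b q1 q0 y" by (rule comparisonI[OF S]) simp_all
  ultimately show ?thesis unfolding double_ext_def using sq(2) v(2) q Ey by auto
qed

text \<open>The comparison of the pasted square is \<open>x \<odot> w1\<close>, where
  \<open>x\<close> goes from the pullback for the first square to the one for the pasted square and
  is itself a pullback of the second comparison \<open>w2\<close>.\<close>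

lemma double_ext_Cmp:
  assumes "double_ext C E f g u1 v1" "double_ext C E g h u2 v2"
  shows "double_ext C E f h (u2 \<odot> u1) (v2 \<odot> v1)"
proof -
  have sq: "comm_square C f g u1 v1" "comm_square C g h u2 v2" using assms unfolding double_ext_def
    by auto
  note D [simp] = comm_squareD(1-8)[OF sq(1)] comm_squareD(1-8)[OF sq(2)]
  obtain w1 where w1: "comparison C f g u1 v1 w1" "E w1" using assms(1) unfolding double_ext_def
    by auto
  then obtain p1 q1 where pb1: "is_pullback C g v1 p1 q1"
    and w1': "w1 \<in> hom_set C (Dom C f) (Dom C p1)"
    "p1 \<odot> w1 = u1" "q1 \<odot> w1 = f" unfolding comparison_def by auto
  obtain w2 where w2: "comparison C g h u2 v2 w2" "E w2" using assms(2) unfolding double_ext_def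
    by auto
  then obtain p2 q2 where pb2: "is_pullback C h v2 p2 q2"
    and w2': "w2 \<in> hom_set C (Dom C g) (Dom C p2)"
    "p2 \<odot> w2 = u2" "q2 \<odot> w2 = g" unfolding comparison_def by auto
  obtain p q where pb: "is_pullback C h (v2 \<odot> v1) p q" using ex_pullback[of h "v2 \<odot> v1"] by auto
  note [simp] = pullbackD(1-4,6-8)[OF pb1] pullbackD(1-4,6-8)[OF pb2]
  have [simp]: "p \<in> Mor C" "q \<in> Mor C" "Cod C p = Dom C h" "Cod C q = Cod C f" "Dom C p = Dom C q"
    "w1 \<in> Mor C" "Dom C w1 = Dom C f" "Cod C w1 = Dom C q1"
    "w2 \<in> Mor C" "Dom C w2 = Dom C g" "Cod C w2 = Dom C q2"
    using pullbackD[OF pb] w1'(1) w2'(1) by simp_all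
  have hp: "h \<odot> p = v2 \<odot> (v1 \<odot> q)" using pullbackD(9)[OF pb] by simp
  obtain n where n [simp]: "n \<in> Mor C" "Dom C n = Dom C q" "Cod C n = Dom C q2" "p2 \<odot> n = p"
    "q2 \<odot> n = v1 \<odot> q"
    using pullback_lift[OF pb2, of p "v1 \<odot> q"] hp by auto
  have "h \<odot> (u2 \<odot> p1) = v2 \<odot> (g \<odot> p1)" by (rule reassoc[OF comm_squareD(9)[OF sq(2)]]) simp_all
  then have "h \<odot> (u2 \<odot> p1) = v2 \<odot> (v1 \<odot> q1)" by (simp only: pullbackD(9)[OF pb1])
  then obtain x where x [simp]: "x \<in> Mor C" "Dom C x = Dom C q1" "Cod C x = Dom C q"
    "p \<odot> x = u2 \<odot> p1" "q \<odot> x = q1"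
    using pullback_lift[OF pb, of "u2 \<odot> p1" q1] by auto
  have "is_pullback C w2 n p1 x"
  proof (rule pullbackI)
    show "w2 \<odot> p1 = n \<odot> x"
      by (rule pullback_unique[OF pb2])
        (simp_all add: reassoc1[OF w2'(2)] reassoc1[OF w2'(3)] reassoc1[OF n(4)] reassoc[OF n(5)]
          pullbackD(9)[OF pb1])
  next
    fix \<alpha> \<beta> assume [simp]: "\<alpha> \<in> Mor C" "\<beta> \<in> Mor C" "Dom C \<alpha> = Dom C \<beta>" "Cod C \<alpha> = Dom C w2"
      "Cod C \<beta> = Dom C n"
      and eq: "w2 \<odot> \<alpha> = n \<odot> \<beta>"
    have 1: "g \<odot> \<alpha> = v1 \<odot> (q \<odot> \<beta>)"
      using arg_cong[OF eq, of "\<lambda>z. q2 \<odot> z"] by (simp add: reassoc1[OF w2'(3)] reassoc[OF n(5)])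
    have 2: "u2 \<odot> \<alpha> = p \<odot> \<beta>"
      using arg_cong[OF eq, of "\<lambda>z. p2 \<odot> z"] by (simp add: reassoc1[OF w2'(2)] reassoc1[OF n(4)])
    obtain h where h [simp]: "h \<in> Mor C" "Dom C h = Dom C \<beta>" "Cod C h = Dom C q1" "p1 \<odot> h = \<alpha>"
      "q1 \<odot> h = q \<odot> \<beta>"
      using pullback_lift[OF pb1, of \<alpha> "q \<odot> \<beta>"] 1 by auto
    have "x \<odot> h = \<beta>"
      by (rule pullback_unique[OF pb]) (simp_all add: reassoc[OF x(4)] reassoc1[OF x(5)] 2)
    then show "\<exists>h. h \<in> Mor C \<and> Dom C h = Dom C \<beta> \<and> Cod C h = Dom C x \<and> p1 \<odot> h = \<alpha> \<and> x \<odot> h = \<beta>"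
      by (intro exI[of _ h]) simp
  next
    fix h h' assume [simp]: "h \<in> Mor C" "h' \<in> Mor C" "Dom C h = Dom C h'" "Cod C h = Dom C x"
      "Cod C h' = Dom C x"
      and eq: "p1 \<odot> h = p1 \<odot> h'" "x \<odot> h = x \<odot> h'"
    have "q1 \<odot> h = q1 \<odot> h'"
      using arg_cong[OF eq(2), of "\<lambda>z. q \<odot> z"] by (simp add: reassoc1[OF x(5)])
    then show "h = h'" using pullback_unique[OF pb1, of h h'] eq by simp
  qed simp_all
  moreover have "P (Dom C q)"
    using E_pullback[OF pb] E_Dom[of q] E_Cod[of f] assms unfolding double_ext_def by simp
  ultimately have "E x" using E_pullback w2(2) by simp
  then have Exw: "E (x \<odot> w1)" using E_Cmp[OF w1(2)] by simp
  have "comparison C f h (u2 \<odot> u1) (v2 \<odot> v1) (x \<odot> w1)"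
    by (rule comparisonI[OF pb])
      (simp_all add: reassoc[OF x(4)] reassoc1[OF x(5)] w1')
  then show ?thesis
    using Exw assms comm_square_Cmp[OF sq] E_Cmp unfolding double_ext_def by auto
qed

text \<open>The components \<open>w1\<close> and \<open>w0\<close> of the comparison from
  \<open>a\<close> to \<open>r\<close> are extensions by \<open>E_comparison\<close> in the two
  faces of the cube. By the same axiom for the transposed square from \<open>a\<close> to
  \<open>r\<close>, it remains to treat the map \<open>Rw\<close> between the kernel pairs of
  \<open>a\<close> and \<open>r\<close>. This map is again a comparison, namely for the square
  \<open>Rf\<close>, \<open>Rg\<close>, \<open>Ru\<close>, \<open>Rv\<close> between the kernel
  pairs of \<open>a\<close>, \<open>b\<close>, \<open>c\<close>, \<open>d\<close>. The map between
  the kernel pairs of \<open>Ru\<close> and \<open>Rv\<close> is \<open>K2\<close>, induced by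
  \<open>k1\<close>, and it is an extension because \<open>k\<close> is a double extension.\<close>

lemma double_ext_comparison:
  assumes sq: "comm_square (Arr C) f g u v" and f: "arr_ext C E f" and g: "arr_ext C E g"
    and u: "arr_ext C E u"
    and v: "arr_ext C E v"
    and ku: "is_kernel_pair (Arr C) u x y" and kv: "is_kernel_pair (Arr C) v x' y'"
    and k: "pair_map (Arr C) f x y x' y' k" and "arr_ext C E k" and w: "comparison (Arr C) f g u v w"
  shows "arr_ext C E w"
proof -
  note ASq = comm_squareD[OF sq]
  obtain p q where pb: "is_pullback (Arr C) g v p q"
    and wpq: "w \<in> hom_set (Arr C) (Dom (Arr C) f) (Dom (Arr C) p)" "p \<odot>\<^bsub>Arr C\<^esub> w = u" "q \<odot>\<^bsub>Arr C\<^esub> w = f"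
    using w unfolding comparison_def by auto
  obtain b c d r g1 g0 v1 v0 p1 p0 q1 q0 where S: "g = Square c d g1 g0" "v = Square b d v1 v0"
      "p = Square r c p1 p0" "q = Square r b q1 q0"
    and sqg: "comm_square C c d g1 g0" and sqv: "comm_square C b d v1 v0"
    and sqp: "comm_square C r c p1 p0" and sqq: "comm_square C r b q1 q0"
    and pb1: "is_pullback C g1 v1 p1 q1" and pb0: "is_pullback C g0 v0 p0 q0"
    using pb by (rule pullback_ArrE)
  obtain a f1 f0 where f': "f = Square a b f1 f0" and sqf: "comm_square C a b f1 f0"
    using ASq(1,7) S by (metis Mor_ArrE Dom_Arr Cod_Arr)
  obtain u1 u0 where u': "u = Square a c u1 u0" and squ: "comm_square C a c u1 u0"
    using ASq(3,5,6) S f' by (metis Mor_ArrE Dom_Arr Cod_Arr)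
  obtain w1 w0 where w': "w = Square a r w1 w0" and sqw: "comm_square C a r w1 w0"
    using wpq(1) S f' by (metis Mor_ArrE Dom_Arr Cod_Arr in_hom_set)
  obtain ku x1 x0 y1 y0 where xy: "x = Square ku a x1 x0" "y = Square ku a y1 y0"
    and sqx: "comm_square C ku a x1 x0" and sqy: "comm_square C ku a y1 y0"
    and ku1: "is_kernel_pair C u1 x1 y1" and ku0: "is_kernel_pair C u0 x0 y0"
    using ku unfolding u' by (elim pullback_ArrE) blast
  obtain kv x1' x0' y1' y0' where xy': "x' = Square kv b x1' x0'" "y' = Square kv b y1' y0'"
    and sqx': "comm_square C kv b x1' x0'" and sqy': "comm_square C kv b y1' y0'"
    and kv1: "is_kernel_pair C v1 x1' y1'" and kv0: "is_kernel_pair C v0 x0' y0'"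
    using kv unfolding S by (elim pullback_ArrE) blast
  obtain k1 k0 where k': "k = Square ku kv k1 k0" and sqk: "comm_square C ku kv k1 k0"
    using pair_mapD(1-3)[OF k] xy xy' by (metis Mor_ArrE Dom_Arr Cod_Arr)
  have sq1: "comm_square C f1 g1 u1 v1" and sq0: "comm_square C f0 g0 u0 v0"
    using ASq(9) comm_squareD[OF sqf] comm_squareD[OF sqg] comm_squareD[OF squ] comm_squareD[OF sqv]
    unfolding comm_square_def by (simp_all add: f' u' S)
  have k1: "pair_map C f1 x1 y1 x1' y1' k1" and k0: "pair_map C f0 x0 y0 x0' y0' k0"
    using pair_mapD(4,5)[OF k] comm_squareD[OF sqk] comm_squareD[OF sqx] comm_squareD[OF sqx']
    unfolding pair_map_def by (simp_all add: f' xy xy' k')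
  have w1: "comparison C f1 g1 u1 v1 w1" and w0: "comparison C f0 g0 u0 v0 w0"
    using wpq comm_squareD[OF sqw] comm_squareD[OF sqf] comm_squareD[OF sqq]
    by (auto intro!: comparisonI[OF pb1] comparisonI[OF pb0] simp: w' S f' u')
  have ext: "double_ext C E a b f1 f0" "double_ext C E c d g1 g0" "double_ext C E a c u1 u0"
      "double_ext C E b d v1 v0" "double_ext C E ku kv k1 k0"
    using assms unfolding f' S u' k' by auto
  then have E: "E a" "E b" "E c" "E d" "E f1" "E f0" "E g1" "E g0" "E u1" "E u0" "E v1" "E v0"
    "E k1" "E k0" "E ku" "E kv"
    unfolding double_ext_def by auto
  have "E w1" by (rule E_comparison[OF sq1 _ _ _ _ ku1 kv1 k1 _ w1]) (use E in auto)
  have "E w0" by (rule E_comparison[OF sq0 _ _ _ _ ku0 kv0 k0 _ w0]) (use E in auto)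
  have "E r"
    using double_ext_pullback[OF ext(2) sqv \<open>E b\<close> sqp sqq pb1 pb0] unfolding double_ext_def by auto
  \<comment> \<open>From here on kernel pairs are taken of the arrows that are the objects of the
    arrow category, transversally to the kernel pairs of \<open>u\<close> and
    \<open>v\<close>.\<close>
  have ex_ker: "\<exists>a1 a2. is_kernel_pair C a a1 a2" if "E a" for a
    using ex_pullback E_Mor that by blast
  obtain a1 a2 where ka: "is_kernel_pair C a a1 a2" using ex_ker[OF \<open>E a\<close>] by auto
  obtain b1 b2 where kb: "is_kernel_pair C b b1 b2" using ex_ker[OF \<open>E b\<close>] by auto
  obtain c1 c2 where kc: "is_kernel_pair C c c1 c2" using ex_ker[OF \<open>E c\<close>] by auto
  obtain d1 d2 where kd: "is_kernel_pair C d d1 d2" using ex_ker[OF \<open>E d\<close>] by auto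
  obtain r1 r2 where kr: "is_kernel_pair C r r1 r2" using ex_ker[OF \<open>E r\<close>] by auto
  obtain e1 e2 where ke: "is_kernel_pair C ku e1 e2" using ex_ker[OF \<open>E ku\<close>] by auto
  obtain e1' e2' where ke': "is_kernel_pair C kv e1' e2'" using ex_ker[OF \<open>E kv\<close>] by auto
  obtain Rf where Rf: "pair_map C f1 a1 a2 b1 b2 Rf"
    using ex_pair_map[OF comm_square_sym[OF sqf] ka kb] .
  obtain Rg where Rg: "pair_map C g1 c1 c2 d1 d2 Rg"
    using ex_pair_map[OF comm_square_sym[OF sqg] kc kd] .
  obtain Ru where Ru: "pair_map C u1 a1 a2 c1 c2 Ru"
    using ex_pair_map[OF comm_square_sym[OF squ] ka kc] .
  obtain Rv where Rv: "pair_map C v1 b1 b2 d1 d2 Rv"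
    using ex_pair_map[OF comm_square_sym[OF sqv] kb kd] .
  obtain Rp where Rp: "pair_map C p1 r1 r2 c1 c2 Rp"
    using ex_pair_map[OF comm_square_sym[OF sqp] kr kc] .
  obtain Rq where Rq: "pair_map C q1 r1 r2 b1 b2 Rq"
    using ex_pair_map[OF comm_square_sym[OF sqq] kr kb] .
  obtain Rw where Rw: "pair_map C w1 a1 a2 r1 r2 Rw"
    using ex_pair_map[OF comm_square_sym[OF sqw] ka kr] .
  obtain X where X: "pair_map C x1 e1 e2 a1 a2 X"
    using ex_pair_map[OF comm_square_sym[OF sqx] ke ka] .
  obtain Y where Y: "pair_map C y1 e1 e2 a1 a2 Y"
    using ex_pair_map[OF comm_square_sym[OF sqy] ke ka] .
  obtain X' where X': "pair_map C x1' e1' e2' b1 b2 X'"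
    using ex_pair_map[OF comm_square_sym[OF sqx'] ke' kb] .
  obtain Y' where Y': "pair_map C y1' e1' e2' b1 b2 Y'"
    using ex_pair_map[OF comm_square_sym[OF sqy'] ke' kb] .
  obtain K2 where K2: "pair_map C k1 e1 e2 e1' e2' K2"
    using ex_pair_map[OF comm_square_sym[OF sqk] ke ke'] .
  \<comment> \<open>Double extensions are symmetric under transposition, so
    \<open>E_pair_map\<close> also applies to the kernel pairs of \<open>a\<close> and
    \<open>b\<close>.\<close>
  have ext_pair_map: "E kk" if "double_ext C E a b f1 f0" "is_kernel_pair C a a1 a2"
    "is_kernel_pair C b b1 b2"
    "pair_map C f1 a1 a2 b1 b2 kk" for a b f1 f0 a1 a2 b1 b2 kk
    using that unfolding double_ext_def
    by (metis E_pair_map comparison_sym comm_square_sym)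
  have ER: "E Rf" "E Rg" "E Ru" "E Rv" "E K2"
    using ext_pair_map[OF ext(1) ka kb Rf] ext_pair_map[OF ext(2) kc kd Rg]
      ext_pair_map[OF ext(3) ka kc Ru]
      ext_pair_map[OF ext(4) kb kd Rv] ext_pair_map[OF ext(5) ke ke' K2] by auto
  have pbR: "is_pullback C Rg Rv Rp Rq"
    by (rule pullback_pair_maps[OF pb1 pb0 sqg sqv sqp sqq kb kc kd kr Rg Rv Rp Rq])
  \<comment> \<open>Kernel pairs commute with each other: the kernel pair of the map
    \<open>Ru\<close> of kernel pairs sits on the kernel pair of \<open>ku\<close>, the arrow that
    carries the kernel pair of \<open>u\<close>.\<close>
  have kRu: "is_kernel_pair C Ru X Y"
    by (rule pullback_pair_maps[OF ku1 ku0 squ squ sqx sqy ka ka kc ke Ru Ru X Y])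
  have kRv: "is_kernel_pair C Rv X' Y'"
    by (rule pullback_pair_maps[OF kv1 kv0 sqv sqv sqx' sqy' kb kb kd ke' Rv Rv X' Y'])
  note Mors [simp] = comm_squareD(1-8)[OF sqf] comm_squareD(1-8)[OF sqg] comm_squareD(1-8)[OF squ]
    comm_squareD(1-8)[OF sqv]
    comm_squareD(1-8)[OF sqp] comm_squareD(1-8)[OF sqq] comm_squareD(1-8)[OF sqw]
      comm_squareD(1-8)[OF sqx]
    comm_squareD(1-8)[OF sqy] comm_squareD(1-8)[OF sqx'] comm_squareD(1-8)[OF sqy']
      comm_squareD(1-8)[OF sqk]
  have "Rg \<odot> Ru = Rv \<odot> Rf"
    using pair_map_Cmp[OF ka kc kd Ru Rg] pair_map_Cmp[OF ka kb kd Rf Rv] comm_squareD(9)[OF sq1]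
    by (intro pair_map_unique[OF kd]) simp_all
  then have sqR: "comm_square C Rf Rg Ru Rv"
    unfolding comm_square_def using E_Mor ER pair_mapD(2,3)[OF Rf] pair_mapD(2,3)[OF Rg]
      pair_mapD(2,3)[OF Ru] pair_mapD(2,3)[OF Rv]
    by simp
  have wpq1: "p1 \<odot> w1 = u1" "q1 \<odot> w1 = f1" using wpq(2,3) by (simp_all add: w' S f' u')
  have "Rp \<odot> Rw = Ru"
    using pair_map_Cmp[OF ka kr kc Rw Rp] Ru wpq1 by (intro pair_map_unique[OF kc]) simp_all
  moreover have "Rq \<odot> Rw = Rf"
    using pair_map_Cmp[OF ka kr kb Rw Rq] Rf wpq1 by (intro pair_map_unique[OF kb]) simp_all
  ultimately have Rw': "comparison C Rf Rg Ru Rv Rw"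
    using pair_mapD(1-3)[OF Rw] pair_mapD(2)[OF Rf] pair_mapD(2)[OF Rq]
      by (intro comparisonI[OF pbR]) simp_all
  have fx: "f1 \<odot> x1 = x1' \<odot> k1" "f1 \<odot> y1 = y1' \<odot> k1" using pair_mapD(4,5)[OF k1] by simp_all
  have "X' \<odot> K2 = Rf \<odot> X"
    using pair_map_Cmp[OF ke ke' kb K2 X'] pair_map_Cmp[OF ke ka kb X Rf] fx
      by (intro pair_map_unique[OF kb]) simp_all
  moreover have "Y' \<odot> K2 = Rf \<odot> Y"
    using pair_map_Cmp[OF ke ke' kb K2 Y'] pair_map_Cmp[OF ke ka kb Y Rf] fx
      by (intro pair_map_unique[OF kb]) simp_all
  \<comment> \<open>So \<open>K2\<close>, obtained from \<open>k1\<close> between the kernel pairs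
    of \<open>ku\<close> and \<open>kv\<close>, is also the map that \<open>Rf\<close> induces
    between the kernel pairs of \<open>Ru\<close> and \<open>Rv\<close>.\<close>
  ultimately have "pair_map C Rf X Y X' Y' K2"
    unfolding pair_map_def using pair_mapD(1-3)[OF K2] pair_mapD(2)[OF X] pair_mapD(2)[OF X'] by simp
  then have "E Rw" using E_comparison[OF sqR ER(1-4) kRu kRv _ ER(5) Rw'] by simp
  have sqw': "comm_square C w1 w0 a r" using sqw by (rule comm_square_sym)
  obtain z where z: "comparison C w1 w0 a r z" using ex_comparison[OF sqw'] .
  have "E z"
    by (rule E_comparison[OF sqw' \<open>E w1\<close> \<open>E w0\<close> \<open>E a\<close> \<open>E r\<close> ka kr Rw \<open>E Rw\<close> z])
  then have "double_ext C E a r w1 w0"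
    unfolding double_ext_def using sqw comparison_sym[OF z sqw'] \<open>E w1\<close> \<open>E w0\<close> \<open>E a\<close> \<open>E r\<close> by auto
  then show ?thesis unfolding w' by simp
qed

theorem relative_maltsev_Arr: "relative_maltsev (Arr C) E (arr_ext C E)"
proof (intro relative_maltsev.intro relative_maltsev_axioms.intro pullback_category_Arr)
  fix e assume "arr_ext C E e"
  then show "e \<in> Mor (Arr C)" "E (Dom (Arr C) e)" "E (Cod (Arr C) e)"
    unfolding arr_ext_def double_ext_def by auto
next
  fix i assume i: "is_iso (Arr C) i" "E (Dom (Arr C) i)"
  then obtain f g u v where i': "i = Square f g u v" unfolding is_iso_def by (metis Mor_ArrE)
  then show "E (Cod (Arr C) i)" using i E_iso_square[of f g u v] by (simp add: iso_Arr_iff)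
next
  fix e g p q assume pb: "is_pullback (Arr C) e g p q" and "arr_ext C E e" "E (Dom (Arr C) g)"
  then show "arr_ext C E q"
    by (elim pullback_ArrE) (auto intro: double_ext_pullback)
next
  fix e e' assume "arr_ext C E e" "arr_ext C E e'" "Dom (Arr C) e' = Cod (Arr C) e"
  then show "arr_ext C E (e' \<odot>\<^bsub>Arr C\<^esub> e)"
    unfolding arr_ext_def using double_ext_Cmp by auto
next
  fix f g u v d c d' c' k w
  assume "comm_square (Arr C) f g u v" "arr_ext C E f" "arr_ext C E g" "arr_ext C E u" "arr_ext C E v"
    "is_kernel_pair (Arr C) u d c" "is_kernel_pair (Arr C) v d' c'" "pair_map (Arr C) f d c d' c' k"
      "arr_ext C E k"
    "comparison (Arr C) f g u v w"
  then show "arr_ext C E w" by (rule double_ext_comparison)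
qed

end

subsection \<open>Regular epimorphisms in an exact Mal'tsev category\<close>

context category
begin

lemma coequaliserD:
  assumes "is_coequaliser C d c f"
  shows "d \<in> Mor C" "c \<in> Mor C" "f \<in> Mor C" "Dom C d = Dom C c" "Cod C d = Cod C c"
    "Dom C f = Cod C c"
    "f \<odot> d = f \<odot> c"
  using assms unfolding is_coequaliser_def by auto

lemma coequaliser_factor:
  assumes "is_coequaliser C d c f" "g \<in> Mor C" "Dom C g = Cod C c" "g \<odot> d = g \<odot> c"
  obtains h where "h \<in> Mor C" "Dom C h = Cod C f" "Cod C h = Cod C g" "h \<odot> f = g"
proof -
  have "\<exists>!h. h \<in> hom_set C (Cod C f) (Cod C g) \<and> h \<odot> f = g"
    using assms coequaliserD(5)[OF assms(1)] unfolding is_coequaliser_def by metis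
  then show ?thesis using that by auto
qed

lemma regular_epi_Mor: "regular_epi C f \<Longrightarrow> f \<in> Mor C"
  unfolding regular_epi_def is_coequaliser_def by auto

lemma regular_epi_epi:
  assumes "regular_epi C f" "g \<in> Mor C" "h \<in> Mor C" "Dom C g = Cod C f" "Dom C h = Cod C f"
    "g \<odot> f = h \<odot> f"
  shows "g = h"
proof -
  obtain d c where dc: "is_coequaliser C d c f" using assms(1) unfolding regular_epi_def by auto
  note D = coequaliserD[OF dc]
  have "Cod C (g \<odot> f) = Cod C (h \<odot> f)" using assms(6) by (rule arg_cong)
  then have Cod: "Cod C g = Cod C h" using assms(2-5) D(3) by simp
  have "(g \<odot> f) \<odot> d = (g \<odot> f) \<odot> c" using D assms(2-5) by simp
  moreover have "g \<odot> f \<in> Mor C" "Dom C (g \<odot> f) = Cod C d" "Cod C (g \<odot> f) = Cod C g"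
    using D assms(2-5) by simp_all
  ultimately have "\<exists>!x. x \<in> hom_set C (Cod C f) (Cod C g) \<and> x \<odot> f = g \<odot> f"
    using dc unfolding is_coequaliser_def by metis
  then show ?thesis using assms Cod by auto
qed

lemma coequaliserI:
  assumes "d \<in> Mor C" "c \<in> Mor C" "f \<in> Mor C" "Dom C d = Dom C c" "Cod C d = Cod C c"
    "Dom C f = Cod C c"
    "f \<odot> d = f \<odot> c"
    and "\<And>g. \<lbrakk>g \<in> Mor C; Dom C g = Cod C c; g \<odot> d = g \<odot> c\<rbrakk>
      \<Longrightarrow> \<exists>h. h \<in> Mor C \<and> Dom C h = Cod C f \<and> Cod C h = Cod C g \<and> h \<odot> f = g"
    and "\<And>g h. \<lbrakk>g \<in> Mor C; h \<in> Mor C; Dom C g = Cod C f; Dom C h = Cod C f; g \<odot> f = h \<odot> f\<rbrakk> \<Longrightarrow> g = h"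
  shows "is_coequaliser C d c f"
  unfolding is_coequaliser_def
proof (intro conjI ballI impI)
  fix g assume "g \<in> Mor C" "Dom C g = Cod C d \<and> g \<odot> d = g \<odot> c"
  then obtain h where h: "h \<in> Mor C" "Dom C h = Cod C f" "Cod C h = Cod C g" "h \<odot> f = g"
    using assms(5,8) by metis
  show "\<exists>!h. h \<in> hom_set C (Cod C f) (Cod C g) \<and> h \<odot> f = g"
  proof (rule ex1I[of _ h])
    fix x assume "x \<in> hom_set C (Cod C f) (Cod C g) \<and> x \<odot> f = g"
    then show "x = h" using assms(9)[of x h] h by simp
  qed (use h in simp)
qed (use assms(1-7) in simp_all)

text \<open>The pair of which \<open>f\<close> is a coequaliser factors through its kernel pair, so
  a map that coequalises the kernel pair coequalises that pair as well.\<close>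

lemma regular_epi_coequaliser:
  assumes "regular_epi C f" and k: "is_kernel_pair C f d c"
  shows "is_coequaliser C d c f"
proof (rule coequaliserI)
  note D = pullbackD(1-4,6-9)[OF k]
  obtain x y where xy: "is_coequaliser C x y f" using assms(1) unfolding regular_epi_def by auto
  note D' = coequaliserD[OF xy]
  obtain m where m: "m \<in> Mor C" "Dom C m = Dom C y" "Cod C m = Dom C c" "d \<odot> m = x" "c \<odot> m = y"
    by (rule pullback_lift[OF k, of x y]) (use D D' in simp_all)
  fix g assume g: "g \<in> Mor C" "Dom C g = Cod C c" "g \<odot> d = g \<odot> c"
  have "g \<odot> (d \<odot> m) = g \<odot> (c \<odot> m)" using g(3) by (rule reassoc) (use g D m in simp_all)
  then have "g \<odot> x = g \<odot> y" using m by simp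
  then show "\<exists>h. h \<in> Mor C \<and> Dom C h = Cod C f \<and> Cod C h = Cod C g \<and> h \<odot> f = g"
    using coequaliser_factor[OF xy g(1)] g D D' by metis
next
  fix g h assume "g \<in> Mor C" "h \<in> Mor C" "Dom C g = Cod C f" "Dom C h = Cod C f" "g \<odot> f = h \<odot> f"
  then show "g = h" using regular_epi_epi[OF assms(1)] by blast
qed (use pullbackD[OF k] in auto)

end

section \<open>Local lifts, composites and images in a regular category\<close>

context regular_category
begin

text \<open>A generalized element \<open>\<alpha>\<close> of the codomain lifts along
  \<open>e\<close> after restriction along a regular epimorphism \<open>t\<close>. This is what
  makes arguments with elements possible below.\<close>

lemma regular_epi_cover:
  assumes "regular_epi C e" "\<alpha> \<in> Mor C" "Cod C \<alpha> = Cod C e"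
  obtains s t where "regular_epi C t" "s \<in> Mor C" "t \<in> Mor C" "Cod C s = Dom C e"
    "Cod C t = Dom C \<alpha>" "Dom C s = Dom C t"
    "e \<odot> s = \<alpha> \<odot> t"
proof -
  obtain s t where st: "is_pullback C e \<alpha> s t"
    using ex_pullback assms regular_epi_Mor by metis
  then show ?thesis using pullbackD[OF st] regular_epi_stable[OF st assms(1)] by (intro that[of t s])
qed

text \<open>The restriction is kept as two regular epimorphisms \<open>t'\<close> and
  \<open>t\<close>, since \<open>regular_epi_Cmp\<close> is proved from this lemma; each of the two
  can be cancelled by itself.\<close>

lemma regular_epi_cover2:
  assumes "regular_epi C e" "\<alpha> \<in> Mor C" "\<beta> \<in> Mor C" "Cod C \<alpha> = Cod C e" "Cod C \<beta> = Cod C e"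
    "Dom C \<alpha> = Dom C \<beta>"
  obtains s s' t t' where "regular_epi C t" "regular_epi C t'" "t \<in> Mor C" "t' \<in> Mor C" "s \<in> Mor C"
    "s' \<in> Mor C"
    "Cod C s = Dom C e" "Cod C s' = Dom C e" "Cod C t' = Dom C \<alpha>" "Dom C t' = Cod C t"
      "Dom C s = Dom C t" "Dom C s' = Dom C t"
    "e \<odot> s = \<alpha> \<odot> (t' \<odot> t)" "e \<odot> s' = \<beta> \<odot> (t' \<odot> t)"
proof -
  have e: "e \<in> Mor C" using regular_epi_Mor assms by blast
  obtain s1 t1 where 1: "regular_epi C t1" "s1 \<in> Mor C" "t1 \<in> Mor C" "Cod C s1 = Dom C e"
    "Cod C t1 = Dom C \<alpha>"
    "Dom C s1 = Dom C t1" "e \<odot> s1 = \<alpha> \<odot> t1"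
    using regular_epi_cover[OF assms(1,2,4)] .
  obtain s2 t2 where 2: "regular_epi C t2" "s2 \<in> Mor C" "t2 \<in> Mor C" "Cod C s2 = Dom C e"
    "Cod C t2 = Dom C t1"
    "Dom C s2 = Dom C t2" "e \<odot> s2 = (\<beta> \<odot> t1) \<odot> t2"
    by (rule regular_epi_cover[OF assms(1), of "\<beta> \<odot> t1"]) (use 1 assms in simp_all)
  have "e \<odot> (s1 \<odot> t2) = \<alpha> \<odot> (t1 \<odot> t2)"
    using 1(7) by (rule reassoc) (use e 1 2 assms in simp_all)
  then show ?thesis using 1 2 assms e by (intro that[of t2 t1 "s1 \<odot> t2" s2]) simp_all
qed

lemma regular_epi_Cmp:
  assumes f: "regular_epi C f" and g: "regular_epi C g" and fg: "Dom C g = Cod C f"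
  shows "regular_epi C (g \<odot> f)"
proof -
  have [simp]: "f \<in> Mor C" "g \<in> Mor C" using regular_epi_Mor f g by auto
  note [simp] = fg
  obtain r1 r2 where r: "is_kernel_pair C (g \<odot> f) r1 r2" using ex_pullback[of "g \<odot> f" "g \<odot> f"] by auto
  have [simp]: "r1 \<in> Mor C" "r2 \<in> Mor C" "Cod C r1 = Dom C f" "Cod C r2 = Dom C f"
    "Dom C r1 = Dom C r2"
    using pullbackD[OF r] by simp_all
  have "is_coequaliser C r1 r2 (g \<odot> f)"
  proof (rule coequaliserI)
    show "(g \<odot> f) \<odot> r1 = (g \<odot> f) \<odot> r2" using pullbackD(9)[OF r] .
  next
    fix h assume h [simp]: "h \<in> Mor C" "Dom C h = Cod C r2" and hr: "h \<odot> r1 = h \<odot> r2"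
    \<comment> \<open>Two elements that \<open>g \<odot> f\<close> identifies form an element of its
      kernel pair, hence \<open>h\<close> identifies them too.\<close>
    have eq: "h \<odot> a = h \<odot> b" if [simp]: "a \<in> Mor C" "b \<in> Mor C" "Dom C a = Dom C b"
      "Cod C a = Dom C f" "Cod C b = Dom C f"
      and gf: "g \<odot> (f \<odot> a) = g \<odot> (f \<odot> b)" for a b
    proof -
      obtain m where m [simp]: "m \<in> Mor C" "Dom C m = Dom C b" "Cod C m = Dom C r2" "r1 \<odot> m = a"
        "r2 \<odot> m = b"
        by (rule pullback_lift[OF r, of a b]) (simp_all add: gf)
      have "h \<odot> (r1 \<odot> m) = h \<odot> (r2 \<odot> m)" using hr by (rule reassoc) simp_all
      then show ?thesis by simp
    qed
    obtain d c where dc: "is_kernel_pair C f d c" using ex_pullback[of f f] by auto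
    note [simp] = pullbackD(3-4,6-8)[OF dc]
    have "h \<odot> d = h \<odot> c" by (rule eq) (simp_all add: pullbackD(9)[OF dc])
    then obtain k where k [simp]: "k \<in> Mor C" "Dom C k = Cod C f" "Cod C k = Cod C h" "k \<odot> f = h"
      using coequaliser_factor[OF regular_epi_coequaliser[OF f dc], of h] by auto
    obtain x y where xy: "is_kernel_pair C g x y" using ex_pullback[of g g] by auto
    note [simp] = pullbackD(3-4,6-8)[OF xy]
    \<comment> \<open>The factor \<open>k\<close> of \<open>h\<close> through \<open>f\<close> has
      to identify the kernel pair \<open>x\<close>, \<open>y\<close> of \<open>g\<close>. Lifted
      locally to the domain of \<open>f\<close>, the two become accessible to \<open>eq\<close>;
      then the cover is cancelled.\<close>
    obtain s s' t t' where st: "regular_epi C t" "regular_epi C t'"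
      and [simp]: "t \<in> Mor C" "t' \<in> Mor C" "s \<in> Mor C" "s' \<in> Mor C"
        "Cod C s = Dom C f" "Cod C s' = Dom C f" "Cod C t' = Dom C y" "Dom C t' = Cod C t"
          "Dom C s = Dom C t" "Dom C s' = Dom C t"
      and fs: "f \<odot> s = x \<odot> (t' \<odot> t)" "f \<odot> s' = y \<odot> (t' \<odot> t)"
      by (rule regular_epi_cover2[OF f, of x y]) simp_all
    have "h \<odot> s = h \<odot> s'"
      by (rule eq) (simp_all add: fs reassoc[OF pullbackD(9)[OF xy]])
    moreover have "h \<odot> s = k \<odot> (f \<odot> s)" "h \<odot> s' = k \<odot> (f \<odot> s')"
      by (simp_all add: reassoc1[OF k(4)])
    ultimately have "((k \<odot> x) \<odot> t') \<odot> t = ((k \<odot> y) \<odot> t') \<odot> t" by (simp add: fs)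
    then have "(k \<odot> x) \<odot> t' = (k \<odot> y) \<odot> t'"
      by (rule regular_epi_epi[OF st(1), rotated -1]) simp_all
    then have "k \<odot> x = k \<odot> y"
      by (rule regular_epi_epi[OF st(2), rotated -1]) simp_all
    then obtain l where "l \<in> Mor C" "Dom C l = Cod C g" "Cod C l = Cod C k" "l \<odot> g = k"
      using coequaliser_factor[OF regular_epi_coequaliser[OF g xy], of k] by auto
    then show "\<exists>l. l \<in> Mor C \<and> Dom C l = Cod C (g \<odot> f) \<and> Cod C l = Cod C h \<and> l \<odot> (g \<odot> f) = h"
      by (intro exI[of _ l]) (simp add: reassoc1[of l g])
  next
    fix a b assume [simp]: "a \<in> Mor C" "b \<in> Mor C" "Dom C a = Cod C (g \<odot> f)" "Dom C b = Cod C (g \<odot> f)"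
      and "a \<odot> (g \<odot> f) = b \<odot> (g \<odot> f)"
    then have "(a \<odot> g) \<odot> f = (b \<odot> g) \<odot> f" by simp
    then have "a \<odot> g = b \<odot> g" by (rule regular_epi_epi[OF f, rotated -1]) simp_all
    then show "a = b" by (rule regular_epi_epi[OF g, rotated -1]) simp_all
  qed simp_all
  then show ?thesis unfolding regular_epi_def by blast
qed

lemma image_factorization:
  assumes [simp]: "w \<in> Mor C"
  obtains e m where "regular_epi C e" "e \<in> Mor C" "m \<in> Mor C" "Dom C e = Dom C w"
    "Cod C m = Cod C w" "Dom C m = Cod C e"
    "m \<odot> e = w"
    "\<And>\<alpha> \<beta>. \<lbrakk>\<alpha> \<in> Mor C; \<beta> \<in> Mor C; Dom C \<alpha> = Dom C \<beta>; Cod C \<alpha> = Dom C m; Cod C \<beta> = Dom C m; m \<odot> \<alpha>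
      = m \<odot> \<beta>\<rbrakk> \<Longrightarrow> \<alpha> = \<beta>"
proof -
  obtain x y where xy: "is_kernel_pair C w x y" using ex_pullback[of w w] by auto
  note [simp] = pullbackD(3-4,6-8)[OF xy]
  obtain e where e: "is_coequaliser C x y e" using ex_coequaliser[OF xy] by auto
  then have re: "regular_epi C e" unfolding regular_epi_def by blast
  have [simp]: "e \<in> Mor C" "Dom C e = Dom C w" using coequaliserD[OF e] by simp_all
  obtain m where m [simp]: "m \<in> Mor C" "Dom C m = Cod C e" "Cod C m = Cod C w" "m \<odot> e = w"
    using coequaliser_factor[OF e, of w] pullbackD(9)[OF xy] by auto
  have "\<alpha> = \<beta>" if [simp]: "\<alpha> \<in> Mor C" "\<beta> \<in> Mor C" "Dom C \<alpha> = Dom C \<beta>" "Cod C \<alpha> = Dom C m"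
    "Cod C \<beta> = Dom C m"
    and m\<alpha>\<beta>: "m \<odot> \<alpha> = m \<odot> \<beta>" for \<alpha> \<beta>
  proof -
    \<comment> \<open>Elements of the image with equal values under \<open>m\<close> lift locally to
      \<open>s\<close> and \<open>s'\<close> with equal values under \<open>w\<close>. These form an
      element of the kernel pair of \<open>w\<close>, which \<open>e\<close> coequalises.\<close>
    obtain s s' t t' where st: "regular_epi C t" "regular_epi C t'"
      and [simp]: "t \<in> Mor C" "t' \<in> Mor C" "s \<in> Mor C" "s' \<in> Mor C"
        "Cod C s = Dom C w" "Cod C s' = Dom C w" "Cod C t' = Dom C \<beta>" "Dom C t' = Cod C t"
          "Dom C s = Dom C t" "Dom C s' = Dom C t"
      and es: "e \<odot> s = \<alpha> \<odot> (t' \<odot> t)" "e \<odot> s' = \<beta> \<odot> (t' \<odot> t)"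
      by (rule regular_epi_cover2[OF re, of \<alpha> \<beta>]) simp_all
    have "m \<odot> (e \<odot> s) = m \<odot> (e \<odot> s')"
      unfolding es by (rule reassoc[OF m\<alpha>\<beta>]) simp_all
    then have "w \<odot> s = w \<odot> s'" by (simp add: reassoc1[OF m(4)])
    then obtain h where h [simp]: "h \<in> Mor C" "Dom C h = Dom C s'" "Cod C h = Dom C y" "x \<odot> h = s"
      "y \<odot> h = s'"
      using pullback_lift[OF xy, of s s'] by auto
    have "e \<odot> (x \<odot> h) = e \<odot> (y \<odot> h)" by (rule reassoc[OF coequaliserD(7)[OF e]]) simp_all
    then have "(\<alpha> \<odot> t') \<odot> t = (\<beta> \<odot> t') \<odot> t" by (simp add: es)
    then have "\<alpha> \<odot> t' = \<beta> \<odot> t'"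
      by (rule regular_epi_epi[OF st(1), rotated -1]) simp_all
    then show ?thesis
      by (rule regular_epi_epi[OF st(2), rotated -1]) simp_all
  qed
  with re show ?thesis by (intro that[of e m]) simp_all
qed

text \<open>As \<open>m\<close> is monic, \<open>y\<close> coequalises every pair that
  \<open>z\<close> coequalises; so \<open>y\<close> factors through \<open>z\<close>, and the factor
  is an inverse of \<open>m\<close>.\<close>

lemma regular_epi_mono_iso:
  assumes z: "regular_epi C z" and [simp]: "m \<in> Mor C" "y \<in> Mor C" "Dom C m = Cod C y"
    and my: "m \<odot> y = z"
    and mono: "\<And>\<alpha> \<beta>. \<lbrakk>\<alpha> \<in> Mor C; \<beta> \<in> Mor C; Dom C \<alpha> = Dom C \<beta>; Cod C \<alpha> = Dom C m; Cod C \<beta>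
      = Dom C m; m \<odot> \<alpha> = m \<odot> \<beta>\<rbrakk> \<Longrightarrow> \<alpha> = \<beta>"
  obtains n where "n \<in> Mor C" "Dom C n = Cod C m" "Cod C n = Dom C m" "n \<odot> m = Idt C (Dom C m)"
    "m \<odot> n = Idt C (Cod C m)"
proof -
  obtain a b where ab: "is_coequaliser C a b z" using z unfolding regular_epi_def by auto
  have Dz: "Dom C z = Dom C y" "Cod C z = Cod C m" using my by auto
  note D = coequaliserD[OF ab]
  have [simp]: "a \<in> Mor C" "b \<in> Mor C" "Dom C a = Dom C b" "Cod C a = Dom C y" "Cod C b = Dom C y"
    using D Dz by simp_all
  have "m \<odot> (y \<odot> a) = m \<odot> (y \<odot> b)" using D(7) by (simp add: reassoc1[OF my])
  then have "y \<odot> a = y \<odot> b" by (rule mono[rotated -1]) simp_all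
  then obtain n where n [simp]: "n \<in> Mor C" "Dom C n = Cod C m" "Cod C n = Cod C y" "n \<odot> z = y"
    using coequaliser_factor[OF ab, of y] Dz by auto
  have "(m \<odot> n) \<odot> z = Idt C (Cod C m) \<odot> z" using my Dz D(3) by simp
  then have mn: "m \<odot> n = Idt C (Cod C m)" by (rule regular_epi_epi[OF z, rotated -1])
    (simp_all add: Dz)
  then have "m \<odot> (n \<odot> m) = m \<odot> Idt C (Dom C m)" by (simp add: reassoc1[OF mn])
  then have "n \<odot> m = Idt C (Dom C m)" by (rule mono[rotated -1]) simp_all
  with mn show ?thesis by (intro that[of n]) simp_all
qed

end

section \<open>Bourn's lemma for regular epimorphisms\<close>

context exact_maltsev_category
begin

text \<open>Transitivity in terms of elements: \<open>a\<close> and \<open>b\<close> are pairs of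
  the relation that can be chained, and \<open>h\<close> is the resulting pair.\<close>

lemma reflexive_relation_trans:
  assumes "is_reflexive_relation C r s" "a \<in> Mor C" "b \<in> Mor C" "Dom C a = Dom C b"
    "Cod C a = Dom C r" "Cod C b = Dom C r"
    "s \<odot> a = r \<odot> b"
  obtains h where "h \<in> Mor C" "Dom C h = Dom C b" "Cod C h = Dom C r" "r \<odot> h = r \<odot> a" "s \<odot> h = s \<odot> b"
proof -
  have tr: "is_transitive_relation C r s" using maltsev[OF assms(1)]
    unfolding is_equivalence_relation_def by auto
  then have [simp]: "r \<in> Mor C" "s \<in> Mor C" "Dom C r = Dom C s" "Cod C r = Cod C s"
    unfolding is_transitive_relation_def is_relation_def by auto
  obtain p q where pb: "is_pullback C s r p q" using ex_pullback[of s r] by auto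
  note [simp] = pullbackD(3-4,6-8)[OF pb]
  have "\<exists>t \<in> hom_set C (Dom C p) (Dom C r). r \<odot> t = r \<odot> p \<and> s \<odot> t = s \<odot> q"
    using tr pb unfolding is_transitive_relation_def by blast
  then obtain t where t [simp]: "t \<in> Mor C" "Dom C t = Dom C p" "Cod C t = Dom C r" "r \<odot> t = r \<odot> p"
    "s \<odot> t = s \<odot> q"
    by auto
  obtain h where h [simp]: "h \<in> Mor C" "Dom C h = Dom C b" "Cod C h = Dom C q" "p \<odot> h = a" "q \<odot> h = b"
    using pullback_lift[OF pb assms(2,3,4)] assms by auto
  have "r \<odot> (t \<odot> h) = r \<odot> a" "s \<odot> (t \<odot> h) = s \<odot> b"
    by (simp_all add: reassoc[OF t(4)] reassoc[OF t(5)])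
  then show ?thesis by (intro that[of "t \<odot> h"]) simp_all
qed

text \<open>Let \<open>I\<close> be the image of the comparison \<open>w\<close>. The pairs \<open>(a, a')\<close> with \<open>(u a, f a') \<in> I\<close> form a
  reflexive relation, hence a transitive one. Given any \<open>(u a, f a')\<close> in the pullback, the pair
  \<open>(f a, f a')\<close> lifts locally to \<open>(b, b')\<close> in the kernel pair of \<open>u\<close>, and \<open>(a, b)\<close> and \<open>(b, a')\<close> are in
  this relation.\<close>

lemma regular_epi_comparison:
  assumes sq: "comm_square C f g u v" and re: "regular_epi C f" "regular_epi C u" "regular_epi C k"
    and ku: "is_kernel_pair C u d c" and kv: "is_kernel_pair C v d' c'"
    and k: "pair_map C f d c d' c' k" and comp: "comparison C f g u v w"
  shows "regular_epi C w"
proof -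
  obtain p q where pb: "is_pullback C g v p q"
    and w: "w \<in> hom_set C (Dom C f) (Dom C p)" "p \<odot> w = u" "q \<odot> w = f"
    using comp unfolding comparison_def by auto
  note D [simp] = comm_squareD(1-8)[OF sq] pullbackD(1-4,6-8)[OF ku] pullbackD(1-4,6-8)[OF kv]
    pullbackD(1-4,6-8)[OF pb]
    pair_mapD(1-3)[OF k]
  have [simp]: "w \<in> Mor C" "Dom C w = Dom C f" "Cod C w = Dom C q" using w by simp_all
  \<comment> \<open>The image I is the codomain of \<open>e\<close>. As \<open>m\<close> embeds it
    in the pullback, its coordinates \<open>i\<close> and \<open>j\<close> are jointly
    monic.\<close>
  obtain e m where e: "regular_epi C e" and [simp]: "e \<in> Mor C" "m \<in> Mor C" "Dom C e = Dom C f"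
    "Cod C m = Dom C q"
    "Dom C m = Cod C e" and me: "m \<odot> e = w"
    and mono: "\<And>\<alpha> \<beta>. \<lbrakk>\<alpha> \<in> Mor C; \<beta> \<in> Mor C; Dom C \<alpha> = Dom C \<beta>; Cod C \<alpha> = Dom C m; Cod C \<beta>
      = Dom C m; m \<odot> \<alpha> = m \<odot> \<beta>\<rbrakk> \<Longrightarrow> \<alpha> = \<beta>"
    using image_factorization[of w] by (metis \<open>w \<in> Mor C\<close> \<open>Dom C w = Dom C f\<close> \<open>Cod C w = Dom C q\<close>)
  define i where "i = p \<odot> m"
  define j where "j = q \<odot> m"
  have ij [simp]: "i \<in> Mor C" "j \<in> Mor C" "Dom C i = Cod C e" "Dom C j = Cod C e"
    "Cod C i = Dom C g" "Cod C j = Cod C f"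
    unfolding i_def j_def by simp_all
  have ie: "i \<odot> e = u" and je: "j \<odot> e = f" unfolding i_def j_def using w by (simp_all add: me)
  have ij_mono: "\<alpha> = \<beta>" if [simp]: "\<alpha> \<in> Mor C" "\<beta> \<in> Mor C" "Dom C \<alpha> = Dom C \<beta>" "Cod C \<alpha> = Cod C e"
    "Cod C \<beta> = Cod C e"
    and "i \<odot> \<alpha> = i \<odot> \<beta>" "j \<odot> \<alpha> = j \<odot> \<beta>" for \<alpha> \<beta>
  proof -
    have "m \<odot> \<alpha> = m \<odot> \<beta>"
      by (rule pullback_unique[OF pb]) (use that in \<open>simp_all add: i_def j_def\<close>)
    then show ?thesis by (rule mono[rotated -1]) simp_all
  qed
  \<comment> \<open>The relation is built from triples (x, x', z) with z in I, u x = i z and f x' =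
    j z: the first pullback joins x to z, the second one adds x'. Its legs \<open>s1\<close> and
    \<open>s2\<close> are x and x'; by \<open>ij_mono\<close> these determine z, so the legs are
    jointly monic.\<close>
  obtain \<pi> \<iota> where P1: "is_pullback C u i \<pi> \<iota>" using ex_pullback[of u i] by auto
  note [simp] = pullbackD(3-4,6-8)[OF P1]
  obtain \<sigma> s2 where P2: "is_pullback C (j \<odot> \<iota>) f \<sigma> s2" using ex_pullback[of "j \<odot> \<iota>" f] by auto
  have [simp]: "\<sigma> \<in> Mor C" "s2 \<in> Mor C" "Cod C \<sigma> = Dom C \<iota>" "Cod C s2 = Dom C f" "Dom C \<sigma> = Dom C s2"
    using pullbackD(3-4,6-8)[OF P2] by simp_all
  have s2: "j \<odot> (\<iota> \<odot> \<sigma>) = f \<odot> s2" using pullbackD(9)[OF P2] by simp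
  define s1 where "s1 = \<pi> \<odot> \<sigma>"
  have s1 [simp]: "s1 \<in> Mor C" "Dom C s1 = Dom C s2" "Cod C s1 = Dom C f" unfolding s1_def by simp_all
  have us1: "u \<odot> s1 = i \<odot> (\<iota> \<odot> \<sigma>)" unfolding s1_def by (rule reassoc[OF pullbackD(9)[OF P1]]) simp_all
  have lift: "\<exists>h. h \<in> Mor C \<and> Dom C h = Dom C a \<and> Cod C h = Dom C s2 \<and> s1 \<odot> h = a \<and> s2 \<odot> h = a'"
    if [simp]: "a \<in> Mor C" "a' \<in> Mor C" "b \<in> Mor C" "Dom C a' = Dom C a" "Dom C b = Dom C a"
      "Cod C a = Dom C f" "Cod C a' = Dom C f" "Cod C b = Cod C e" and ua: "u \<odot> a = i \<odot> b"
        and fa: "f \<odot> a' = j \<odot> b" for a a' b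
  proof -
    obtain h1 where h1 [simp]: "h1 \<in> Mor C" "Dom C h1 = Dom C a" "Cod C h1 = Dom C \<iota>" "\<pi> \<odot> h1 = a"
      "\<iota> \<odot> h1 = b"
      using pullback_lift[OF P1, of a b] ua by auto
    obtain h where h [simp]: "h \<in> Mor C" "Dom C h = Dom C a" "Cod C h = Dom C s2" "\<sigma> \<odot> h = h1"
      "s2 \<odot> h = a'"
      using pullback_lift[OF P2, of h1 a'] fa by auto
    have "s1 \<odot> h = a" unfolding s1_def by simp
    then show ?thesis by (intro exI[of _ h]) simp
  qed
  have "is_relation C s1 s2"
    unfolding is_relation_def
  proof (intro conjI ballI impI)
    fix a b assume [simp]: "a \<in> Mor C" "b \<in> Mor C"
      and A: "Dom C a = Dom C b \<and> Cod C a = Dom C s1 \<and> Cod C b = Dom C s1 \<and> s1 \<odot> a = s1 \<odot> b \<and> s2 \<odot> a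
        = s2 \<odot> b"
    then have [simp]: "Dom C a = Dom C b" "Cod C a = Dom C s2" "Cod C b = Dom C s2" by simp_all
    have "i \<odot> ((\<iota> \<odot> \<sigma>) \<odot> a) = i \<odot> ((\<iota> \<odot> \<sigma>) \<odot> b)"
      by (subst (1 2) reassoc[OF us1[symmetric]]) (use A in simp_all)
    moreover have "j \<odot> ((\<iota> \<odot> \<sigma>) \<odot> a) = j \<odot> ((\<iota> \<odot> \<sigma>) \<odot> b)"
      by (subst (1 2) reassoc[OF s2]) (use A in simp_all)
    ultimately have "(\<iota> \<odot> \<sigma>) \<odot> a = (\<iota> \<odot> \<sigma>) \<odot> b" by (rule ij_mono[rotated -2]) simp_all
    moreover have "\<pi> \<odot> (\<sigma> \<odot> a) = \<pi> \<odot> (\<sigma> \<odot> b)" using A unfolding s1_def by simp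
    ultimately have "\<sigma> \<odot> a = \<sigma> \<odot> b" by (intro pullback_unique[OF P1, of "\<sigma> \<odot> a" "\<sigma> \<odot> b"]) simp_all
    then show "a = b" using A by (intro pullback_unique[OF P2, of a b]) simp_all
  qed simp_all
  \<comment> \<open>The pair (x, x) is witnessed by the point e x of I.\<close>
  moreover obtain r where "r \<in> Mor C" "Dom C r = Dom C f" "Cod C r = Dom C s2"
    "s1 \<odot> r = Idt C (Dom C f)" "s2 \<odot> r = Idt C (Dom C f)"
    using lift[of "Idt C (Dom C f)" "Idt C (Dom C f)" e] by (auto simp: ie je)
  ultimately have refl: "is_reflexive_relation C s1 s2"
    unfolding is_reflexive_relation_def by auto
  \<comment> \<open>The generic point of the pullback, its identity, is lifted in both coordinates
    over a cover \<open>t\<close>: u a = p t and f a' = q t.\<close>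
  obtain a0 t1 where 1: "regular_epi C t1" "u \<odot> a0 = p \<odot> t1"
    and [simp]: "a0 \<in> Mor C" "t1 \<in> Mor C" "Cod C a0 = Dom C f" "Cod C t1 = Dom C q"
      "Dom C a0 = Dom C t1"
    by (rule regular_epi_cover[OF re(2), of p]) simp_all
  obtain a' t2 where 2: "regular_epi C t2" "f \<odot> a' = (q \<odot> t1) \<odot> t2"
    and [simp]: "a' \<in> Mor C" "t2 \<in> Mor C" "Cod C a' = Dom C f" "Cod C t2 = Dom C t1"
      "Dom C a' = Dom C t2"
    by (rule regular_epi_cover[OF re(1), of "q \<odot> t1"]) simp_all
  define a where "a = a0 \<odot> t2"
  define t where "t = t1 \<odot> t2"
  have [simp]: "a \<in> Mor C" "Cod C a = Dom C f" "Dom C a = Dom C t2" "t \<in> Mor C" "Dom C t = Dom C t2"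
    "Cod C t = Dom C q"
    unfolding a_def t_def by simp_all
  have ua: "u \<odot> a = p \<odot> t" unfolding a_def t_def by (rule reassoc[OF 1(2)]) simp_all
  have fa': "f \<odot> a' = q \<odot> t" unfolding t_def using 2(2) by simp
  have "v \<odot> (f \<odot> a) = g \<odot> (u \<odot> a)" by (rule reassoc[OF comm_squareD(9)[OF sq, symmetric]]) simp_all
  also have "\<dots> = v \<odot> (q \<odot> t)" unfolding ua by (rule reassoc[OF pullbackD(9)[OF pb]]) simp_all
  finally obtain b where b [simp]: "b \<in> Mor C" "Dom C b = Dom C t2" "Cod C b = Dom C c'"
    "d' \<odot> b = f \<odot> a" "c' \<odot> b = f \<odot> a'"
    using pullback_lift[OF kv, of "f \<odot> a" "f \<odot> a'"] fa' by auto
  \<comment> \<open>Since \<open>k\<close> is a regular epimorphism, the pair (f a, f a') in the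
    kernel pair of \<open>v\<close> lifts locally to \<open>\<kappa>\<close>. The b and b' announced
    above are \<open>d \<odot> \<kappa>\<close> and \<open>c \<odot> \<kappa>\<close>.\<close>
  obtain \<kappa> t3 where 3: "regular_epi C t3" "k \<odot> \<kappa> = b \<odot> t3"
    and [simp]: "\<kappa> \<in> Mor C" "t3 \<in> Mor C" "Cod C \<kappa> = Dom C c" "Cod C t3 = Dom C t2"
      "Dom C \<kappa> = Dom C t3"
    by (rule regular_epi_cover[OF re(3), of b]) simp_all
  have fd: "f \<odot> (d \<odot> \<kappa>) = f \<odot> (a \<odot> t3)"
    by (simp add: reassoc[OF pair_mapD(4)[OF k, symmetric]] 3(2) reassoc[OF b(4)])
  have fc: "f \<odot> (c \<odot> \<kappa>) = f \<odot> (a' \<odot> t3)"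
    by (simp add: reassoc[OF pair_mapD(5)[OF k, symmetric]] 3(2) reassoc[OF b(5)])
  have udc: "u \<odot> (d \<odot> \<kappa>) = u \<odot> (c \<odot> \<kappa>)" by (rule reassoc[OF pullbackD(9)[OF ku]]) simp_all
  \<comment> \<open>Witnesses in I: e a for (a, b), because f b = f a, and e b' for (b, a'), because
    u b = u b' and f b' = f a'.\<close>
  obtain h1 where h1 [simp]: "h1 \<in> Mor C" "Dom C h1 = Dom C t3" "Cod C h1 = Dom C s2"
    "s1 \<odot> h1 = a \<odot> t3" "s2 \<odot> h1 = d \<odot> \<kappa>"
    using lift[of "a \<odot> t3" "d \<odot> \<kappa>" "e \<odot> (a \<odot> t3)"] fd by (auto simp: reassoc1[OF ie] reassoc1[OF je])
  obtain h2 where h2 [simp]: "h2 \<in> Mor C" "Dom C h2 = Dom C t3" "Cod C h2 = Dom C s2"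
    "s1 \<odot> h2 = d \<odot> \<kappa>" "s2 \<odot> h2 = a' \<odot> t3"
    using lift[of "d \<odot> \<kappa>" "a' \<odot> t3" "e \<odot> (c \<odot> \<kappa>)"] fc udc
      by (auto simp: reassoc1[OF ie] reassoc1[OF je])
  obtain h3 where h3 [simp]: "h3 \<in> Mor C" "Dom C h3 = Dom C t3" "Cod C h3 = Dom C s2"
    "s1 \<odot> h3 = a \<odot> t3" "s2 \<odot> h3 = a' \<odot> t3"
    using reflexive_relation_trans[OF refl, of h1 h2] by auto
  \<comment> \<open>The point of I that witnesses (a, a'). Since \<open>m\<close> sends it to the
    generic point over the cover, the regular epimorphism \<open>t \<odot> t3\<close> factors
    through \<open>m\<close>, which is therefore invertible.\<close>
  define y where "y = (\<iota> \<odot> \<sigma>) \<odot> h3"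
  have y [simp]: "y \<in> Mor C" "Dom C y = Dom C t3" "Cod C y = Cod C e" unfolding y_def by simp_all
  have "p \<odot> (m \<odot> y) = i \<odot> y" unfolding i_def by simp
  also have "\<dots> = u \<odot> (s1 \<odot> h3)" unfolding y_def by (rule reassoc[OF us1[symmetric]]) simp_all
  also have "\<dots> = u \<odot> (a \<odot> t3)" by simp
  also have "\<dots> = p \<odot> (t \<odot> t3)" by (rule reassoc[OF ua]) simp_all
  finally have py: "p \<odot> (m \<odot> y) = p \<odot> (t \<odot> t3)" .
  have "q \<odot> (m \<odot> y) = j \<odot> y" unfolding j_def by simp
  also have "\<dots> = f \<odot> (s2 \<odot> h3)" unfolding y_def by (rule reassoc[OF s2]) simp_all
  also have "\<dots> = f \<odot> (a' \<odot> t3)" by simp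
  also have "\<dots> = q \<odot> (t \<odot> t3)" by (rule reassoc[OF fa']) simp_all
  finally have qy: "q \<odot> (m \<odot> y) = q \<odot> (t \<odot> t3)" .
  have my: "m \<odot> y = t \<odot> t3" by (rule pullback_unique[OF pb]) (use py qy in simp_all)
  have z: "regular_epi C (t \<odot> t3)"
    unfolding t_def by (intro regular_epi_Cmp 1 2 3) simp_all
  obtain n where n: "n \<in> Mor C" "Dom C n = Cod C m" "Cod C n = Dom C m"
      "n \<odot> m = Idt C (Dom C m)" "m \<odot> n = Idt C (Cod C m)"
    by (rule regular_epi_mono_iso[OF z _ _ _ my]) (simp, simp, simp, rule mono)
  have "is_pullback C e n (Idt C (Dom C e)) (m \<odot> e)"
    by (rule pullback_inverse) (use n in simp_all)
  then show ?thesis using regular_epi_stable e me by metis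
qed

end

subsection \<open>Transfer along the isomorphism of \<open>X\<close> with \<open>base X\<close>\<close>

lemma Obj_base [simp]: "Obj (base X) = Ob0 ` Obj X"
  and Mor_base [simp]: "Mor (base X) = Mor0 ` Mor X"
  and Dom_base [simp]: "Dom (base X) (Mor0 f) = Ob0 (Dom X f)"
  and Cod_base [simp]: "Cod (base X) (Mor0 f) = Ob0 (Cod X f)"
  and Idt_base [simp]: "Idt (base X) (Ob0 A) = Mor0 (Idt X A)"
  and Cmp_base [simp]: "Mor0 g \<odot>\<^bsub>base X\<^esub> Mor0 f = Mor0 (g \<odot>\<^bsub>X\<^esub> f)"
  by (simp_all add: base_def)

lemma Ex1_Mor0: "(\<exists>!h. h \<in> Mor0 ` M \<and> Q h) \<longleftrightarrow> (\<exists>!h. h \<in> M \<and> Q (Mor0 h))"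
  by (auto simp: Ex1_def)

lemma category_base: "category X \<Longrightarrow> category (base X)"
  unfolding category_def by auto

lemma pullback_base [simp]:
  "is_pullback (base X) (Mor0 f) (Mor0 g) (Mor0 p) (Mor0 q) \<longleftrightarrow> is_pullback X f g p q"
  unfolding is_pullback_def by (simp add: Ex1_Mor0 inj_image_mem_iff inj_def ball_simps cong:
    conj_cong)

lemma coequaliser_base [simp]:
  "is_coequaliser (base X) (Mor0 d) (Mor0 c) (Mor0 f) \<longleftrightarrow> is_coequaliser X d c f"
  unfolding is_coequaliser_def by (simp add: Ex1_Mor0 inj_image_mem_iff inj_def)

lemma regular_epi_base [simp]: "regular_epi (base X) (Mor0 f) \<longleftrightarrow> regular_epi X f"
proof
  assume "regular_epi (base X) (Mor0 f)"
  then obtain d c where "is_coequaliser (base X) d c (Mor0 f)" unfolding regular_epi_def by auto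
  moreover from this obtain d' c' where "d = Mor0 d'" "c = Mor0 c'" unfolding is_coequaliser_def
    by auto
  ultimately show "regular_epi X f" unfolding regular_epi_def by auto
next
  assume "regular_epi X f"
  then obtain d c where "is_coequaliser X d c f" unfolding regular_epi_def by auto
  then have "is_coequaliser (base X) (Mor0 d) (Mor0 c) (Mor0 f)" by simp
  then show "regular_epi (base X) (Mor0 f)" unfolding regular_epi_def by blast
qed

text \<open>Regular epimorphisms are stable under all pullbacks, so at the bottom level the class
  \<open>P\<close> contains every object.\<close>

lemma relative_maltsev_base:
  assumes "exact_maltsev_category X"
  shows "cell_relative_maltsev (base X) (\<lambda>_. True) (regular_epi (base X))"
proof -
  interpret exact_maltsev_category X by fact
  have Mor0: "\<exists>f. e = Mor0 f \<and> f \<in> Mor X" if "e \<in> Mor (base X)" for e using that by auto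
  show ?thesis
  proof (intro cell_relative_maltsev.intro relative_maltsev.intro relative_maltsev_axioms.intro
    pullback_category.intro
      pullback_category_axioms.intro category_base category_axioms TrueI)
    fix f g assume "f \<in> Mor (base X)" "g \<in> Mor (base X)" "Cod (base X) f = Cod (base X) g"
    then obtain f' g' where "f = Mor0 f'" "g = Mor0 g'" "f' \<in> Mor X" "g' \<in> Mor X"
      "Cod X f' = Cod X g'" by auto
    moreover from this obtain p q where "is_pullback X f' g' p q" using ex_pullback by blast
    ultimately have "is_pullback (base X) f g (Mor0 p) (Mor0 q)" by simp
    then show "\<exists>p q. is_pullback (base X) f g p q" by blast
  next
    fix e assume "regular_epi (base X) e"
    then show "e \<in> Mor (base X)" unfolding regular_epi_def is_coequaliser_def by auto
  next
    fix e g p q assume pb: "is_pullback (base X) e g p q" and e: "regular_epi (base X) e"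
    then obtain e' g' p' q' where "e = Mor0 e'" "g = Mor0 g'" "p = Mor0 p'" "q = Mor0 q'"
      unfolding is_pullback_def by auto
    then show "regular_epi (base X) q" using pb e regular_epi_stable by auto
  next
    fix e e' assume *: "regular_epi (base X) e" "regular_epi (base X) e'"
      "Dom (base X) e' = Cod (base X) e"
    then obtain f f' where "e = Mor0 f" "e' = Mor0 f'" unfolding regular_epi_def is_coequaliser_def
      by auto
    then show "regular_epi (base X) (e' \<odot>\<^bsub>base X\<^esub> e)" using * regular_epi_Cmp by auto
  next
    fix f g u v d c d' c' k w
    assume sq: "comm_square (base X) f g u v" and re: "regular_epi (base X) f"
      "regular_epi (base X) u"
      and ku: "is_kernel_pair (base X) u d c" and kv: "is_kernel_pair (base X) v d' c'"
      and k: "pair_map (base X) f d c d' c' k" "regular_epi (base X) k"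
        and comp: "comparison (base X) f g u v w"
    obtain p q where pb: "is_pullback (base X) g v p q"
      and w: "w \<in> hom_set (base X) (Dom (base X) f) (Dom (base X) p)"
      "p \<odot>\<^bsub>base X\<^esub> w = u" "q \<odot>\<^bsub>base X\<^esub> w = f"
      using comp unfolding comparison_def by auto
    have "f \<in> Mor (base X)" "g \<in> Mor (base X)" "u \<in> Mor (base X)" "v \<in> Mor (base X)"
      using sq unfolding comm_square_def by auto
    then obtain f1 g1 u1 v1 where 1: "f = Mor0 f1" "g = Mor0 g1" "u = Mor0 u1" "v = Mor0 v1" by auto
    have "d \<in> Mor (base X)" "c \<in> Mor (base X)" "d' \<in> Mor (base X)" "c' \<in> Mor (base X)"
      "p \<in> Mor (base X)" "q \<in> Mor (base X)"
      using ku kv pb unfolding is_pullback_def by auto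
    then obtain d1 c1 d1' c1' p1 q1 where 2: "d = Mor0 d1" "c = Mor0 c1" "d' = Mor0 d1'"
      "c' = Mor0 c1'" "p = Mor0 p1" "q = Mor0 q1"
      by auto
    have "k \<in> Mor (base X)" "w \<in> Mor (base X)" using k w unfolding pair_map_def by auto
    then obtain k1 w1 where 3: "k = Mor0 k1" "w = Mor0 w1" by auto
    have pb': "is_pullback X g1 v1 p1 q1" using pb by (simp add: 1 2)
    have "regular_epi X w1"
    proof (rule regular_epi_comparison)
      show "comm_square X f1 g1 u1 v1" using sq unfolding comm_square_def by (auto simp: 1)
      show "regular_epi X f1" "regular_epi X u1" "regular_epi X k1" "is_kernel_pair X u1 d1 c1"
        "is_kernel_pair X v1 d1' c1'"
        using re ku kv k(2) by (simp_all add: 1 2 3)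
      show "pair_map X f1 d1 c1 d1' c1' k1" using k(1) unfolding pair_map_def by (auto simp: 1 2 3)
      show "comparison X f1 g1 u1 v1 w1"
        using w pullbackD(8)[OF pb'] by (intro comparisonI[OF pb']) (auto simp: 1 2 3)
    qed
    then show "regular_epi (base X) w" by (simp add: 3)
  qed
qed

subsection \<open>Fork categories\<close>

context category
begin

lemma comm_square_paste:
  assumes "comm_square C f g u v" "comm_square C f' g' v w"
  shows "comm_square C (f' \<odot> f) (g' \<odot> g) u w"
  using comm_square_Cmp[OF comm_square_sym[OF assms(1)] comm_square_sym[OF assms(2)]]
    by (rule comm_square_sym)

lemma comm_square_pullback_unique:
  assumes pb0: "is_pullback C g0 v0 p0 q0"
    and sq: "comm_square C r c p1 p0" "comm_square C r b q1 q0" "comm_square C r' c p1 p0"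
      "comm_square C r' b q1 q0"
  shows "r = r'"
  using comm_squareD[OF sq(1)] comm_squareD[OF sq(2)] comm_squareD[OF sq(3)] comm_squareD[OF sq(4)]
  by (intro pullback_unique[OF pb0, of r r']) simp_all

end

lemma forkD:
  assumes "is_fork C F"
  shows "fork_d F \<in> Mor C" "fork_c F \<in> Mor C" "fork_e F \<in> Mor C" "fork_f F \<in> Mor C"
    "Dom C (fork_c F) = Dom C (fork_d F)" "Cod C (fork_d F) = Dom C (fork_f F)"
      "Cod C (fork_c F) = Dom C (fork_f F)"
    "Dom C (fork_e F) = Dom C (fork_f F)" "Cod C (fork_e F) = Dom C (fork_d F)"
    "fork_f F \<odot>\<^bsub>C\<^esub> fork_d F = fork_f F \<odot>\<^bsub>C\<^esub> fork_c F"
    "fork_d F \<odot>\<^bsub>C\<^esub> fork_e F = Idt C (Dom C (fork_f F))"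
      "fork_c F \<odot>\<^bsub>C\<^esub> fork_e F = Idt C (Dom C (fork_f F))"
    "Fork (fork_d F) (fork_c F) (fork_e F) (fork_f F) = F"
  using assms unfolding is_fork_def by auto

lemma is_forkI:
  assumes "d \<in> Mor C" "c \<in> Mor C" "e \<in> Mor C" "f \<in> Mor C"
    "Dom C c = Dom C d" "Cod C d = Dom C f" "Cod C c = Dom C f" "Dom C e = Dom C f"
      "Cod C e = Dom C d"
    "f \<odot>\<^bsub>C\<^esub> d = f \<odot>\<^bsub>C\<^esub> c" "d \<odot>\<^bsub>C\<^esub> e = Idt C (Dom C f)" "c \<odot>\<^bsub>C\<^esub> e = Idt C (Dom C f)"
  shows "is_fork C (Fork d c e f)"
  using assms unfolding is_fork_def by auto

lemma fork_ob_simps [simp]: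
  "fork_ob C 0 F = Cod C (fork_f F)" "fork_ob C (Suc 0) F = Dom C (fork_f F)"
    "fork_ob C 2 F = Dom C (fork_d F)"
  by (simp_all add: fork_ob_def)

definition fork_map :: "('o, 'm) cell_cat \<Rightarrow> ('o, 'm) cell \<Rightarrow> ('o, 'm) cell \<Rightarrow> ('o, 'm) cell \<Rightarrow> ('o, 'm)
  cell \<Rightarrow>
    ('o, 'm) cell \<Rightarrow> bool" where
  "fork_map C F G u2 u1 u0 \<longleftrightarrow> is_fork C F \<and> is_fork C G \<and>
     comm_square C (fork_d F) (fork_d G) u2 u1 \<and> comm_square C (fork_c F) (fork_c G) u2 u1 \<and>
     comm_square C (fork_e F) (fork_e G) u1 u2 \<and> comm_square C (fork_f F) (fork_f G) u1 u0"

lemma fork_mapD: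
  assumes "fork_map C F G u2 u1 u0"
  shows "is_fork C F" "is_fork C G" "comm_square C (fork_d F) (fork_d G) u2 u1"
    "comm_square C (fork_c F) (fork_c G) u2 u1"
    "comm_square C (fork_e F) (fork_e G) u1 u2" "comm_square C (fork_f F) (fork_f G) u1 u0"
    "u2 \<in> Mor C" "Dom C u2 = Dom C (fork_d F)" "Cod C u2 = Dom C (fork_d G)"
    "u1 \<in> Mor C" "Dom C u1 = Dom C (fork_f F)" "Cod C u1 = Dom C (fork_f G)"
    "u0 \<in> Mor C" "Dom C u0 = Cod C (fork_f F)" "Cod C u0 = Cod C (fork_f G)"
  using assms unfolding fork_map_def comm_square_def by auto

text \<open>Up to isomorphism, the forks in the image of \<open>EqFork\<close>. Exactness adds that
  \<open>fork_f F\<close> is the coequaliser.\<close>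

definition kernel_fork :: "('o, 'm) cell_cat \<Rightarrow> ('o, 'm) cell \<Rightarrow> bool" where
  "kernel_fork C F \<longleftrightarrow> is_fork C F \<and> is_kernel_pair C (fork_f F) (fork_d F) (fork_c F)"

context cell_category
begin

lemma Obj_ForkC [simp]: "F \<in> Obj (ForkC C) \<longleftrightarrow> is_fork C F"
  and ForkMap_Mor_ForkC [simp]: "ForkMap F G u2 u1 u0 \<in> Mor (ForkC C) \<longleftrightarrow> fork_map C F G u2 u1 u0"
  and Dom_ForkC [simp]: "Dom (ForkC C) (ForkMap F G u2 u1 u0) = F"
  and Cod_ForkC [simp]: "Cod (ForkC C) (ForkMap F G u2 u1 u0) = G"
  and Idt_ForkC [simp]: "Idt (ForkC C) F =
    ForkMap F F (Idt C (Dom C (fork_d F))) (Idt C (Dom C (fork_f F))) (Idt C (Cod C (fork_f F)))"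
  and Cmp_ForkC [simp]: "ForkMap G' H v2 v1 v0 \<odot>\<^bsub>ForkC C\<^esub> ForkMap F G u2 u1 u0
    = ForkMap F H (v2 \<odot> u2) (v1 \<odot> u1) (v0 \<odot> u0)"
  by (auto simp: ForkC_def fork_map_def comm_square_def forkD)

lemma Mor_ForkCE:
  assumes "x \<in> Mor (ForkC C)"
  obtains F G u2 u1 u0 where "x = ForkMap F G u2 u1 u0" "fork_map C F G u2 u1 u0"
proof -
  from assms obtain F G u2 u1 u0 where x: "x = ForkMap F G u2 u1 u0" unfolding ForkC_def by auto
  then show ?thesis using assms that by simp
qed

lemma fork_map_Cmp:
  assumes "fork_map C F G u2 u1 u0" "fork_map C G H v2 v1 v0"
  shows "fork_map C F H (v2 \<odot> u2) (v1 \<odot> u1) (v0 \<odot> u0)"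
  unfolding fork_map_def using fork_mapD[OF assms(1)] fork_mapD[OF assms(2)] comm_square_Cmp by blast

lemma fork_map_Idt:
  assumes "is_fork C F"
  shows "fork_map C F F (Idt C (Dom C (fork_d F))) (Idt C (Dom C (fork_f F)))
    (Idt C (Cod C (fork_f F)))"
  unfolding fork_map_def using forkD[OF assms] comm_square_Idt[of "fork_d F"]
    comm_square_Idt[of "fork_c F"]
     comm_square_Idt[of "fork_e F"] comm_square_Idt[of "fork_f F"] assms by simp

lemma category_ForkC: "category (ForkC C)"
proof (unfold_locales, goal_cases)
  case (4 f g)
  then show ?case by (elim Mor_ForkCE) (simp add: fork_map_Cmp)
next
  case (7 f g h)
  then show ?case by (elim Mor_ForkCE) (simp add: fork_mapD(7-15))
qed (elim Mor_ForkCE; simp add: fork_mapD fork_map_Idt forkD; fail | simp add: fork_map_Idt)+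

text \<open>The kernel pair of the target supplies the missing component, uniquely by
  \<open>fork_map_unique\<close>. So maps into a kernel pair fork are the same as maps of the
  underlying arrows, which is the universal property behind the adjunction of \<open>arr\<close> and
  \<open>EqFork\<close>.\<close>

lemma ex_fork_map:
  assumes F: "is_fork C F" and G: "kernel_fork C G"
    and sq: "comm_square C (fork_f F) (fork_f G) u1 u0"
  obtains u2 where "fork_map C F G u2 u1 u0"
proof -
  have kG: "is_kernel_pair C (fork_f G) (fork_d G) (fork_c G)" and fG: "is_fork C G" using G
    unfolding kernel_fork_def by auto
  note [simp] = forkD(1-9)[OF F] forkD(1-9)[OF fG] comm_squareD(1-8)[OF sq]
  have "fork_f G \<odot> (u1 \<odot> fork_d F) = u0 \<odot> (fork_f F \<odot> fork_d F)"
    by (rule reassoc[OF comm_squareD(9)[OF sq]]) simp_all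
  also have "\<dots> = u0 \<odot> (fork_f F \<odot> fork_c F)" by (simp only: forkD(10)[OF F])
  also have "\<dots> = fork_f G \<odot> (u1 \<odot> fork_c F)"
    by (rule reassoc[OF comm_squareD(9)[OF sq, symmetric]]) simp_all
  finally obtain u2 where u2 [simp]: "u2 \<in> Mor C" "Dom C u2 = Dom C (fork_d F)"
    "Cod C u2 = Dom C (fork_d G)"
    "fork_d G \<odot> u2 = u1 \<odot> fork_d F" "fork_c G \<odot> u2 = u1 \<odot> fork_c F"
    using pullback_lift[OF kG, of "u1 \<odot> fork_d F" "u1 \<odot> fork_c F"] by auto
  have "fork_e G \<odot> u1 = u2 \<odot> fork_e F"
    by (rule pullback_unique[OF kG])
      (simp_all add: reassoc1[OF forkD(11)[OF fG]] reassoc1[OF forkD(12)[OF fG]] reassoc[OF u2(4)]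
        reassoc[OF u2(5)] forkD(11,12)[OF F])
  then show ?thesis
    using F fG sq by (intro that[of u2]) (simp add: fork_map_def, simp add: comm_square_def)
qed

lemma fork_map_unique:
  assumes "kernel_fork C G" "fork_map C F G u2 u1 u0" "fork_map C F G v2 u1 u0"
  shows "u2 = v2"
proof (rule pullback_unique)
  show "is_kernel_pair C (fork_f G) (fork_d G) (fork_c G)" using assms(1) unfolding kernel_fork_def
    by auto
  show "fork_d G \<odot> u2 = fork_d G \<odot> v2" "fork_c G \<odot> u2 = fork_c G \<odot> v2"
    using comm_squareD(9)[OF fork_mapD(3)[OF assms(2)]] comm_squareD(9)[OF fork_mapD(3)[OF assms(3)]]
      comm_squareD(9)[OF fork_mapD(4)[OF assms(2)]] comm_squareD(9)[OF fork_mapD(4)[OF assms(3)]]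
        by simp_all
qed (use fork_mapD(7-9)[OF assms(2)] fork_mapD(7-9)[OF assms(3)] in simp_all)

end

sublocale cell_category \<subseteq> Fork: category "ForkC C"
  by (rule category_ForkC)

context cell_category
begin

lemma iso_ForkC_iff:
  "is_iso (ForkC C) (ForkMap F G u2 u1 u0) \<longleftrightarrow> fork_map C F G u2 u1 u0 \<and> is_iso C u2 \<and> is_iso C u1
    \<and> is_iso C u0"
proof safe
  assume "is_iso (ForkC C) (ForkMap F G u2 u1 u0)"
  then obtain y where y: "ForkMap F G u2 u1 u0 \<in> Mor (ForkC C)" "y \<in> Mor (ForkC C)"
    "Dom (ForkC C) y = G" "Cod (ForkC C) y = F"
    "y \<odot>\<^bsub>ForkC C\<^esub> ForkMap F G u2 u1 u0 = Idt (ForkC C) F"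
      "ForkMap F G u2 u1 u0 \<odot>\<^bsub>ForkC C\<^esub> y = Idt (ForkC C) G"
    using Fork.isoE by (metis Dom_ForkC Cod_ForkC)
  then obtain v2 v1 v0 where y': "y = ForkMap G F v2 v1 v0" "fork_map C G F v2 v1 v0"
    by (metis Mor_ForkCE Dom_ForkC Cod_ForkC)
  show u: "fork_map C F G u2 u1 u0" using y by simp
  note D = fork_mapD(7-)[OF u] fork_mapD(7-)[OF y'(2)]
  show "is_iso C u2" by (rule isoI[of u2 v2]) (use y(5,6) y' D in simp_all)
  show "is_iso C u1" by (rule isoI[of u1 v1]) (use y(5,6) y' D in simp_all)
  show "is_iso C u0" by (rule isoI[of u0 v0]) (use y(5,6) y' D in simp_all)
next
  assume u: "fork_map C F G u2 u1 u0" and iso: "is_iso C u2" "is_iso C u1" "is_iso C u0"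
  note D = fork_mapD(7-)[OF u]
  obtain v2 where v2: "v2 \<in> Mor C" "Dom C v2 = Cod C u2" "Cod C v2 = Dom C u2"
    "v2 \<odot> u2 = Idt C (Dom C u2)" "u2 \<odot> v2 = Idt C (Cod C u2)" using iso(1) by (rule isoE)
  obtain v1 where v1: "v1 \<in> Mor C" "Dom C v1 = Cod C u1" "Cod C v1 = Dom C u1"
    "v1 \<odot> u1 = Idt C (Dom C u1)" "u1 \<odot> v1 = Idt C (Cod C u1)" using iso(2) by (rule isoE)
  obtain v0 where v0: "v0 \<in> Mor C" "Dom C v0 = Cod C u0" "Cod C v0 = Dom C u0"
    "v0 \<odot> u0 = Idt C (Dom C u0)" "u0 \<odot> v0 = Idt C (Cod C u0)" using iso(3) by (rule isoE)
  have v: "fork_map C G F v2 v1 v0"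
    unfolding fork_map_def
    using comm_square_inverse[OF fork_mapD(3)[OF u] v2(1-3,5) v1(1-4)]
      comm_square_inverse[OF fork_mapD(4)[OF u] v2(1-3,5) v1(1-4)]
      comm_square_inverse[OF fork_mapD(5)[OF u] v1(1-3,5) v2(1-4)]
        comm_square_inverse[OF fork_mapD(6)[OF u] v1(1-3,5) v0(1-4)]
      fork_mapD(1,2)[OF u] by simp
  show "is_iso (ForkC C) (ForkMap F G u2 u1 u0)"
    using u v D v2 v1 v0 by (intro Fork.isoI[of _ "ForkMap G F v2 v1 v0"]) simp_all
qed

lemma pullback_ForkI:
  assumes g: "fork_map C A D g2 g1 g0" and v: "fork_map C B D v2 v1 v0"
    and p: "fork_map C R A p2 p1 p0" and q: "fork_map C R B q2 q1 q0"
    and pb2: "is_pullback C g2 v2 p2 q2" and pb1: "is_pullback C g1 v1 p1 q1"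
      and pb0: "is_pullback C g0 v0 p0 q0"
  shows "is_pullback (ForkC C) (ForkMap A D g2 g1 g0) (ForkMap B D v2 v1 v0) (ForkMap R A p2 p1 p0)
    (ForkMap R B q2 q1 q0)"
proof (rule Fork.pullbackI)
  note Dg [simp] = fork_mapD(7-)[OF g] fork_mapD(7-)[OF v] fork_mapD(7-)[OF p] fork_mapD(7-)[OF q]
  fix x y assume "x \<in> Mor (ForkC C)" "y \<in> Mor (ForkC C)" "Dom (ForkC C) x = Dom (ForkC C) y"
    "Cod (ForkC C) x = Dom (ForkC C) (ForkMap A D g2 g1 g0)"
      "Cod (ForkC C) y = Dom (ForkC C) (ForkMap B D v2 v1 v0)"
    and eq: "ForkMap A D g2 g1 g0 \<odot>\<^bsub>ForkC C\<^esub> x = ForkMap B D v2 v1 v0 \<odot>\<^bsub>ForkC C\<^esub> y"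
  then obtain Z x2 x1 x0 y2 y1 y0 where xy: "x = ForkMap Z A x2 x1 x0" "y = ForkMap Z B y2 y1 y0"
    and x: "fork_map C Z A x2 x1 x0" and y: "fork_map C Z B y2 y1 y0"
    by (metis Mor_ForkCE Dom_ForkC Cod_ForkC)
  note [simp] = fork_mapD(7-)[OF x] fork_mapD(7-)[OF y] pullbackD(1-4)[OF pb2]
    pullbackD(1-4)[OF pb1] pullbackD(1-4)[OF pb0]
  have [simp]: "is_fork C Z" "is_fork C R" using fork_mapD(1)[OF x] fork_mapD(1)[OF p] by auto
  note [simp] = forkD(1-9)[OF \<open>is_fork C Z\<close>] forkD(1-9)[OF \<open>is_fork C R\<close>]
  obtain h2 where h2 [simp]: "h2 \<in> Mor C" "Dom C h2 = Dom C y2" "Cod C h2 = Dom C q2" "p2 \<odot> h2 = x2"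
    "q2 \<odot> h2 = y2"
    by (rule pullback_lift[OF pb2, of x2 y2]) (use eq xy in auto)
  obtain h1 where h1 [simp]: "h1 \<in> Mor C" "Dom C h1 = Dom C y1" "Cod C h1 = Dom C q1" "p1 \<odot> h1 = x1"
    "q1 \<odot> h1 = y1"
    by (rule pullback_lift[OF pb1, of x1 y1]) (use eq xy in auto)
  obtain h0 where h0 [simp]: "h0 \<in> Mor C" "Dom C h0 = Dom C y0" "Cod C h0 = Dom C q0" "p0 \<odot> h0 = x0"
    "q0 \<odot> h0 = y0"
    by (rule pullback_lift[OF pb0, of x0 y0]) (use eq xy in auto)
  have "comm_square C (fork_d Z) (fork_d R) h2 h1"
    by (rule comm_square_lift[OF fork_mapD(3)[OF p] fork_mapD(3)[OF q] pb2 pb1 fork_mapD(3)[OF x]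
      fork_mapD(3)[OF y]]) simp_all
  moreover have "comm_square C (fork_c Z) (fork_c R) h2 h1"
    by (rule comm_square_lift[OF fork_mapD(4)[OF p] fork_mapD(4)[OF q] pb2 pb1 fork_mapD(4)[OF x]
      fork_mapD(4)[OF y]]) simp_all
  moreover have "comm_square C (fork_e Z) (fork_e R) h1 h2"
    by (rule comm_square_lift[OF fork_mapD(5)[OF p] fork_mapD(5)[OF q] pb1 pb2 fork_mapD(5)[OF x]
      fork_mapD(5)[OF y]]) simp_all
  moreover have "comm_square C (fork_f Z) (fork_f R) h1 h0"
    by (rule comm_square_lift[OF fork_mapD(6)[OF p] fork_mapD(6)[OF q] pb1 pb0 fork_mapD(6)[OF x]
      fork_mapD(6)[OF y]]) simp_all
  ultimately have "fork_map C Z R h2 h1 h0" unfolding fork_map_def by simp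
  then show "\<exists>h. h \<in> Mor (ForkC C) \<and> Dom (ForkC C) h = Dom (ForkC C) y \<and> Cod (ForkC C) h
    = Dom (ForkC C) (ForkMap R B q2 q1 q0) \<and>
      ForkMap R A p2 p1 p0 \<odot>\<^bsub>ForkC C\<^esub> h = x \<and> ForkMap R B q2 q1 q0 \<odot>\<^bsub>ForkC C\<^esub> h = y"
    by (intro exI[of _ "ForkMap Z R h2 h1 h0"]) (simp add: xy)
next
  fix h h' assume "h \<in> Mor (ForkC C)" "h' \<in> Mor (ForkC C)" "Dom (ForkC C) h = Dom (ForkC C) h'"
    "Cod (ForkC C) h = Dom (ForkC C) (ForkMap R B q2 q1 q0)"
      "Cod (ForkC C) h' = Dom (ForkC C) (ForkMap R B q2 q1 q0)"
    and eq: "ForkMap R A p2 p1 p0 \<odot>\<^bsub>ForkC C\<^esub> h = ForkMap R A p2 p1 p0 \<odot>\<^bsub>ForkC C\<^esub> h'"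
    "ForkMap R B q2 q1 q0 \<odot>\<^bsub>ForkC C\<^esub> h = ForkMap R B q2 q1 q0 \<odot>\<^bsub>ForkC C\<^esub> h'"
  then obtain Z h2 h1 h0 h2' h1' h0' where hh: "h = ForkMap Z R h2 h1 h0"
    "h' = ForkMap Z R h2' h1' h0'"
    and h: "fork_map C Z R h2 h1 h0" and h': "fork_map C Z R h2' h1' h0'"
    by (metis Mor_ForkCE Dom_ForkC Cod_ForkC)
  note [simp] = fork_mapD(7-)[OF h] fork_mapD(7-)[OF h'] fork_mapD(7-)[OF p] fork_mapD(7-)[OF q]
  have "h2 = h2'" by (rule pullback_unique[OF pb2]) (use eq hh in simp_all)
  moreover have "h1 = h1'" by (rule pullback_unique[OF pb1]) (use eq hh in simp_all)
  moreover have "h0 = h0'" by (rule pullback_unique[OF pb0]) (use eq hh in simp_all)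
  ultimately show "h = h'" by (simp add: hh)
qed (use assms pullbackD(9)[OF pb2] pullbackD(9)[OF pb1] pullbackD(9)[OF pb0] in simp_all)

end

context cell_pullbacks
begin

lemma ex_pullback_ForkC:
  assumes g: "fork_map C A D g2 g1 g0" and v: "fork_map C B D v2 v1 v0"
  obtains R p2 p1 p0 q2 q1 q0 where "fork_map C R A p2 p1 p0" "fork_map C R B q2 q1 q0"
    "is_pullback C g2 v2 p2 q2" "is_pullback C g1 v1 p1 q1" "is_pullback C g0 v0 p0 q0"
    "is_pullback (ForkC C) (ForkMap A D g2 g1 g0) (ForkMap B D v2 v1 v0) (ForkMap R A p2 p1 p0)
      (ForkMap R B q2 q1 q0)"
proof -
  note [simp] = fork_mapD(7-)[OF g] fork_mapD(7-)[OF v]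
  obtain p2 q2 where pb2: "is_pullback C g2 v2 p2 q2" using ex_pullback[of g2 v2] by auto
  obtain p1 q1 where pb1: "is_pullback C g1 v1 p1 q1" using ex_pullback[of g1 v1] by auto
  obtain p0 q0 where pb0: "is_pullback C g0 v0 p0 q0" using ex_pullback[of g0 v0] by auto
  obtain d where d: "comm_square C d (fork_d A) p2 p1" "comm_square C d (fork_d B) q2 q1"
    using ex_comm_square_pullback[OF fork_mapD(3)[OF g] fork_mapD(3)[OF v] pb2 pb1] .
  obtain c where c: "comm_square C c (fork_c A) p2 p1" "comm_square C c (fork_c B) q2 q1"
    using ex_comm_square_pullback[OF fork_mapD(4)[OF g] fork_mapD(4)[OF v] pb2 pb1] .
  obtain e where e: "comm_square C e (fork_e A) p1 p2" "comm_square C e (fork_e B) q1 q2"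
    using ex_comm_square_pullback[OF fork_mapD(5)[OF g] fork_mapD(5)[OF v] pb1 pb2] .
  obtain f where f: "comm_square C f (fork_f A) p1 p0" "comm_square C f (fork_f B) q1 q0"
    using ex_comm_square_pullback[OF fork_mapD(6)[OF g] fork_mapD(6)[OF v] pb1 pb0] .
  note A = forkD[OF fork_mapD(1)[OF g]] and B = forkD[OF fork_mapD(1)[OF v]]
  \<comment> \<open>This and the next two fork identities hold after both projections, where they
    are the identities of \<open>A\<close> and \<open>B\<close>. Pasting squares brings each into
    the form of two arrows lying over the same arrows of \<open>A\<close> and of
    \<open>B\<close>.\<close>
  have "f \<odot> d = f \<odot> c"
    using comm_square_paste[OF d(1) f(1)] comm_square_paste[OF d(2) f(2)]
      comm_square_paste[OF c(1) f(1)]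
      comm_square_paste[OF c(2) f(2)] unfolding A(10) B(10)
        by (rule comm_square_pullback_unique[OF pb0])
  moreover have D1: "Dom C d = Dom C q2" "Cod C d = Dom C q1" "Dom C c = Dom C q2"
    "Cod C c = Dom C q1"
    "Dom C e = Dom C q1" "Cod C e = Dom C q2" "Dom C f = Dom C q1" "Cod C f = Dom C q0"
    "d \<in> Mor C" "c \<in> Mor C" "e \<in> Mor C" "f \<in> Mor C"
      and D2: "Dom C p1 = Dom C f" "Dom C q1 = Dom C f" "Dom C (fork_f A) = Cod C p1"
      "Dom C (fork_f B) = Cod C q1"
    "p1 \<in> Mor C" "q1 \<in> Mor C"
    using comm_squareD[OF d(2)] comm_squareD[OF c(2)] comm_squareD[OF e(2)] comm_squareD[OF f(2)]
      comm_squareD[OF f(1)]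
    by simp_all
  have Id: "comm_square C (Idt C (Dom C f)) (Idt C (Dom C (fork_f A))) p1 p1"
      "comm_square C (Idt C (Dom C f)) (Idt C (Dom C (fork_f B))) q1 q1"
    using D1(9-) D2 unfolding comm_square_def by simp_all
  have "d \<odot> e = Idt C (Dom C f)"
    using comm_square_paste[OF e(1) d(1)] comm_square_paste[OF e(2) d(2)] Id
    unfolding A(11) B(11) by (rule comm_square_pullback_unique[OF pb1])
  moreover have "c \<odot> e = Idt C (Dom C f)"
    using comm_square_paste[OF e(1) c(1)] comm_square_paste[OF e(2) c(2)] Id
    unfolding A(12) B(12) by (rule comm_square_pullback_unique[OF pb1])
  ultimately have "is_fork C (Fork d c e f)"
    using D1 by (intro is_forkI) simp_all
  then have p: "fork_map C (Fork d c e f) A p2 p1 p0" and q: "fork_map C (Fork d c e f) B q2 q1 q0"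
    unfolding fork_map_def using fork_mapD(1)[OF g] fork_mapD(1)[OF v] d c e f by simp_all
  show ?thesis by (rule that[OF p q pb2 pb1 pb0 pullback_ForkI[OF g v p q pb2 pb1 pb0]])
qed

lemma pullback_category_ForkC: "pullback_category (ForkC C)"
proof unfold_locales
  fix f g assume "f \<in> Mor (ForkC C)" "g \<in> Mor (ForkC C)" "Cod (ForkC C) f = Cod (ForkC C) g"
  then obtain A D g2 g1 g0 B v2 v1 v0 where "f = ForkMap A D g2 g1 g0" "fork_map C A D g2 g1 g0"
      "g = ForkMap B D v2 v1 v0" "fork_map C B D v2 v1 v0"
    by (metis Mor_ForkCE Cod_ForkC)
  then show "\<exists>p q. is_pullback (ForkC C) f g p q" using ex_pullback_ForkC by metis
qed

text \<open>As for arrows: the componentwise pullback is transported along an isomorphism, which is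
  an isomorphism in each of the three components.\<close>

lemma pullback_ForkE:
  assumes "is_pullback (ForkC C) g v p q"
  obtains A B D R g2 g1 g0 v2 v1 v0 p2 p1 p0 q2 q1 q0 where
    "g = ForkMap A D g2 g1 g0" "v = ForkMap B D v2 v1 v0" "p = ForkMap R A p2 p1 p0"
      "q = ForkMap R B q2 q1 q0"
    "fork_map C A D g2 g1 g0" "fork_map C B D v2 v1 v0" "fork_map C R A p2 p1 p0"
      "fork_map C R B q2 q1 q0"
    "is_pullback C g2 v2 p2 q2" "is_pullback C g1 v1 p1 q1" "is_pullback C g0 v0 p0 q0"
proof -
  note D = Fork.pullbackD[OF assms]
  obtain A D g2 g1 g0 where g: "g = ForkMap A D g2 g1 g0" "fork_map C A D g2 g1 g0"
    using D(1) by (rule Mor_ForkCE)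
  obtain B v2 v1 v0 where v: "v = ForkMap B D v2 v1 v0" "fork_map C B D v2 v1 v0"
    using D(2,5) g by (metis Mor_ForkCE Cod_ForkC)
  obtain R p2 p1 p0 where p: "p = ForkMap R A p2 p1 p0" "fork_map C R A p2 p1 p0"
    using D(3,6) g by (metis Mor_ForkCE Cod_ForkC Dom_ForkC)
  obtain q2 q1 q0 where q: "q = ForkMap R B q2 q1 q0" "fork_map C R B q2 q1 q0"
    using D(4,7,8) v p by (metis Mor_ForkCE Cod_ForkC Dom_ForkC)
  obtain R' p2' p1' p0' q2' q1' q0' where p': "fork_map C R' A p2' p1' p0'"
    and q': "fork_map C R' B q2' q1' q0'"
    and pb: "is_pullback C g2 v2 p2' q2'" "is_pullback C g1 v1 p1' q1'" "is_pullback C g0 v0 p0' q0'"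
    and pb': "is_pullback (ForkC C) g v (ForkMap R' A p2' p1' p0') (ForkMap R' B q2' q1' q0')"
    using ex_pullback_ForkC[OF g(2) v(2)] g v by metis
  obtain i where i: "is_iso (ForkC C) i" "Dom (ForkC C) i = R" "Cod (ForkC C) i = R'"
    "ForkMap R' A p2' p1' p0' \<odot>\<^bsub>ForkC C\<^esub> i = p" "ForkMap R' B q2' q1' q0' \<odot>\<^bsub>ForkC C\<^esub> i = q"
    using Fork.pullback_iso[OF pb' assms] q by auto
  then obtain i2 i1 i0 where i': "i = ForkMap R R' i2 i1 i0"
    unfolding is_iso_def by (metis Mor_ForkCE Dom_ForkC Cod_ForkC)
  have iso: "is_iso C i2" "is_iso C i1" "is_iso C i0" and "fork_map C R R' i2 i1 i0" using i(1)
    unfolding i' iso_ForkC_iff by auto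
  then have Cod: "Cod C i2 = Dom C q2'" "Cod C i1 = Dom C q1'" "Cod C i0 = Dom C q0'"
    using fork_mapD(7-) q' by metis+
  have "p2 = p2' \<odot> i2" "p1 = p1' \<odot> i1" "p0 = p0' \<odot> i0" "q2 = q2' \<odot> i2" "q1 = q1' \<odot> i1" "q0 = q0' \<odot> i0"
    using i(4,5) p(1) q(1) unfolding i' by auto
  then have "is_pullback C g2 v2 p2 q2" "is_pullback C g1 v1 p1 q1" "is_pullback C g0 v0 p0 q0"
    using pullback_Cmp_iso[OF pb(1) iso(1) Cod(1)] pullback_Cmp_iso[OF pb(2) iso(2) Cod(2)]
      pullback_Cmp_iso[OF pb(3) iso(3) Cod(3)] by simp_all
  with g v p q show ?thesis by (intro that)
qed

end

sublocale cell_pullbacks \<subseteq> Fork: pullback_category "ForkC C"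
  by (rule pullback_category_ForkC)

subsection \<open>Kernel pair forks\<close>

context cell_pullbacks
begin

text \<open>The choice of \<open>d\<close> and \<open>c\<close> is justified by the existence of
  pullbacks, that of \<open>e\<close> by the unique lift of two identities to the kernel
  pair.\<close>

lemma EqFork_ob:
  assumes "f \<in> Mor C"
  shows "fork_f (EqFork_ob C f) = f" "kernel_fork C (EqFork_ob C f)"
proof -
  obtain d c where dc: "(SOME (d, c). is_kernel_pair C f d c) = (d, c)" by fastforce
  have "\<exists>x. (case x of (d, c) \<Rightarrow> is_kernel_pair C f d c)" using ex_pullback[of f f] assms by auto
  from someI_ex[OF this] have k: "is_kernel_pair C f d c" unfolding dc by simp
  note [simp] = pullbackD(1-4,6-8)[OF k]
  define Q where "Q = (\<lambda>e. e \<in> hom_set C (Dom C f) (Dom C d) \<and> d \<odot> e = Idt C (Dom C f) \<and> c \<odot> e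
    = Idt C (Dom C f))"
  define e where "e = (THE e. Q e)"
  have E: "EqFork_ob C f = Fork d c e f" unfolding EqFork_ob_def dc e_def Q_def by simp
  obtain e' where e': "e' \<in> Mor C" "Dom C e' = Dom C f" "Cod C e' = Dom C c"
    "d \<odot> e' = Idt C (Dom C f)" "c \<odot> e' = Idt C (Dom C f)"
    by (rule pullback_lift[OF k, of "Idt C (Dom C f)" "Idt C (Dom C f)"]) simp_all
  have "Q e"
    unfolding e_def
  proof (rule theI[of Q])
    show "Q e'" unfolding Q_def using e' by simp
    fix x assume "Q x"
    then show "x = e'" using e' unfolding Q_def by (intro pullback_unique[OF k, of x e']) simp_all
  qed
  then have "is_fork C (Fork d c e f)"
    unfolding Q_def using pullbackD(9)[OF k] by (intro is_forkI) simp_all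
  then show "fork_f (EqFork_ob C f) = f" "kernel_fork C (EqFork_ob C f)"
    unfolding E kernel_fork_def using k by simp_all
qed

lemma fork_map_kernel_map:
  assumes "is_fork C F" "kernel_fork C G" "comm_square C (fork_f F) (fork_f G) u1 u0"
  shows "fork_map C F G (kernel_map C F G u1) u1 u0"
proof -
  obtain u2 where u2: "fork_map C F G u2 u1 u0" using ex_fork_map[OF assms] .
  have kG: "is_kernel_pair C (fork_f G) (fork_d G) (fork_c G)" using assms(2)
    unfolding kernel_fork_def by simp
  have "kernel_map C F G u1 = u2"
    unfolding kernel_map_def
  proof (rule the_equality)
    show "u2 \<in> hom_set C (fork_ob C 2 F) (fork_ob C 2 G) \<and> fork_d G \<odot> u2 = u1 \<odot> fork_d F
      \<and> fork_c G \<odot> u2 = u1 \<odot> fork_c F"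
      using fork_mapD[OF u2] by (simp add: comm_square_def)
    fix w assume "w \<in> hom_set C (fork_ob C 2 F) (fork_ob C 2 G) \<and> fork_d G \<odot> w = u1 \<odot> fork_d F
      \<and> fork_c G \<odot> w = u1 \<odot> fork_c F"
    then show "w = u2"
      using fork_mapD[OF u2] by (intro pullback_unique[OF kG, of w u2])
        (simp_all add: comm_square_def)
  qed
  with u2 show ?thesis by simp
qed

end

subsection \<open>Functors and adjunctions\<close>

lemma OMap_comp_functor [simp]: "OMap (G \<circ>\<^sub>F F) A = OMap G (OMap F A)"
  and MMap_comp_functor [simp]: "MMap (G \<circ>\<^sub>F F) f = MMap G (MMap F f)"
  by (simp_all add: comp_functor_def)

lemma OMap_id_functor [simp]: "OMap id_functor A = A"
  and MMap_id_functor [simp]: "MMap id_functor f = f"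
  by (simp_all add: id_functor_def)

context is_functor
begin

lemma MMap_Mor [simp]: "f \<in> Mor C \<Longrightarrow> MMap F f \<in> Mor D"
  and Dom_MMap [simp]: "f \<in> Mor C \<Longrightarrow> Dom D (MMap F f) = OMap F (Dom C f)"
  and Cod_MMap [simp]: "f \<in> Mor C \<Longrightarrow> Cod D (MMap F f) = OMap F (Cod C f)"
  using MMap_hom by auto

lemma MMap_iso:
  assumes "is_iso C f"
  shows "is_iso D (MMap F f)"
proof -
  obtain g where g: "f \<in> Mor C" "g \<in> Mor C" "Dom C g = Cod C f" "Cod C g = Dom C f"
    "g \<odot>\<^bsub>C\<^esub> f = Idt C (Dom C f)" "f \<odot>\<^bsub>C\<^esub> g = Idt C (Cod C f)" using assms by (rule dom.isoE)
  then show ?thesis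
    using MMap_Cmp[of f g] MMap_Cmp[of g f] MMap_Idt by (intro cod.isoI[of _ "MMap F g"]) simp_all
qed

lemma comm_square_MMap: "comm_square C f g u v \<Longrightarrow> comm_square D (MMap F f) (MMap F g) (MMap F u)
  (MMap F v)"
  unfolding comm_square_def using MMap_Cmp[of u g] MMap_Cmp[of f v] by auto

end

lemma is_functor_id: "category C \<Longrightarrow> is_functor C C id_functor"
  by (intro is_functor.intro is_functor_axioms.intro) (simp_all)

lemma is_functor_comp:
  assumes "is_functor C D F" "is_functor D E G"
  shows "is_functor C E (G \<circ>\<^sub>F F)"
proof -
  interpret F: is_functor C D F by fact
  interpret G: is_functor D E G by fact
  show ?thesis
    by unfold_locales (simp_all add: F.OMap_Obj G.OMap_Obj F.MMap_Idt G.MMap_Idt F.MMap_Cmp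
      G.MMap_Cmp)
qed

lemma adjunctionI:
  assumes F: "is_functor C D F" and G: "is_functor D C G"
    and "\<And>A. A \<in> Obj C \<Longrightarrow> \<eta> A \<in> hom_set C A (OMap G (OMap F A))"
    and "\<And>f. f \<in> Mor C \<Longrightarrow> MMap G (MMap F f) \<odot>\<^bsub>C\<^esub> \<eta> (Dom C f) = \<eta> (Cod C f) \<odot>\<^bsub>C\<^esub> f"
    and "\<And>B. B \<in> Obj D \<Longrightarrow> \<epsilon> B \<in> hom_set D (OMap F (OMap G B)) B"
    and "\<And>g. g \<in> Mor D \<Longrightarrow> g \<odot>\<^bsub>D\<^esub> \<epsilon> (Dom D g) = \<epsilon> (Cod D g) \<odot>\<^bsub>D\<^esub> MMap F (MMap G g)"
    and "\<And>A. A \<in> Obj C \<Longrightarrow> \<epsilon> (OMap F A) \<odot>\<^bsub>D\<^esub> MMap F (\<eta> A) = Idt D (OMap F A)"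
    and "\<And>B. B \<in> Obj D \<Longrightarrow> MMap G (\<epsilon> B) \<odot>\<^bsub>C\<^esub> \<eta> (OMap G B) = Idt C (OMap G B)"
  shows "adjunction C D F G \<eta> \<epsilon>"
proof -
  have cat: "category C" "category D" using F unfolding is_functor_def by auto
  show ?thesis
    by (intro adjunction.intro adjunction_axioms.intro is_nat_trans.intro is_nat_trans_axioms.intro
        is_functor_id is_functor_comp[OF F G] is_functor_comp[OF G F] F G cat)
      (use assms in simp_all)
qed

text \<open>Unit and counit have the shape of the recursive equations for \<open>unit_n\<close> and
  \<open>counit_n\<close>, so that \<open>adjunction_n\<close> results by rewriting.\<close>

lemma adjunction_comp:
  assumes "adjunction C D F G \<eta> \<epsilon>" "adjunction D E F' G' \<eta>' \<epsilon>'"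
  shows "adjunction C E (F' \<circ>\<^sub>F F) (G \<circ>\<^sub>F G') (\<lambda>A. MMap G (\<eta>' (OMap F A)) \<odot>\<^bsub>C\<^esub> \<eta> A)
    (\<lambda>B. \<epsilon>' B \<odot>\<^bsub>E\<^esub> MMap F' (\<epsilon> (OMap G' B)))"
proof -
  interpret a: adjunction C D F G \<eta> \<epsilon> by fact
  interpret b: adjunction D E F' G' \<eta>' \<epsilon>' by fact
  have [simp]: "\<eta> A \<in> Mor C" "Dom C (\<eta> A) = A" "Cod C (\<eta> A) = OMap G (OMap F A)" if "A \<in> Obj C" for A
    using a.unit.component[OF that] by simp_all
  have [simp]: "\<epsilon> A \<in> Mor D" "Dom D (\<epsilon> A) = OMap F (OMap G A)" "Cod D (\<epsilon> A) = A" if "A \<in> Obj D" for A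
    using a.counit.component[OF that] by simp_all
  have [simp]: "\<eta>' A \<in> Mor D" "Dom D (\<eta>' A) = A" "Cod D (\<eta>' A) = OMap G' (OMap F' A)" if "A \<in> Obj D"
    for A
    using b.unit.component[OF that] by simp_all
  have [simp]: "\<epsilon>' A \<in> Mor E" "Dom E (\<epsilon>' A) = OMap F' (OMap G' A)" "Cod E (\<epsilon>' A) = A" if "A \<in> Obj E"
    for A
    using b.counit.component[OF that] by simp_all
  note [simp] = a.left.OMap_Obj a.right.OMap_Obj b.left.OMap_Obj b.right.OMap_Obj
  show ?thesis
  proof (rule adjunctionI, goal_cases)
    case 1
    show ?case
      by (rule is_functor_comp[OF a.left.is_functor_axioms b.left.is_functor_axioms])
  next
    case 2
    show ?case
      by (rule is_functor_comp[OF b.right.is_functor_axioms a.right.is_functor_axioms])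
  next
    case (4 f)
    note [simp] = 4
    define A where "A = Dom C f"
    define B where "B = Cod C f"
    have [simp]: "Dom C f = A" "Cod C f = B" "A \<in> Obj C" "B \<in> Obj C" unfolding A_def B_def by simp_all
    have "MMap G (MMap G' (MMap F' (MMap F f))) \<odot>\<^bsub>C\<^esub> (MMap G (\<eta>' (OMap F A)) \<odot>\<^bsub>C\<^esub> \<eta> A)
      = MMap G (MMap G' (MMap F' (MMap F f)) \<odot>\<^bsub>D\<^esub> \<eta>' (OMap F A)) \<odot>\<^bsub>C\<^esub> \<eta> A"
      by (simp add: a.right.MMap_Cmp)
    also have "\<dots> = MMap G (\<eta>' (OMap F B) \<odot>\<^bsub>D\<^esub> MMap F f) \<odot>\<^bsub>C\<^esub> \<eta> A"
      using b.unit.naturality[of "MMap F f"] by simp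
    also have "\<dots> = MMap G (\<eta>' (OMap F B)) \<odot>\<^bsub>C\<^esub> (MMap G (MMap F f) \<odot>\<^bsub>C\<^esub> \<eta> A)"
      by (simp add: a.right.MMap_Cmp)
    also have "\<dots> = (MMap G (\<eta>' (OMap F B)) \<odot>\<^bsub>C\<^esub> \<eta> B) \<odot>\<^bsub>C\<^esub> f"
      using a.unit.naturality[of f] by simp
    finally show ?case by simp
  next
    case (6 g)
    note [simp] = 6
    define A where "A = Dom E g"
    define B where "B = Cod E g"
    have [simp]: "Dom E g = A" "Cod E g = B" "A \<in> Obj E" "B \<in> Obj E" unfolding A_def B_def by simp_all
    have "g \<odot>\<^bsub>E\<^esub> (\<epsilon>' A \<odot>\<^bsub>E\<^esub> MMap F' (\<epsilon> (OMap G' A))) = (g \<odot>\<^bsub>E\<^esub> \<epsilon>' A) \<odot>\<^bsub>E\<^esub> MMap F' (\<epsilon> (OMap G' A))"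
      by simp
    also have "\<dots> = (\<epsilon>' B \<odot>\<^bsub>E\<^esub> MMap F' (MMap G' g)) \<odot>\<^bsub>E\<^esub> MMap F' (\<epsilon> (OMap G' A))"
      using b.counit.naturality[of g] by simp
    also have "\<dots> = \<epsilon>' B \<odot>\<^bsub>E\<^esub> MMap F' (MMap G' g \<odot>\<^bsub>D\<^esub> \<epsilon> (OMap G' A))"
      by (simp add: b.left.MMap_Cmp)
    also have "\<dots> = \<epsilon>' B \<odot>\<^bsub>E\<^esub> MMap F' (\<epsilon> (OMap G' B) \<odot>\<^bsub>D\<^esub> MMap F (MMap G (MMap G' g)))"
      using a.counit.naturality[of "MMap G' g"] by simp
    also have "\<dots> = (\<epsilon>' B \<odot>\<^bsub>E\<^esub> MMap F' (\<epsilon> (OMap G' B))) \<odot>\<^bsub>E\<^esub> MMap F' (MMap F (MMap G (MMap G' g)))"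
      by (simp add: b.left.MMap_Cmp)
    finally show ?case by simp
  next
    case (7 A)
    note [simp] = 7
    define B where "B = OMap F A"
    have [simp]: "OMap F A = B" "B \<in> Obj D" unfolding B_def by simp_all
    have "(\<epsilon>' (OMap F' B) \<odot>\<^bsub>E\<^esub> MMap F' (\<epsilon> (OMap G' (OMap F' B)))) \<odot>\<^bsub>E\<^esub> MMap F'
      (MMap F (MMap G (\<eta>' B) \<odot>\<^bsub>C\<^esub> \<eta> A))
      = \<epsilon>' (OMap F' B) \<odot>\<^bsub>E\<^esub> MMap F' ((\<epsilon> (OMap G' (OMap F' B)) \<odot>\<^bsub>D\<^esub> MMap F (MMap G (\<eta>' B))) \<odot>\<^bsub>D\<^esub> MMap F
        (\<eta> A))"
      by (simp add: b.left.MMap_Cmp a.left.MMap_Cmp)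
    also have "\<dots> = \<epsilon>' (OMap F' B) \<odot>\<^bsub>E\<^esub> MMap F' ((\<eta>' B \<odot>\<^bsub>D\<^esub> \<epsilon> B) \<odot>\<^bsub>D\<^esub> MMap F (\<eta> A))"
      using a.counit.naturality[of "\<eta>' B"] by simp
    also have "\<dots> = Idt E (OMap F' B)"
      using a.triangle_left[of A] b.triangle_left[of B] by simp
    finally show ?case by simp
  next
    case (8 B)
    note [simp] = 8
    define A where "A = OMap G' B"
    have [simp]: "OMap G' B = A" "A \<in> Obj D" unfolding A_def by simp_all
    have "MMap G (MMap G' (\<epsilon>' B \<odot>\<^bsub>E\<^esub> MMap F' (\<epsilon> A))) \<odot>\<^bsub>C\<^esub>
      (MMap G (\<eta>' (OMap F (OMap G A))) \<odot>\<^bsub>C\<^esub> \<eta> (OMap G A))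
      = MMap G (MMap G' (\<epsilon>' B) \<odot>\<^bsub>D\<^esub> (MMap G' (MMap F' (\<epsilon> A)) \<odot>\<^bsub>D\<^esub> \<eta>' (OMap F (OMap G A)))) \<odot>\<^bsub>C\<^esub> \<eta>
        (OMap G A)"
      by (simp add: a.right.MMap_Cmp b.right.MMap_Cmp)
    also have "\<dots> = MMap G (MMap G' (\<epsilon>' B) \<odot>\<^bsub>D\<^esub> (\<eta>' A \<odot>\<^bsub>D\<^esub> \<epsilon> A)) \<odot>\<^bsub>C\<^esub> \<eta> (OMap G A)"
      using b.unit.naturality[of "\<epsilon> A"] by simp
    also have "\<dots> = MMap G ((MMap G' (\<epsilon>' B) \<odot>\<^bsub>D\<^esub> \<eta>' A) \<odot>\<^bsub>D\<^esub> \<epsilon> A) \<odot>\<^bsub>C\<^esub> \<eta> (OMap G A)"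
      by simp
    also have "\<dots> = Idt C (OMap G A)"
      using b.triangle_right[of B] a.triangle_right[of A] by simp
    finally show ?case by simp
  qed simp_all
qed

lemma adjunction_id:
  assumes "category C"
  shows "adjunction C C id_functor id_functor (Idt C) (Idt C)"
proof -
  interpret category C by fact
  show ?thesis by (rule adjunctionI) (simp_all add: is_functor_id assms)
qed

section \<open>Restriction to full subcategories\<close>

lemma full_sub_simps [simp]:
  "Obj (full_sub C P) = {A \<in> Obj C. P A}" "Mor (full_sub C P) = {f \<in> Mor C. P (Dom C f)
    \<and> P (Cod C f)}"
  "Dom (full_sub C P) = Dom C" "Cod (full_sub C P) = Cod C" "Idt (full_sub C P) = Idt C"
    "Cmp (full_sub C P) = Cmp C"
  by (simp_all add: full_sub_def)

lemma category_full_sub: "category C \<Longrightarrow> category (full_sub C P)"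
proof -
  assume "category C"
  then interpret category C .
  show ?thesis by unfold_locales simp_all
qed

lemma iso_full_sub: "is_iso C f \<Longrightarrow> P (Dom C f) \<Longrightarrow> P (Cod C f) \<Longrightarrow> is_iso (full_sub C P) f"
  unfolding is_iso_def by auto

lemma is_functor_full_sub:
  assumes "is_functor C D F" "\<And>A. \<lbrakk>A \<in> Obj C; P A\<rbrakk> \<Longrightarrow> Q (OMap F A)"
  shows "is_functor (full_sub C P) (full_sub D Q) F"
proof -
  interpret is_functor C D F by fact
  show ?thesis
    by (intro is_functor.intro is_functor_axioms.intro category_full_sub dom.category_axioms
      cod.category_axioms)
      (simp_all add: assms OMap_Obj MMap_Idt MMap_Cmp)
qed

text \<open>By fullness the inverses of unit and counit components stay inside, as both of their
  ends satisfy the predicate.\<close>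

lemma adjoint_equivalence_full_sub:
  assumes "adjunction C D F G \<eta> \<epsilon>"
    and P: "\<And>A. \<lbrakk>A \<in> Obj C; P A\<rbrakk> \<Longrightarrow> Q (OMap F A)" "\<And>A. \<lbrakk>A \<in> Obj C; P A\<rbrakk> \<Longrightarrow> is_iso C (\<eta> A)"
    and Q: "\<And>B. \<lbrakk>B \<in> Obj D; Q B\<rbrakk> \<Longrightarrow> P (OMap G B)" "\<And>B. \<lbrakk>B \<in> Obj D; Q B\<rbrakk> \<Longrightarrow> is_iso D (\<epsilon> B)"
  shows "adjoint_equivalence (full_sub C P) (full_sub D Q) F G \<eta> \<epsilon>"
proof -
  interpret adjunction C D F G \<eta> \<epsilon> by fact
  have u: "\<eta> A \<in> Mor C" "Dom C (\<eta> A) = A" "Cod C (\<eta> A) = OMap G (OMap F A)" if "A \<in> Obj C" for A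
    using unit.component[OF that] by simp_all
  have c: "\<epsilon> A \<in> Mor D" "Dom D (\<epsilon> A) = OMap F (OMap G A)" "Cod D (\<epsilon> A) = A" if "A \<in> Obj D" for A
    using counit.component[OF that] by simp_all
  note obj = left.OMap_Obj right.OMap_Obj
  show ?thesis
  proof (intro adjoint_equivalence.intro adjoint_equivalence_axioms.intro adjunctionI)
    show "is_functor (full_sub C P) (full_sub D Q) F"
      by (rule is_functor_full_sub[OF left.is_functor_axioms]) (rule P(1))
    show "is_functor (full_sub D Q) (full_sub C P) G"
      by (rule is_functor_full_sub[OF right.is_functor_axioms]) (rule Q(1))
  next
    fix f assume "f \<in> Mor (full_sub C P)"
    then show "MMap G (MMap F f) \<odot>\<^bsub>full_sub C P\<^esub> \<eta> (Dom (full_sub C P) f)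
      = \<eta> (Cod (full_sub C P) f) \<odot>\<^bsub>full_sub C P\<^esub> f"
      using unit.naturality[of f] by simp
  next
    fix f assume "f \<in> Mor (full_sub D Q)"
    then show "f \<odot>\<^bsub>full_sub D Q\<^esub> \<epsilon> (Dom (full_sub D Q) f)
      = \<epsilon> (Cod (full_sub D Q) f) \<odot>\<^bsub>full_sub D Q\<^esub> MMap F (MMap G f)"
      using counit.naturality[of f] by simp
  next
    fix A assume "A \<in> Obj (full_sub C P)"
    then show "is_iso (full_sub C P) (\<eta> A)"
      using P Q(1) by (intro iso_full_sub) (simp_all add: u obj)
  next
    fix A assume "A \<in> Obj (full_sub D Q)"
    then show "is_iso (full_sub D Q) (\<epsilon> A)"
      using Q P(1) by (intro iso_full_sub) (simp_all add: c obj)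
  qed (use P(1) Q(1) in \<open>simp_all add: u c obj triangle_left triangle_right\<close>)
qed

subsection \<open>The adjunctions between arrows and forks\<close>

lemma OMap_Arr_functor [simp]: "OMap (Arr_functor F) f = MMap F f"
  and MMap_Arr_functor [simp]:
    "MMap (Arr_functor F) (Square f g u v) = Square (MMap F f) (MMap F g) (MMap F u) (MMap F v)"
  by (simp_all add: Arr_functor_def)

lemma is_functor_Arr:
  assumes "is_functor C D F"
  shows "is_functor (Arr C) (Arr D) (Arr_functor F)"
proof -
  interpret is_functor C D F by fact
  interpret C: cell_category C ..
  interpret D: cell_category D ..
  show ?thesis
  proof (intro is_functor.intro is_functor_axioms.intro C.category_Arr D.category_Arr)
    fix f assume "f \<in> Mor (Arr C)"
    then show "MMap (Arr_functor F) f \<in> hom_set (Arr D) (OMap (Arr_functor F) (Dom (Arr C) f))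
      (OMap (Arr_functor F) (Cod (Arr C) f))"
      by (elim C.Mor_ArrE) (simp add: comm_square_MMap)
  next
    fix f g assume "f \<in> Mor (Arr C)" "g \<in> Mor (Arr C)" "Dom (Arr C) g = Cod (Arr C) f"
    then show "MMap (Arr_functor F) (g \<odot>\<^bsub>Arr C\<^esub> f)
      = MMap (Arr_functor F) g \<odot>\<^bsub>Arr D\<^esub> MMap (Arr_functor F) f"
      by (elim C.Mor_ArrE) (simp add: MMap_Cmp comm_squareD)
  qed (simp_all add: MMap_Idt)
qed

text \<open>Everything holds componentwise; that a component of the new unit or counit is a
  commutative square is naturality of the old one.\<close>

lemma adjunction_Arr:
  assumes "adjunction C D F G \<eta> \<epsilon>"
  shows "adjunction (Arr C) (Arr D) (Arr_functor F) (Arr_functor G)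
    (Arr_nat_trans C id_functor (G \<circ>\<^sub>F F) \<eta>) (Arr_nat_trans D (F \<circ>\<^sub>F G) id_functor \<epsilon>)"
proof -
  interpret adjunction C D F G \<eta> \<epsilon> by fact
  interpret C: cell_category C ..
  interpret D: cell_category D ..
  have [simp]: "\<eta> A \<in> Mor C" "Dom C (\<eta> A) = A" "Cod C (\<eta> A) = OMap G (OMap F A)" if "A \<in> Obj C" for A
    using unit.component[OF that] by simp_all
  have [simp]: "\<epsilon> A \<in> Mor D" "Dom D (\<epsilon> A) = OMap F (OMap G A)" "Cod D (\<epsilon> A) = A" if "A \<in> Obj D" for A
    using counit.component[OF that] by simp_all
  note [simp] = left.OMap_Obj right.OMap_Obj
  have nat: "MMap G (MMap F f) \<odot>\<^bsub>C\<^esub> \<eta> A = \<eta> B \<odot>\<^bsub>C\<^esub> f" if "f \<in> Mor C" "Dom C f = A" "Cod C f = B" for f A B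
    using unit.naturality[OF that(1)] that by simp
  have nat': "g \<odot>\<^bsub>D\<^esub> \<epsilon> A = \<epsilon> B \<odot>\<^bsub>D\<^esub> MMap F (MMap G g)" if "g \<in> Mor D" "Dom D g = A" "Cod D g = B"
    for g A B
    using counit.naturality[OF that(1)] that by simp
  show ?thesis
  proof (rule adjunctionI)
    show "is_functor (Arr C) (Arr D) (Arr_functor F)" "is_functor (Arr D) (Arr C) (Arr_functor G)"
      by (rule is_functor_Arr[OF left.is_functor_axioms], rule
        is_functor_Arr[OF right.is_functor_axioms])
  next
    fix A assume "A \<in> Obj (Arr C)"
    then show "Arr_nat_trans C id_functor (G \<circ>\<^sub>F F) \<eta> A \<in> hom_set (Arr C) A
      (OMap (Arr_functor G) (OMap (Arr_functor F) A))"
      by (simp add: Arr_nat_trans_def comm_square_def nat)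
  next
    fix f assume "f \<in> Mor (Arr C)"
    then show "MMap (Arr_functor G) (MMap (Arr_functor F) f) \<odot>\<^bsub>Arr C\<^esub> Arr_nat_trans C id_functor
      (G \<circ>\<^sub>F F) \<eta> (Dom (Arr C) f) =
         Arr_nat_trans C id_functor (G \<circ>\<^sub>F F) \<eta> (Cod (Arr C) f) \<odot>\<^bsub>Arr C\<^esub> f"
      by (elim C.Mor_ArrE) (simp add: Arr_nat_trans_def comm_squareD nat)
  next
    fix A assume "A \<in> Obj (Arr D)"
    then show "Arr_nat_trans D (F \<circ>\<^sub>F G) id_functor \<epsilon> A \<in> hom_set (Arr D)
      (OMap (Arr_functor F) (OMap (Arr_functor G) A)) A"
      by (simp add: Arr_nat_trans_def comm_square_def nat')
  next
    fix f assume "f \<in> Mor (Arr D)"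
    then show "f \<odot>\<^bsub>Arr D\<^esub> Arr_nat_trans D (F \<circ>\<^sub>F G) id_functor \<epsilon> (Dom (Arr D) f) =
         Arr_nat_trans D (F \<circ>\<^sub>F G) id_functor \<epsilon> (Cod (Arr D) f) \<odot>\<^bsub>Arr D\<^esub> MMap (Arr_functor F)
           (MMap (Arr_functor G) f)"
      by (elim D.Mor_ArrE) (simp add: Arr_nat_trans_def comm_squareD nat')
  next
    fix A assume "A \<in> Obj (Arr C)"
    then show "Arr_nat_trans D (F \<circ>\<^sub>F G) id_functor \<epsilon> (OMap (Arr_functor F) A) \<odot>\<^bsub>Arr D\<^esub>
        MMap (Arr_functor F) (Arr_nat_trans C id_functor (G \<circ>\<^sub>F F) \<eta> A) = Idt (Arr D)
          (OMap (Arr_functor F) A)"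
      by (simp add: Arr_nat_trans_def triangle_left)
  next
    fix A assume "A \<in> Obj (Arr D)"
    then show "MMap (Arr_functor G) (Arr_nat_trans D (F \<circ>\<^sub>F G) id_functor \<epsilon> A) \<odot>\<^bsub>Arr C\<^esub>
        Arr_nat_trans C id_functor (G \<circ>\<^sub>F F) \<eta> (OMap (Arr_functor G) A) = Idt (Arr C)
          (OMap (Arr_functor G) A)"
      by (simp add: Arr_nat_trans_def triangle_right)
  qed
qed

lemma OMap_arr [simp]: "OMap arr F = fork_f F"
  and MMap_arr [simp]: "MMap arr (ForkMap F G u2 u1 u0) = Square (fork_f F) (fork_f G) u1 u0"
  by (simp_all add: arr_def)

lemma OMap_EqFork [simp]: "OMap (EqFork C) = EqFork_ob C"
  and MMap_EqFork [simp]: "MMap (EqFork C) (Square f g u v) =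
    ForkMap (EqFork_ob C f) (EqFork_ob C g) (kernel_map C (EqFork_ob C f) (EqFork_ob C g) u) u v"
  by (simp_all add: EqFork_def)

context cell_category
begin

lemma is_functor_arr: "is_functor (ForkC C) (Arr C) arr"
proof (intro is_functor.intro is_functor_axioms.intro category_ForkC category_Arr)
  fix F assume "F \<in> Obj (ForkC C)"
  then show "OMap arr F \<in> Obj (Arr C)" by (simp add: forkD)
next
  fix x assume "x \<in> Mor (ForkC C)"
  then show "MMap arr x \<in> hom_set (Arr C) (OMap arr (Dom (ForkC C) x)) (OMap arr (Cod (ForkC C) x))"
    by (elim Mor_ForkCE) (simp add: fork_mapD)
next
  fix x y assume "x \<in> Mor (ForkC C)" "y \<in> Mor (ForkC C)" "Dom (ForkC C) y = Cod (ForkC C) x"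
  then show "MMap arr (y \<odot>\<^bsub>ForkC C\<^esub> x) = MMap arr y \<odot>\<^bsub>Arr C\<^esub> MMap arr x"
    by (elim Mor_ForkCE) simp
qed simp

text \<open>The component that \<open>arr\<close> forgets is determined by
  \<open>fork_map_unique\<close>. Hence functoriality of \<open>EqFork\<close>, naturality of the
  unit and a triangle identity can be tested after \<open>arr\<close>, without computing with
  \<open>kernel_map\<close>.\<close>

lemma arr_faithful:
  assumes "x \<in> Mor (ForkC C)" "y \<in> Mor (ForkC C)" "Dom (ForkC C) x = Dom (ForkC C) y"
    "Cod (ForkC C) x = Cod (ForkC C) y"
    "kernel_fork C (Cod (ForkC C) x)" "MMap arr x = MMap arr y"
  shows "x = y"
  using assms by (elim Mor_ForkCE) (auto intro: fork_map_unique)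

end

context cell_pullbacks
begin

lemma is_functor_EqFork: "is_functor (Arr C) (ForkC C) (EqFork C)"
proof -
  have hom: "MMap (EqFork C) x \<in> Mor (ForkC C)"
    "Dom (ForkC C) (MMap (EqFork C) x) = EqFork_ob C (Dom (Arr C) x)"
      "Cod (ForkC C) (MMap (EqFork C) x) = EqFork_ob C (Cod (Arr C) x)"
        "MMap arr (MMap (EqFork C) x) = x"
    if xM: "x \<in> Mor (Arr C)" for x
  proof -
    obtain f g u v where x: "x = Square f g u v" and sq: "comm_square C f g u v" using xM
      by (rule Mor_ArrE)
    have "is_fork C (EqFork_ob C f)" using EqFork_ob(2) comm_squareD(1)[OF sq]
      unfolding kernel_fork_def by simp
    then show "MMap (EqFork C) x \<in> Mor (ForkC C)"
      "Dom (ForkC C) (MMap (EqFork C) x) = EqFork_ob C (Dom (Arr C) x)"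
      "Cod (ForkC C) (MMap (EqFork C) x) = EqFork_ob C (Cod (Arr C) x)"
        "MMap arr (MMap (EqFork C) x) = x"
      using fork_map_kernel_map EqFork_ob comm_squareD[OF sq] sq unfolding x by simp_all
  qed
  interpret arr: is_functor "ForkC C" "Arr C" arr by (rule is_functor_arr)
  have fork: "is_fork C (EqFork_ob C f)" if "f \<in> Mor C" for f using EqFork_ob(2)[OF that]
    unfolding kernel_fork_def by simp
  show ?thesis
  proof (intro is_functor.intro is_functor_axioms.intro category_ForkC category_Arr)
    fix f assume f: "f \<in> Obj (Arr C)"
    then show "OMap (EqFork C) f \<in> Obj (ForkC C)" by (simp add: fork)
    show "MMap (EqFork C) (Idt (Arr C) f) = Idt (ForkC C) (OMap (EqFork C) f)"
    proof (rule arr_faithful)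
      show "MMap arr (MMap (EqFork C) (Idt (Arr C) f)) = MMap arr (Idt (ForkC C) (OMap (EqFork C) f))"
        using f by (subst hom(4)) (simp_all add: comm_square_Idt EqFork_ob)
    qed (use f hom[of "Idt (Arr C) f"] fork_map_Idt[OF fork[of f]] in
      \<open>simp_all add: comm_square_Idt EqFork_ob del: MMap_EqFork\<close>)
  next
    fix x assume "x \<in> Mor (Arr C)"
    then show "MMap (EqFork C) x \<in> hom_set (ForkC C) (OMap (EqFork C) (Dom (Arr C) x))
      (OMap (EqFork C) (Cod (Arr C) x))"
      using hom by simp
  next
    fix x y assume xy [simp]: "x \<in> Mor (Arr C)" "y \<in> Mor (Arr C)" "Dom (Arr C) y = Cod (Arr C) x"
    have yx [simp]: "y \<odot>\<^bsub>Arr C\<^esub> x \<in> Mor (Arr C)" by simp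
    have "Cod (Arr C) y \<in> Mor C" using Arr.Cod_Obj[OF xy(2)] by simp
    note hx [simp] = hom[OF xy(1)] hom[OF xy(2)] hom[OF yx]
    show "MMap (EqFork C) (y \<odot>\<^bsub>Arr C\<^esub> x) = MMap (EqFork C) y \<odot>\<^bsub>ForkC C\<^esub> MMap (EqFork C) x"
      by (rule arr_faithful) (simp_all add: EqFork_ob \<open>Cod (Arr C) y \<in> Mor C\<close> arr.MMap_Cmp)
  qed
qed

lemma arr_EqFork:
  assumes "x \<in> Mor (Arr C)"
  shows "MMap arr (MMap (EqFork C) x) = x"
  using assms by (elim Mor_ArrE) (simp add: EqFork_ob comm_squareD)

lemma arr_unit_fork_map:
  assumes F: "is_fork C F"
  shows "arr_unit C F = ForkMap F (EqFork_ob C (fork_f F))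
    (kernel_map C F (EqFork_ob C (fork_f F)) (Idt C (Dom C (fork_f F))))
      (Idt C (Dom C (fork_f F))) (Idt C (Cod C (fork_f F)))"
    and "fork_map C F (EqFork_ob C (fork_f F))
      (kernel_map C F (EqFork_ob C (fork_f F)) (Idt C (Dom C (fork_f F))))
      (Idt C (Dom C (fork_f F))) (Idt C (Cod C (fork_f F)))"
  using forkD(4)[OF F] fork_map_kernel_map[OF F] EqFork_ob[of "fork_f F"]
    comm_square_Idt[of "fork_f F"]
  by (simp_all add: arr_unit_def Let_def)

lemma adjunction_arr_EqFork: "adjunction (ForkC C) (Arr C) arr (EqFork C) (arr_unit C) (arr_counit C)"
proof -
  interpret arr: is_functor "ForkC C" "Arr C" arr by (rule is_functor_arr)
  interpret EqFork: is_functor "Arr C" "ForkC C" "EqFork C" by (rule is_functor_EqFork)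
  have unit: "arr_unit C F \<in> Mor (ForkC C)" "Dom (ForkC C) (arr_unit C F) = F"
    "Cod (ForkC C) (arr_unit C F) = EqFork_ob C (fork_f F)"
    "MMap arr (arr_unit C F) = Idt (Arr C) (fork_f F)" "kernel_fork C (EqFork_ob C (fork_f F))"
      if "is_fork C F" for F
    using arr_unit_fork_map[OF that] EqFork_ob[OF forkD(4)[OF that]] by simp_all
  show ?thesis
  proof (rule adjunctionI[OF is_functor_arr is_functor_EqFork])
    fix F assume "F \<in> Obj (ForkC C)"
    then show "arr_unit C F \<in> hom_set (ForkC C) F (OMap (EqFork C) (OMap arr F))" using unit[of F]
      by simp
  next
    fix x assume x [simp]: "x \<in> Mor (ForkC C)"
    have D [simp]: "is_fork C (Dom (ForkC C) x)" "is_fork C (Cod (ForkC C) x)"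
      using Fork.Dom_Obj[OF x] Fork.Cod_Obj[OF x] by simp_all
    note [simp] = unit[OF D(1)] unit[OF D(2)]
    have [simp]: "MMap arr x \<in> Mor (Arr C)" "Dom (Arr C) (MMap arr x) = fork_f (Dom (ForkC C) x)"
      "Cod (Arr C) (MMap arr x) = fork_f (Cod (ForkC C) x)" by simp_all
    have ff: "fork_f (Dom (ForkC C) x) \<in> Obj (Arr C)" "fork_f (Cod (ForkC C) x) \<in> Obj (Arr C)"
      using D by (simp_all add: forkD)
    show "MMap (EqFork C) (MMap arr x) \<odot>\<^bsub>ForkC C\<^esub> arr_unit C (Dom (ForkC C) x)
      = arr_unit C (Cod (ForkC C) x) \<odot>\<^bsub>ForkC C\<^esub> x"
      by (rule arr_faithful) (use ff in \<open>simp_all add: arr.MMap_Cmp arr_EqFork del: Idt_Arr Obj_Arr\<close>)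
  next
    fix f assume "f \<in> Obj (Arr C)"
    then show "arr_counit C f \<in> hom_set (Arr C) (OMap arr (OMap (EqFork C) f)) f"
      by (simp add: arr_counit_def EqFork_ob comm_square_Idt)
  next
    fix x assume x: "x \<in> Mor (Arr C)"
    then have "x \<odot>\<^bsub>Arr C\<^esub> Idt (Arr C) (Dom (Arr C) x) = Idt (Arr C) (Cod (Arr C) x) \<odot>\<^bsub>Arr C\<^esub> x"
      by (simp del: Idt_Arr)
    then show "x \<odot>\<^bsub>Arr C\<^esub> arr_counit C (Dom (Arr C) x)
      = arr_counit C (Cod (Arr C) x) \<odot>\<^bsub>Arr C\<^esub> MMap arr (MMap (EqFork C) x)"
      unfolding arr_EqFork[OF x] arr_counit_def .
  next
    fix F assume "F \<in> Obj (ForkC C)"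
    then have F: "is_fork C F" and ff: "fork_f F \<in> Obj (Arr C)" by (simp_all add: forkD)
    show "arr_counit C (OMap arr F) \<odot>\<^bsub>Arr C\<^esub> MMap arr (arr_unit C F) = Idt (Arr C) (OMap arr F)"
      using ff by (simp add: unit[OF F] arr_counit_def del: Idt_Arr Obj_Arr)
  next
    fix f assume f: "f \<in> Obj (Arr C)"
    then have [simp]: "fork_f (EqFork_ob C f) = f" "is_fork C (EqFork_ob C f)"
      using EqFork_ob[of f] unfolding kernel_fork_def by simp_all
    have u: "arr_unit C (EqFork_ob C f) \<in> Mor (ForkC C)" "Dom (ForkC C) (arr_unit C (EqFork_ob C f))
      = EqFork_ob C f"
      "Cod (ForkC C) (arr_unit C (EqFork_ob C f)) = EqFork_ob C f"
      "MMap arr (arr_unit C (EqFork_ob C f)) = Idt (Arr C) f" "kernel_fork C (EqFork_ob C f)"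
      using unit[of "EqFork_ob C f"] by simp_all
    have "MMap (EqFork C) (arr_counit C f) = Idt (ForkC C) (EqFork_ob C f)"
      unfolding arr_counit_def using EqFork.MMap_Idt[OF f] by simp
    then have "MMap (EqFork C) (arr_counit C f) \<odot>\<^bsub>ForkC C\<^esub> arr_unit C (EqFork_ob C f)
      = arr_unit C (EqFork_ob C f)"
      using u by (simp del: Idt_ForkC)
    moreover have "arr_unit C (EqFork_ob C f) = Idt (ForkC C) (EqFork_ob C f)"
      by (rule arr_faithful) (use u f fork_map_Idt[of "EqFork_ob C f"] in simp_all)
    ultimately show "MMap (EqFork C) (arr_counit C f) \<odot>\<^bsub>ForkC C\<^esub> arr_unit C (OMap (EqFork C) f)
      = Idt (ForkC C) (OMap (EqFork C) f)"
      by simp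
  qed
qed

end

lemma cell_pullbacks_Fork_n:
  assumes "cell_pullbacks (base X)"
  shows "cell_pullbacks (Fork_n n X)"
proof (induction n)
  case (Suc n)
  then interpret cell_pullbacks "Fork_n n X" .
  show ?case by (simp add: cell_pullbacks_def pullback_category_ForkC)
qed (simp add: assms)

lemma cell_pullbacks_Arr_n:
  assumes "cell_pullbacks (base X)"
  shows "cell_pullbacks (Arr_n n X)"
proof (induction n)
  case (Suc n)
  then interpret cell_pullbacks "Arr_n n X" .
  show ?case by (simp add: cell_pullbacks_def pullback_category_Arr)
qed (simp add: assms)

theorem adjunction_n:
  assumes "cell_pullbacks (base X)"
  shows "adjunction (Fork_n n X) (Arr_n n X) (arr_n n) (EqFork_n n X) (unit_n n X) (counit_n n X)"
proof (induction n)
  case 0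
  interpret cell_pullbacks "base X" by fact
  show ?case using adjunction_id[OF category_axioms] by simp
next
  case (Suc n)
  interpret cell_pullbacks "Fork_n n X" by (rule cell_pullbacks_Fork_n[OF assms])
  show ?case using adjunction_comp[OF adjunction_arr_EqFork adjunction_Arr[OF Suc]] by simp
qed

subsection \<open>Exact forks\<close>

lemma pair_mapI: "\<lbrakk>comm_square C k u d d'; comm_square C k u c c'\<rbrakk> \<Longrightarrow> pair_map C u d c d' c' k"
  unfolding comm_square_def pair_map_def by simp

lemma is_fork_image:
  assumes "is_functor C D F" "is_fork C (Fork d c e f)"
  shows "is_fork D (Fork (MMap F d) (MMap F c) (MMap F e) (MMap F f))"
proof -
  interpret is_functor C D F by fact
  note D = forkD[OF assms(2), simplified]
  show ?thesis
    using D MMap_Cmp[of d f] MMap_Cmp[of c f] MMap_Cmp[of e d] MMap_Cmp[of e c] MMap_Idt[of "Dom C f"]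
    by (intro is_forkI) simp_all
qed

context cell_category
begin

text \<open>On kernel pair forks \<open>arr\<close> is full and faithful: the inverse of the
  underlying map of arrows lifts by \<open>ex_fork_map\<close>, and the lift is an inverse by
  \<open>arr_faithful\<close>.\<close>

lemma kernel_fork_iso:
  assumes F: "kernel_fork C F" and G: "kernel_fork C G" and u: "fork_map C F G u2 u1 u0"
    and iso: "is_iso C u1" "is_iso C u0"
  shows "is_iso (ForkC C) (ForkMap F G u2 u1 u0)"
proof -
  have fF: "is_fork C F" and fG: "is_fork C G" using F G unfolding kernel_fork_def by auto
  note D = fork_mapD(7-)[OF u]
  obtain v1 where v1: "v1 \<in> Mor C" "Dom C v1 = Cod C u1" "Cod C v1 = Dom C u1"
    "v1 \<odot> u1 = Idt C (Dom C u1)" "u1 \<odot> v1 = Idt C (Cod C u1)" using iso(1) by (rule isoE)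
  obtain v0 where v0: "v0 \<in> Mor C" "Dom C v0 = Cod C u0" "Cod C v0 = Dom C u0"
    "v0 \<odot> u0 = Idt C (Dom C u0)" "u0 \<odot> v0 = Idt C (Cod C u0)" using iso(2) by (rule isoE)
  have "comm_square C (fork_f G) (fork_f F) v1 v0"
    by (rule comm_square_inverse[OF fork_mapD(6)[OF u] v1(1-3,5) v0(1-4)])
  then obtain v2 where v: "fork_map C G F v2 v1 v0" using ex_fork_map[OF fG F] by blast
  let ?x = "ForkMap F G u2 u1 u0" and ?y = "ForkMap G F v2 v1 v0"
  have x: "?x \<in> Mor (ForkC C)" and y: "?y \<in> Mor (ForkC C)" using u v by simp_all
  have "?y \<odot>\<^bsub>ForkC C\<^esub> ?x = Idt (ForkC C) F"
    by (rule arr_faithful)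
      (use F u v D v1 v0 fork_map_Cmp[OF u v] fork_map_Idt[OF fF] in simp_all)
  moreover have "?x \<odot>\<^bsub>ForkC C\<^esub> ?y = Idt (ForkC C) G"
    by (rule arr_faithful)
      (use G u v D v1 v0 fork_map_Cmp[OF v u] fork_map_Idt[OF fG] in simp_all)
  ultimately show ?thesis using x y by (intro Fork.isoI[of ?x ?y]) simp_all
qed

end

context cell_pullbacks
begin

text \<open>Compare \<open>G\<close> with the kernel pair fork \<open>H\<close> of its own arrow. By
  \<open>kernel_fork_iso\<close> the composite of \<open>i2\<close> with the comparison
  \<open>m\<close> is invertible, hence so is \<open>m\<close>, and it transports the kernel pair of
  \<open>H\<close> to the pair in \<open>G\<close>.\<close>

lemma kernel_fork_iso_codomain:
  assumes F: "kernel_fork C F" and i: "is_iso (ForkC C) (ForkMap F G i2 i1 i0)"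
  shows "kernel_fork C G"
proof -
  have iso: "is_iso C i2" "is_iso C i1" "is_iso C i0" and i: "fork_map C F G i2 i1 i0"
    using i unfolding iso_ForkC_iff by simp_all
  note D = fork_mapD(7-)[OF i] and G = fork_mapD(2)[OF i]
  define H where "H = EqFork_ob C (fork_f G)"
  have H: "kernel_fork C H" "fork_f H = fork_f G" unfolding H_def using EqFork_ob forkD(4)[OF G]
    by simp_all
  obtain m where m: "fork_map C G H m (Idt C (Dom C (fork_f G))) (Idt C (Cod C (fork_f G)))"
    using ex_fork_map[OF G H(1)] comm_square_Idt forkD(4)[OF G] H(2) by metis
  note M = fork_mapD(7-)[OF m]
  have "fork_map C F H (m \<odot> i2) i1 i0" using fork_map_Cmp[OF i m] D by simp
  then have mi: "is_iso C (m \<odot> i2)" using kernel_fork_iso[OF F H(1)] iso unfolding iso_ForkC_iff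
    by blast
  obtain j where j: "i2 \<in> Mor C" "j \<in> Mor C" "Dom C j = Cod C i2" "Cod C j = Dom C i2"
    "j \<odot> i2 = Idt C (Dom C i2)" "i2 \<odot> j = Idt C (Cod C i2)" using iso(1) by (rule isoE)
  have "is_iso C ((m \<odot> i2) \<odot> j)"
    by (rule iso_Cmp[OF isoI[of j i2] mi]) (use j D M in simp_all)
  then have "is_iso C m" using j D M by simp
  then have "is_kernel_pair C (fork_f H) (fork_d H \<odot> m) (fork_c H \<odot> m)"
    using H(1) M forkD(5)[OF fork_mapD(2)[OF m]] unfolding kernel_fork_def
      by (intro pullback_Cmp_iso) simp_all
  moreover have "fork_d H \<odot> m = fork_d G" "fork_c H \<odot> m = fork_c G"
    using comm_squareD(9)[OF fork_mapD(3)[OF m]] comm_squareD(9)[OF fork_mapD(4)[OF m]] forkD[OF G]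
      by simp_all
  ultimately show ?thesis unfolding kernel_fork_def using G H(2) by simp
qed

end

section \<open>Evaluation at vertices and extensions of exact forks\<close>

definition vertices :: "nat \<Rightarrow> nat list set" where
  "vertices n = {v. length v = n \<and> set v \<subseteq> {0, 1, 2}}"

lemma vertices_0 [simp]: "vertices 0 = {[]}"
  unfolding vertices_def by auto

lemma vertices_Suc: "v \<in> vertices (Suc n) \<longleftrightarrow> (\<exists>k w. v = k # w \<and> (k = 0 \<or> k = 1 \<or> k = 2)
  \<and> w \<in> vertices n)"
  unfolding vertices_def by (cases v) auto

lemma ball_vertices_Suc:
  "(\<forall>v \<in> vertices (Suc n). Q v) \<longleftrightarrow> (\<forall>v \<in> vertices n. Q (2 # v) \<and> Q (1 # v) \<and> Q (0 # v))"
  by (auto simp: Ball_def vertices_Suc)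

text \<open>\<open>eval_mor\<close> acts on morphisms only, so the value at an object is read off
  from its identity.\<close>

definition eval_functor :: "nat \<Rightarrow> ('o, 'm) precat \<Rightarrow> nat list \<Rightarrow> ('o, 'm) cell_functor" where
  "eval_functor n X v = \<lparr>OMap = (\<lambda>A. Dom (base X) (eval_mor v (Idt (Fork_n n X) A))), MMap
    = eval_mor v\<rparr>"

lemma MMap_eval_functor [simp]: "MMap (eval_functor n X v) = eval_mor v"
  by (simp add: eval_functor_def)

definition ext_obj :: "nat \<Rightarrow> ('o, 'm) precat \<Rightarrow> ('o, 'm) cell \<Rightarrow> bool" where
  "ext_obj n X A \<longleftrightarrow> n = 0 \<or> cubic_ext n X A"

text \<open>Only some kernel pair is required to be exact; by invariance under isomorphism this
  passes to all of them, see \<open>fork_ext_kernel_pair\<close>.\<close>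

definition fork_ext :: "nat \<Rightarrow> ('o, 'm) precat \<Rightarrow> ('o, 'm) cell \<Rightarrow> bool" where
  "fork_ext n X f \<longleftrightarrow> f \<in> Mor (Fork_n n X) \<and> exact_n_fork n X (Dom (Fork_n n X) f) \<and>
     exact_n_fork n X (Cod (Fork_n n X) f) \<and> (\<forall>v \<in> vertices n. regular_epi (base X) (eval_mor v f)) \<and>
     (\<exists>d c. is_kernel_pair (Fork_n n X) f d c \<and> exact_n_fork n X (Dom (Fork_n n X) d))"

context exact_maltsev_category
begin

interpretation base: cell_relative_maltsev "base C" "\<lambda>_. True" "regular_epi (base C)"
  by (rule relative_maltsev_base[OF exact_maltsev_category_axioms])

lemma Fork_n_pullbacks: "cell_pullbacks (Fork_n n C)"
  by (rule cell_pullbacks_Fork_n) unfold_locales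

lemma Arr_n_pullbacks: "cell_pullbacks (Arr_n n C)"
  by (rule cell_pullbacks_Arr_n) unfold_locales

lemma adjunction_Fork_n_Arr_n: "adjunction (Fork_n n C) (Arr_n n C) (arr_n n) (EqFork_n n C)
  (unit_n n C) (counit_n n C)"
  by (rule adjunction_n) unfold_locales

lemma is_functor_arr_n: "is_functor (Fork_n n C) (Arr_n n C) (arr_n n)"
  using adjunction_Fork_n_Arr_n by (rule adjunction.axioms)

lemma is_functor_EqFork_n: "is_functor (Arr_n n C) (Fork_n n C) (EqFork_n n C)"
  using adjunction_Fork_n_Arr_n by (rule adjunction.axioms)

text \<open>Being an object of the iterated arrow category is commutativity of the square, so the
  recursion is the passage from extensions to double extensions.\<close>

lemma cubic_ext_Suc_Suc: "cubic_ext (Suc (Suc n)) C = arr_ext (Arr_n n C) (cubic_ext (Suc n) C)"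
proof
  interpret cell_pullbacks "Arr_n n C" by (rule Arr_n_pullbacks)
  fix x
  have "Square f g u v \<in> Obj (Arr_n (Suc (Suc n)) C) \<longleftrightarrow> comm_square (Arr_n n C) f g u v" for f g u v
    by (simp add: Arr_def[of "Arr (Arr_n n C)"])
  then show "cubic_ext (Suc (Suc n)) C x = arr_ext (Arr_n n C) (cubic_ext (Suc n) C) x"
    unfolding cubic_ext.simps arr_ext_def double_ext_def comparison_def by blast
qed

lemma relative_maltsev_Arr_n: "cell_relative_maltsev (Arr_n n C) (ext_obj n C) (cubic_ext (Suc n) C)"
proof (induction n)
  case 0
  have "ext_obj 0 C = (\<lambda>_. True)" "cubic_ext (Suc 0) C = regular_epi (base C)" unfolding ext_obj_def
    by auto
  then show ?case by (simp add: base.cell_relative_maltsev_axioms)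
next
  case (Suc n)
  then interpret cell_relative_maltsev "Arr_n n C" "ext_obj n C" "cubic_ext (Suc n) C" .
  have "ext_obj (Suc n) C = cubic_ext (Suc n) C" unfolding ext_obj_def by auto
  then show ?case
    using relative_maltsev_Arr by (simp add: cell_relative_maltsev_def cubic_ext_Suc_Suc del:
      cubic_ext.simps)
qed

lemma is_functor_eval:
  assumes "v \<in> vertices n"
  shows "is_functor (Fork_n n C) (base C) (eval_functor n C v)"
  using assms
proof (induction n arbitrary: v)
  case 0
  then show ?case
    by (intro is_functor.intro is_functor_axioms.intro)
      (auto simp: eval_functor_def base.category_axioms)
next
  case (Suc n)
  then obtain k w where v: "v = k # w" "k = 0 \<or> k = 1 \<or> k = 2" "w \<in> vertices n"
    by (auto simp: vertices_Suc)
  let ?F = "Fork_n n C"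
  interpret F: cell_pullbacks "?F" by (rule Fork_n_pullbacks)
  interpret w: is_functor "?F" "base C" "eval_functor n C w" using Suc.IH v(3) .
  let ?G = "eval_functor (Suc n) C v" and ?S = "Fork_n (Suc n) C"
  have O: "OMap ?G A = OMap (eval_functor n C w) (fork_ob ?F k A)" for A
    using v(2) unfolding v(1) eval_functor_def by (auto simp: fork_ob_def)
  show ?case
  proof (intro is_functor.intro is_functor_axioms.intro)
    show "category ?S" by (simp add: F.category_ForkC)
    show "category (base C)" by unfold_locales
  next
    fix A assume "A \<in> Obj ?S"
    then have A: "is_fork ?F A" by simp
    have kA: "fork_ob ?F k A \<in> Obj ?F" using v(2) forkD[OF A] by auto
    then show "OMap ?G A \<in> Obj (base C)" unfolding O by (rule w.OMap_Obj)
    have "MMap ?G (Idt ?S A) = eval_mor w (Idt ?F (fork_ob ?F k A))"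
      using v(2) unfolding v(1) by (auto simp: fork_ob_def)
    then show "MMap ?G (Idt ?S A) = Idt (base C) (OMap ?G A)"
      using w.MMap_Idt[OF kA] unfolding O by simp
  next
    fix f assume "f \<in> Mor ?S"
    then obtain F G u2 u1 u0 where f: "f = ForkMap F G u2 u1 u0" and u: "fork_map ?F F G u2 u1 u0"
      by (metis F.Mor_ForkCE Fork_n.simps(2))
    show "MMap ?G f \<in> hom_set (base C) (OMap ?G (Dom ?S f))
        (OMap ?G (Cod ?S f))"
      unfolding O using v(2) fork_mapD(7-)[OF u] w.MMap_hom[of u2] w.MMap_hom[of u1]
        w.MMap_hom[of u0] by (auto simp: f v(1))
  next
    fix f g assume "f \<in> Mor ?S" "g \<in> Mor ?S" "Dom ?S g = Cod ?S f"
    then show "MMap ?G (g \<odot>\<^bsub>?S\<^esub> f) =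
        MMap ?G g \<odot>\<^bsub>base C\<^esub> MMap ?G f"
      using v(2) w.MMap_Cmp by (auto elim!: F.Mor_ForkCE simp: v(1) fork_mapD)
  qed
qed

lemma pullback_eval:
  assumes "is_pullback (Fork_n n C) f g p q" "v \<in> vertices n"
  shows "is_pullback (base C) (eval_mor v f) (eval_mor v g) (eval_mor v p) (eval_mor v q)"
  using assms
proof (induction n arbitrary: v f g p q)
  case (Suc n)
  interpret F: cell_pullbacks "Fork_n n C" by (rule Fork_n_pullbacks)
  from Suc.prems(1) show ?case
    using Suc.prems(2) Suc.IH by (auto elim!: F.pullback_ForkE simp: vertices_Suc)
qed simp

text \<open>Exactness is stated line by line in X; this assembles the kernel pairs found at all
  vertices into one kernel pair of n-forks.\<close>

lemma pullback_evalI: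
  assumes "f \<in> Mor (Fork_n n C)" "g \<in> Mor (Fork_n n C)" "p \<in> Mor (Fork_n n C)" "q \<in> Mor (Fork_n n C)"
    "Cod (Fork_n n C) f = Cod (Fork_n n C) g" "Cod (Fork_n n C) p = Dom (Fork_n n C) f"
    "Cod (Fork_n n C) q = Dom (Fork_n n C) g" "Dom (Fork_n n C) p = Dom (Fork_n n C) q"
    and "\<And>v. v \<in> vertices n \<Longrightarrow> is_pullback (base C) (eval_mor v f) (eval_mor v g) (eval_mor v p)
      (eval_mor v q)"
  shows "is_pullback (Fork_n n C) f g p q"
  using assms
proof (induction n arbitrary: f g p q)
  case (Suc n)
  let ?F = "Fork_n n C"
  interpret F: cell_pullbacks "?F" by (rule Fork_n_pullbacks)
  obtain A D g2 g1 g0 where f: "f = ForkMap A D g2 g1 g0" and f': "fork_map ?F A D g2 g1 g0"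
    using Suc.prems(1) by (metis F.Mor_ForkCE Fork_n.simps(2))
  obtain B v2 v1 v0 where g: "g = ForkMap B D v2 v1 v0" and g': "fork_map ?F B D v2 v1 v0"
    using Suc.prems(2,5) f F.Mor_ForkCE by (metis Fork_n.simps(2) F.Cod_ForkC)
  obtain R p2 p1 p0 where p: "p = ForkMap R A p2 p1 p0" and p': "fork_map ?F R A p2 p1 p0"
    using Suc.prems(3,6) f F.Mor_ForkCE by (metis Fork_n.simps(2) F.Cod_ForkC F.Dom_ForkC)
  obtain q2 q1 q0 where q: "q = ForkMap R B q2 q1 q0" and q': "fork_map ?F R B q2 q1 q0"
    using Suc.prems(4,7,8) g p F.Mor_ForkCE by (metis Fork_n.simps(2) F.Cod_ForkC F.Dom_ForkC)
  note D = fork_mapD(7-)[OF f'] fork_mapD(7-)[OF g'] fork_mapD(7-)[OF p'] fork_mapD(7-)[OF q']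
  have ev: "is_pullback (base C) (eval_mor v g2) (eval_mor v v2) (eval_mor v p2) (eval_mor v q2)"
    "is_pullback (base C) (eval_mor v g1) (eval_mor v v1) (eval_mor v p1) (eval_mor v q1)"
    "is_pullback (base C) (eval_mor v g0) (eval_mor v v0) (eval_mor v p0) (eval_mor v q0)"
      if "v \<in> vertices n" for v
    using that Suc.prems(9)[of "2 # v"] Suc.prems(9)[of "1 # v"] Suc.prems(9)[of "0 # v"]
    by (simp_all add: vertices_Suc f g p q)
  have "is_pullback ?F g2 v2 p2 q2" "is_pullback ?F g1 v1 p1 q1" "is_pullback ?F g0 v0 p0 q0"
    by (rule Suc.IH; simp add: D ev)+
  then show ?case unfolding f g p q using F.pullback_ForkI[OF f' g' p' q'] by simp
qed simp

text \<open>Pullbacks of forks and of arrows are componentwise and \<open>arr\<close> merely drops a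
  component. Kernel pairs of forks thus pass to n-fold arrows, where the relative Mal'tsev axiom is
  available.\<close>

lemma pullback_arr_n:
  assumes "is_pullback (Fork_n n C) f g p q"
  shows "is_pullback (Arr_n n C) (MMap (arr_n n) f) (MMap (arr_n n) g) (MMap (arr_n n) p)
    (MMap (arr_n n) q)"
  using assms
proof (induction n arbitrary: f g p q)
  case (Suc n)
  interpret F: cell_pullbacks "Fork_n n C" by (rule Fork_n_pullbacks)
  interpret A: cell_pullbacks "Arr_n n C" by (rule Arr_n_pullbacks)
  interpret arr: is_functor "Fork_n n C" "Arr_n n C" "arr_n n" by (rule is_functor_arr_n)
  from Suc.prems show ?case
    by (auto elim!: F.pullback_ForkE intro!: A.pullback_ArrI Suc.IH arr.comm_square_MMap dest:
      fork_mapD(6))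
qed simp

text \<open>The lines in the outermost direction are indexed by the vertices of n-forks; every other
  line lies inside one of the three n-forks F0, F1, F2.\<close>

lemma exact_n_fork_Suc:
  "exact_n_fork (Suc n) C F \<longleftrightarrow> is_fork (Fork_n n C) F \<and>
     (\<forall>k \<in> {0, 1, 2}. exact_n_fork n C (fork_ob (Fork_n n C) k F)) \<and>
     (\<forall>v \<in> vertices n. exact_fork (base C) (Fork (eval_mor v (fork_d F)) (eval_mor v (fork_c F))
       (eval_mor v (fork_e F)) (eval_mor v (fork_f F))))"
  (is "?l \<longleftrightarrow> ?f \<and> ?o \<and> ?v")
proof -
  interpret F: cell_pullbacks "Fork_n n C" by (rule Fork_n_pullbacks)
  have line0: "fork_line (Suc n) C 0 v F = Fork (eval_mor v (fork_d F)) (eval_mor v (fork_c F))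
    (eval_mor v (fork_e F)) (eval_mor v (fork_f F))"
    if "is_fork (Fork_n n C) F" for v
    using that unfolding is_fork_def by auto
  show ?thesis
  proof
    assume l: ?l
    then have f: ?f unfolding exact_n_fork_def by simp
    have *: "exact_fork (base C) (fork_line (Suc n) C i v F)"
      if "i < Suc n" "length v = n" "set v \<subseteq> {0, 1, 2}" for i v
      using l that unfolding exact_n_fork_def by simp
    have ?v using *[of 0] line0[OF f] unfolding vertices_def by simp
    moreover have "exact_n_fork n C (fork_ob (Fork_n n C) k F)" if "k \<in> {0, 1, 2}" for k
      unfolding exact_n_fork_def
    proof (intro conjI allI impI)
      show "fork_ob (Fork_n n C) k F \<in> Obj (Fork_n n C)" using that forkD[OF f] by auto
      \<comment> \<open>For \<open>n = 0\<close> no \<open>i\<close> is below \<open>n\<close>, so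
        the truncated \<open>n - 1\<close> does no harm; otherwise \<open>k # v\<close> has length
        \<open>n\<close> and describes a line in direction \<open>Suc i\<close>.\<close>
      fix i :: nat and v :: "nat list" assume "i < n \<and> length v = n - 1 \<and> set v \<subseteq> {0, 1, 2}"
      then show "exact_fork (base C) (fork_line n C i v (fork_ob (Fork_n n C) k F))"
        using *[of "Suc i" "k # v"] that by (cases n) auto
    qed
    ultimately show "?f \<and> ?o \<and> ?v" using f by blast
  next
    assume r: "?f \<and> ?o \<and> ?v"
    show ?l unfolding exact_n_fork_def
    proof (intro conjI allI impI)
      show "F \<in> Obj (Fork_n (Suc n) C)" using r by simp
      fix i :: nat and v :: "nat list" assume iv:
        "i < Suc n \<and> length v = Suc n - 1 \<and> set v \<subseteq> {0, 1, 2}"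
      show "exact_fork (base C) (fork_line (Suc n) C i v F)"
      proof (cases i)
        case 0
        then show ?thesis using line0 r iv unfolding vertices_def by simp
      next
        case (Suc j)
        then obtain k w where v: "v = k # w" using iv by (cases v) auto
        then have "exact_n_fork n C (fork_ob (Fork_n n C) k F)" using r iv by auto
        then show ?thesis using Suc iv v unfolding exact_n_fork_def by auto
      qed
    qed
  qed
qed

text \<open>A preliminary form of \<open>exact_Suc_iff\<close>: since \<open>fork_ext\<close> speaks
  about some kernel pair, exactness of the one contained in \<open>F\<close> is listed separately.
  Dropping it requires \<open>exact_n_fork_iso\<close>, which is proved from this form.\<close>

lemma exact_Suc_iff_Dom:
  "exact_n_fork (Suc n) C F \<longleftrightarrow> kernel_fork (Fork_n n C) F \<and> fork_ext n C (fork_f F) \<and>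
    exact_n_fork n C (Dom (Fork_n n C) (fork_d F))"
proof -
  let ?F = "Fork_n n C"
  interpret F: cell_pullbacks "?F" by (rule Fork_n_pullbacks)
  let ?ev = "\<lambda>v. Fork (eval_mor v (fork_d F)) (eval_mor v (fork_c F)) (eval_mor v (fork_e F))
    (eval_mor v (fork_f F))"
  show ?thesis
  proof
    assume "exact_n_fork (Suc n) C F"
    then have f: "is_fork ?F F" and o: "exact_n_fork n C (Dom ?F (fork_d F))"
      "exact_n_fork n C (Dom ?F (fork_f F))" "exact_n_fork n C (Cod ?F (fork_f F))"
      and ev: "\<And>v. v \<in> vertices n \<Longrightarrow> exact_fork (base C) (?ev v)"
      unfolding exact_n_fork_Suc by auto
    have "is_kernel_pair ?F (fork_f F) (fork_d F) (fork_c F)"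
      using ev forkD[OF f] unfolding exact_fork_def by (intro pullback_evalI) auto
    moreover have "regular_epi (base C) (eval_mor v (fork_f F))" if "v \<in> vertices n" for v
      using ev[OF that] unfolding exact_fork_def regular_epi_def by auto
    ultimately show "kernel_fork ?F F \<and> fork_ext n C (fork_f F)
      \<and> exact_n_fork n C (Dom ?F (fork_d F))"
      unfolding kernel_fork_def fork_ext_def using f o forkD[OF f] by auto
  next
    assume r: "kernel_fork ?F F \<and> fork_ext n C (fork_f F) \<and> exact_n_fork n C (Dom ?F (fork_d F))"
    then have f: "is_fork ?F F" and k: "is_kernel_pair ?F (fork_f F) (fork_d F) (fork_c F)"
      unfolding kernel_fork_def by auto
    have "exact_fork (base C) (?ev v)" if v: "v \<in> vertices n" for v
    proof -
      interpret ev: is_functor "?F" "base C" "eval_functor n C v" using is_functor_eval v .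
      have "is_fork (base C) (?ev v)"
        using is_fork_image[OF ev.is_functor_axioms, of "fork_d F" "fork_c F" "fork_e F" "fork_f F"]
          f forkD(13)[OF f] by simp
      moreover have "is_kernel_pair (base C) (eval_mor v (fork_f F)) (eval_mor v (fork_d F))
        (eval_mor v (fork_c F))"
        using pullback_eval[OF k v] .
      ultimately show ?thesis
        using r v base.regular_epi_coequaliser unfolding exact_fork_def fork_ext_def by auto
    qed
    then show "exact_n_fork (Suc n) C F"
      unfolding exact_n_fork_Suc using f r unfolding fork_ext_def by auto
  qed
qed

text \<open>The components of an isomorphism of forks are isomorphisms, so the induction covers the
  three objects of the codomain. Its kernel pair and its regular epimorphisms are transported by
  \<open>kernel_fork_iso_codomain\<close> and \<open>E_iso_square\<close>.\<close>

lemma exact_n_fork_iso: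
  assumes "is_iso (Fork_n n C) i" "exact_n_fork n C (Dom (Fork_n n C) i)"
  shows "exact_n_fork n C (Cod (Fork_n n C) i)"
  using assms
proof (induction n arbitrary: i)
  case 0
  then show ?case unfolding exact_n_fork_def is_iso_def using base.Cod_Obj by simp
next
  case (Suc n)
  let ?F = "Fork_n n C"
  interpret F: cell_pullbacks "?F" by (rule Fork_n_pullbacks)
  obtain F G i2 i1 i0 where i: "i = ForkMap F G i2 i1 i0" and i': "fork_map ?F F G i2 i1 i0"
    using Suc.prems(1) unfolding is_iso_def by (metis F.Mor_ForkCE Fork_n.simps(2))
  have iso: "is_iso ?F i2" "is_iso ?F i1" "is_iso ?F i0"
    using Suc.prems(1) unfolding i by (auto simp: F.iso_ForkC_iff)
  have F: "kernel_fork ?F F" "fork_ext n C (fork_f F)" "exact_n_fork n C (Dom ?F (fork_d F))"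
    using Suc.prems(2) unfolding exact_Suc_iff_Dom i by auto
  note D = fork_mapD(7-)[OF i']
  have G: "kernel_fork ?F G" using F.kernel_fork_iso_codomain[OF F(1)] Suc.prems(1) unfolding i
    by simp
  have o: "exact_n_fork n C (Dom ?F (fork_d G))" "exact_n_fork n C (Dom ?F (fork_f G))"
      "exact_n_fork n C (Cod ?F (fork_f G))"
    using Suc.IH[OF iso(1)] Suc.IH[OF iso(2)] Suc.IH[OF iso(3)] F D unfolding fork_ext_def by simp_all
  have "regular_epi (base C) (eval_mor v (fork_f G))" if v: "v \<in> vertices n" for v
  proof -
    interpret ev: is_functor "?F" "base C" "eval_functor n C v" using is_functor_eval v .
    show ?thesis
      using base.E_iso_square ev.comm_square_MMap[OF fork_mapD(6)[OF i']] ev.MMap_iso[OF iso(2)]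
        ev.MMap_iso[OF iso(3)] F(2) v
      unfolding fork_ext_def by auto
  qed
  then have "exact_n_fork (Suc n) C G"
    using G o forkD(4)[of _ G] unfolding exact_Suc_iff_Dom fork_ext_def kernel_fork_def by blast
  then show ?case by (simp add: i)
qed

lemma fork_ext_kernel_pair:
  assumes "fork_ext n C f" "is_kernel_pair (Fork_n n C) f d c"
  shows "exact_n_fork n C (Dom (Fork_n n C) d)"
proof -
  let ?F = "Fork_n n C"
  interpret F: cell_pullbacks "?F" by (rule Fork_n_pullbacks)
  obtain d' c' where k: "is_kernel_pair ?F f d' c'" "exact_n_fork n C (Dom ?F d')"
    using assms(1) unfolding fork_ext_def by auto
  obtain i where "is_iso ?F i" "Dom ?F i = Dom ?F c'" "Cod ?F i = Dom ?F c"
    using F.pullback_iso[OF assms(2) k(1)] by metis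
  then show ?thesis using exact_n_fork_iso k F.pullbackD(8)[OF k(1)] F.pullbackD(8)[OF assms(2)]
    by metis
qed

lemma exact_Suc_iff:
  "exact_n_fork (Suc n) C F \<longleftrightarrow> kernel_fork (Fork_n n C) F \<and> fork_ext n C (fork_f F)"
  unfolding exact_Suc_iff_Dom using fork_ext_kernel_pair unfolding kernel_fork_def by blast

text \<open>For a morphism \<open>f : F \<rightarrow> G\<close> of exact \<open>(n + 1)\<close>-forks with components \<open>f\<^sub>2, f\<^sub>1, f\<^sub>0\<close>, both sides say something
  about the square \<open>(F\<^sub>1 \<rightarrow> F\<^sub>0) \<rightarrow> (G\<^sub>1 \<rightarrow> G\<^sub>0)\<close>: the left-hand side that the induced maps of kernel pairs in the two
  directions, \<open>f\<^sub>2\<close> and \<open>Eq f\<^sub>1 \<rightarrow> Eq f\<^sub>0\<close>, are extensions, the right-hand side that its comparison is one.\<close>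

lemma fork_ext_iff_cubic_ext:
  assumes "f \<in> Mor (Fork_n n C)" "exact_n_fork n C (Dom (Fork_n n C) f)"
    "exact_n_fork n C (Cod (Fork_n n C) f)"
  shows "fork_ext n C f \<longleftrightarrow> cubic_ext (Suc n) C (MMap (arr_n n) f)"
  using assms
proof (induction n arbitrary: f)
  case 0
  \<comment> \<open>For \<open>n = 0\<close> the only vertex is the empty list and exactness only
    means being an object, so any kernel pair will do.\<close>
  obtain d c where k: "is_kernel_pair (base C) f d c" using base.ex_pullback[of f f] 0(1)
    by (auto simp del: Mor_base)
  then have "Dom (base C) d \<in> Obj (base C)" using base.pullbackD(3) base.Dom_Obj by blast
  with k have "fork_ext 0 C f \<longleftrightarrow> regular_epi (base C) f" using 0
    unfolding fork_ext_def exact_n_fork_def by auto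
  then show ?case by simp
next
  case (Suc n)
  let ?F = "Fork_n n C" and ?A = "Arr_n n C"
  interpret F: cell_pullbacks "?F" by (rule Fork_n_pullbacks)
  interpret A: cell_relative_maltsev "Arr_n n C" "ext_obj n C" "cubic_ext (Suc n) C"
    by (rule relative_maltsev_Arr_n)
  interpret arr: is_functor "?F" "Arr_n n C" "arr_n n" by (rule is_functor_arr_n)
  let ?M = "MMap (arr_n n)" and ?E = "cubic_ext (Suc n) C"
  obtain F G f2 f1 f0 where f: "f = ForkMap F G f2 f1 f0" and fm: "fork_map ?F F G f2 f1 f0"
    using Suc.prems(1) by (metis F.Mor_ForkCE Fork_n.simps(2))
  define p where "p = fork_f F"
  define q where "q = fork_f G"
  have F: "kernel_fork ?F F" "fork_ext n C p" and G: "kernel_fork ?F G" "fork_ext n C q"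
    using Suc.prems(2,3) unfolding f p_def q_def by (simp_all add: exact_Suc_iff)
  then have kF: "is_kernel_pair ?F p (fork_d F) (fork_c F)"
    and kG: "is_kernel_pair ?F q (fork_d G) (fork_c G)"
    unfolding kernel_fork_def p_def q_def by simp_all
  note M = fork_mapD(7-)[OF fm, folded p_def q_def]
  have mor: "p \<in> Mor ?F" "q \<in> Mor ?F" using F(2) G(2) unfolding fork_ext_def by auto
  have o: "exact_n_fork n C (Dom ?F p)" "exact_n_fork n C (Cod ?F p)"
     "exact_n_fork n C (Dom ?F q)" "exact_n_fork n C (Cod ?F q)"
     "exact_n_fork n C (Dom ?F (fork_d F))" "exact_n_fork n C (Dom ?F (fork_d G))"
    using F(2) G(2) fork_ext_kernel_pair kF kG unfolding fork_ext_def by blast+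
  have IHp: "?E (?M p)" and IHq: "?E (?M q)" using Suc.IH F(2) G(2) mor o by blast+
  have IH2: "fork_ext n C f2 \<longleftrightarrow> ?E (?M f2)" and IH1: "fork_ext n C f1 \<longleftrightarrow> ?E (?M f1)"
    and IH0: "fork_ext n C f0 \<longleftrightarrow> ?E (?M f0)"
    by (rule Suc.IH; simp add: M o)+
  \<comment> \<open>\<open>K\<close> is the kernel pair of \<open>f\<close>, formed componentwise:
    its objects are those of the kernel pairs of \<open>f2\<close>, \<open>f1\<close>,
    \<open>f0\<close>, and its arrow \<open>k\<close> is the induced map between the last
    two.\<close>
  obtain K x2 x1 x0 y2 y1 y0 where x: "fork_map ?F K F x2 x1 x0" and y: "fork_map ?F K F y2 y1 y0"
    and k2: "is_kernel_pair ?F f2 x2 y2" and k1: "is_kernel_pair ?F f1 x1 y1"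
      and k0: "is_kernel_pair ?F f0 x0 y0"
    and kf: "is_kernel_pair (ForkC ?F) f (ForkMap K F x2 x1 x0) (ForkMap K F y2 y1 y0)"
    using F.ex_pullback_ForkC[OF fm fm] unfolding f by metis
  define k where "k = fork_f K"
  have sqpq: "comm_square ?F p q f1 f0" using fork_mapD(6)[OF fm] unfolding p_def q_def .
  have kx: "comm_square ?F k p x1 x0" and ky: "comm_square ?F k p y1 y0"
    using fork_mapD(6)[OF x] fork_mapD(6)[OF y] unfolding k_def p_def .
  have kk: "pair_map ?F p x1 y1 x0 y0 k" by (rule pair_mapI[OF kx ky])
  have pair2: "pair_map ?F f1 (fork_d F) (fork_c F) (fork_d G) (fork_c G) f2"
    by (rule pair_mapI[OF comm_square_sym[OF fork_mapD(3)[OF fm]]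
      comm_square_sym[OF fork_mapD(4)[OF fm]]])
  \<comment> \<open>Kernel pairs commute with each other, so \<open>K\<close> is again a kernel pair
    fork. By \<open>exact_Suc_iff\<close> it is then exact if and only if \<open>k\<close> is an
    extension.\<close>
  have "is_kernel_pair ?F k (fork_d K) (fork_c K)"
    by (rule F.pullback_pair_maps[OF kF kG _ _ _ _ k1 k1 k0 k2 kk kk])
      (use sqpq fork_mapD(3,4)[OF fm] fork_mapD(3,4)[OF x] fork_mapD(3,4)[OF y] in
        \<open>auto intro: comm_square_sym pair_mapI\<close>)
  then have K: "kernel_fork ?F K" using fork_mapD(1)[OF x] unfolding kernel_fork_def k_def by simp
  note Dx = fork_mapD(7-)[OF x, folded k_def p_def]
  have kmor: "k \<in> Mor ?F" using kx by (rule comm_squareD)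
  have sqM: "comm_square ?A (?M p) (?M q) (?M f1) (?M f0)" using sqpq by (rule arr.comm_square_MMap)
  have pairM2: "pair_map ?A (?M f1) (?M (fork_d F)) (?M (fork_c F)) (?M (fork_d G)) (?M (fork_c G))
    (?M f2)"
    by (rule pair_mapI[OF arr.comm_square_MMap[OF comm_square_sym[OF fork_mapD(3)[OF fm]]]
          arr.comm_square_MMap[OF comm_square_sym[OF fork_mapD(4)[OF fm]]]])
  have pairMk: "pair_map ?A (?M p) (?M x1) (?M y1) (?M x0) (?M y0) (?M k)"
    by (rule pair_mapI[OF arr.comm_square_MMap[OF kx] arr.comm_square_MMap[OF ky]])
  have M_Suc: "MMap (arr_n (Suc n)) f = Square (?M p) (?M q) (?M f1) (?M f0)"
    by (simp add: f p_def q_def)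
  have eval_Suc: "(\<forall>v \<in> vertices (Suc n). regular_epi (base C) (eval_mor v f)) \<longleftrightarrow>
      (\<forall>v \<in> vertices n. regular_epi (base C) (eval_mor v f2) \<and> regular_epi (base C) (eval_mor v f1)
        \<and> regular_epi (base C) (eval_mor v f0))"
    unfolding f ball_vertices_Suc by simp
  show ?case
  proof
    assume ext: "fork_ext (Suc n) C f"
    then have "exact_n_fork (Suc n) C K"
      using fork_ext_kernel_pair[of "Suc n" f] kf F.Dom_ForkC by fastforce
    then have oK: "exact_n_fork n C (Dom ?F k)" "exact_n_fork n C (Cod ?F k)"
        "exact_n_fork n C (Dom ?F (fork_d K))"
      unfolding exact_Suc_iff_Dom fork_ext_def k_def by auto
    have "fork_ext n C f2" "fork_ext n C f1" "fork_ext n C f0"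
      using ext oK o M Dx k2 k1 k0 eval_Suc unfolding fork_ext_def[of "Suc n"]
        unfolding fork_ext_def[of n] by auto
    then have E: "?E (?M f2)" "?E (?M f1)" "?E (?M f0)" using IH2 IH1 IH0 by auto
    \<comment> \<open>Transposed, because the map of kernel pairs at hand is \<open>f2\<close>,
      which lies over \<open>f1\<close> and joins the kernel pairs of \<open>p\<close> and
      \<open>q\<close>.\<close>
    have sqM': "comm_square ?A (?M f1) (?M f0) (?M p) (?M q)" using sqM by (rule comm_square_sym)
    obtain z where z: "comparison ?A (?M f1) (?M f0) (?M p) (?M q) z" using A.ex_comparison[OF sqM'] .
    have "?E z"
      by (rule A.E_comparison[OF sqM' E(2,3) IHp IHq pullback_arr_n[OF kF] pullback_arr_n[OF kG]
        pairM2 E(1) z])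
    then have "double_ext ?A ?E (?M p) (?M q) (?M f1) (?M f0)"
      unfolding double_ext_def using sqM A.comparison_sym[OF z sqM'] E IHp IHq by blast
    then show "cubic_ext (Suc (Suc n)) C (MMap (arr_n (Suc n)) f)"
      unfolding cubic_ext_Suc_Suc M_Suc by simp
  next
    assume "cubic_ext (Suc (Suc n)) C (MMap (arr_n (Suc n)) f)"
    then have "double_ext ?A ?E (?M p) (?M q) (?M f1) (?M f0)"
      unfolding cubic_ext_Suc_Suc M_Suc by simp
    then obtain w where E: "?E (?M f1)" "?E (?M f0)"
      and w: "comparison ?A (?M p) (?M q) (?M f1) (?M f0) w" "?E w"
      unfolding double_ext_def by blast
    \<comment> \<open>\<open>E_pair_map\<close> is used once in each direction of the square: here
      for \<open>f2\<close>, below for \<open>k\<close>, to which the induction hypothesis then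
      applies as to any morphism of exact n-forks.\<close>
    have "?E (?M f2)"
      by (rule A.E_pair_map[OF comm_square_sym[OF sqM] E(1) IHq w(2) pullback_arr_n[OF kF]
        pullback_arr_n[OF kG] pairM2
          A.comparison_sym[OF w(1) sqM]])
    then have ext: "fork_ext n C f2" "fork_ext n C f1" "fork_ext n C f0" using IH2 IH1 IH0 E by auto
    have oK: "exact_n_fork n C (Dom ?F k)" "exact_n_fork n C (Cod ?F k)"
      using fork_ext_kernel_pair[OF ext(2) k1] fork_ext_kernel_pair[OF ext(3) k0] Dx by simp_all
    have "?E (?M k)"
      by (rule A.E_pair_map[OF sqM IHp E(2) w(2) pullback_arr_n[OF k1] pullback_arr_n[OF k0] pairMk
        w(1)])
    then have "fork_ext n C k" using Suc.IH[OF kmor oK] by simp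
    then have "exact_n_fork (Suc n) C K" using K unfolding exact_Suc_iff k_def by simp
    moreover have "\<forall>v \<in> vertices (Suc n). regular_epi (base C) (eval_mor v f)"
      unfolding eval_Suc using ext unfolding fork_ext_def by blast
    ultimately show "fork_ext (Suc n) C f"
      unfolding fork_ext_def using Suc.prems kf F.Dom_ForkC by fastforce
  qed
qed

section \<open>Unit, counit and the adjoint equivalence\<close>

lemma arr_n_EqFork_n:
  assumes "f \<in> Mor (Arr_n n C)"
  shows "MMap (arr_n n) (MMap (EqFork_n n C) f) = f"
  using assms
proof (induction n arbitrary: f)
  case (Suc n)
  interpret F: cell_pullbacks "Fork_n n C" by (rule Fork_n_pullbacks)
  interpret A: cell_pullbacks "Arr_n n C" by (rule Arr_n_pullbacks)
  interpret EqFork: is_functor "Arr_n n C" "Fork_n n C" "EqFork_n n C" by (rule is_functor_EqFork_n)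
  obtain a b u v where f: "f = Square a b u v" and sq: "comm_square (Arr_n n C) a b u v"
    using Suc.prems by (metis A.Mor_ArrE Arr_n.simps(2))
  have "MMap arr (MMap (EqFork (Fork_n n C)) (MMap (Arr_functor (EqFork_n n C)) f))
    = MMap (Arr_functor (EqFork_n n C)) f"
    using EqFork.comm_square_MMap[OF sq] by (intro F.arr_EqFork) (simp add: f)
  then show ?case using Suc.IH comm_squareD(1-4)[OF sq] by (simp add: f del: MMap_EqFork)
qed simp

text \<open>Both factors in the recursion are identities, since \<open>arr_n\<close> after
  \<open>EqFork_n\<close> is strictly the identity. So the counit is invertible at every
  object.\<close>

lemma counit_n_Idt:
  assumes "A \<in> Obj (Arr_n n C)"
  shows "counit_n n C A = Idt (Arr_n n C) A"
  using assms
proof (induction n arbitrary: A)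
  case (Suc n)
  interpret F: cell_pullbacks "Fork_n n C" by (rule Fork_n_pullbacks)
  interpret A: cell_pullbacks "Arr_n n C" by (rule Arr_n_pullbacks)
  interpret arr: is_functor "Arr (Fork_n n C)" "Arr (Arr_n n C)" "Arr_functor (arr_n n)"
    by (rule is_functor_Arr[OF is_functor_arr_n])
  interpret EqFork: is_functor "Arr_n n C" "Fork_n n C" "EqFork_n n C" by (rule is_functor_EqFork_n)
  have A: "A \<in> Mor (Arr_n n C)" using Suc.prems by simp
  have "MMap (Arr_functor (arr_n n)) (Idt (Arr (Fork_n n C)) (MMap (EqFork_n n C) A))
    = Idt (Arr (Arr_n n C)) A"
    using A arr.MMap_Idt[of "MMap (EqFork_n n C) A"] arr_n_EqFork_n[OF A] by simp
  moreover have "Arr_nat_trans (Arr_n n C) (arr_n n \<circ>\<^sub>F EqFork_n n C) id_functor (counit_n n C) A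
    = Idt (Arr (Arr_n n C)) A"
    using A arr_n_EqFork_n[OF A] Suc.IH by (simp add: Arr_nat_trans_def)
  ultimately show ?case
    using A A.Arr.Cmp_Idt_left[of "Idt (Arr (Arr_n n C)) A" A] A.Arr.Mor_Idt[of A] A.Arr.Cod_Idt[of A]
    by (simp add: arr_counit_def del: A.Idt_Arr F.Idt_Arr)
qed simp

text \<open>The unit is a composite. \<open>arr_unit\<close> is invertible because an exact fork is
  a kernel pair fork; the other factor is the image under \<open>EqFork\<close> of a square whose
  components are units at the exact n-forks F1 and F0.\<close>

lemma unit_n_iso:
  assumes "exact_n_fork n C F"
  shows "is_iso (Fork_n n C) (unit_n n C F)"
  using assms
proof (induction n arbitrary: F)
  case 0
  then show ?case using base.iso_Idt unfolding exact_n_fork_def by simp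
next
  case (Suc n)
  let ?F = "Fork_n n C"
  interpret F: cell_pullbacks "?F" by (rule Fork_n_pullbacks)
  interpret adj: adjunction "?F" "Arr_n n C" "arr_n n" "EqFork_n n C" "unit_n n C" "counit_n n C"
    by (rule adjunction_Fork_n_Arr_n)
  interpret EqFork: is_functor "Arr ?F" "ForkC ?F" "EqFork ?F" by (rule F.is_functor_EqFork)
  have kF: "kernel_fork ?F F" and ext: "fork_ext n C (fork_f F)"
    using Suc.prems unfolding exact_Suc_iff by auto
  then have F: "is_fork ?F F" unfolding kernel_fork_def by simp
  define p where "p = fork_f F"
  have p: "p \<in> Mor ?F" using ext unfolding p_def fork_ext_def by simp
  define S where "S = Arr_nat_trans ?F id_functor (EqFork_n n C \<circ>\<^sub>F arr_n n) (unit_n n C) p"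
  have S: "S = Square p (MMap (EqFork_n n C) (MMap (arr_n n) p)) (unit_n n C (Dom ?F p))
    (unit_n n C (Cod ?F p))"
    unfolding S_def Arr_nat_trans_def by simp
  have sq: "comm_square ?F p (MMap (EqFork_n n C) (MMap (arr_n n) p)) (unit_n n C (Dom ?F p))
    (unit_n n C (Cod ?F p))"
    using p adj.unit.naturality[OF p] adj.unit.component[of "Dom ?F p"]
      adj.unit.component[of "Cod ?F p"]
    unfolding comm_square_def by simp
  then have "is_iso (Arr ?F) S"
    unfolding S F.iso_Arr_iff using ext Suc.IH unfolding fork_ext_def p_def by simp
  then have 1: "is_iso (ForkC ?F) (MMap (EqFork ?F) S)" by (rule EqFork.MMap_iso)
  have 2: "is_iso (ForkC ?F) (arr_unit ?F F)"
    unfolding F.arr_unit_fork_map(1)[OF F]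
    using kF F.EqFork_ob(2) p F.arr_unit_fork_map(2)[OF F] F.iso_Idt
    by (intro F.kernel_fork_iso) (simp_all add: p_def)
  have "is_iso (ForkC ?F) (MMap (EqFork ?F) S \<odot>\<^bsub>ForkC ?F\<^esub> arr_unit ?F F)"
    by (rule F.Fork.iso_Cmp[OF 2 1]) (simp add: F.arr_unit_fork_map(1)[OF F] S p_def)
  then show ?case unfolding S_def p_def by simp
qed

text \<open>The fork in question is the kernel pair fork of the morphism
  \<open>MMap (EqFork_n n C) A\<close>. Its ends are exact by induction and \<open>arr_n\<close>
  sends it back to \<open>A\<close>, so \<open>fork_ext_iff_cubic_ext\<close> makes it an
  extension.\<close>

lemma EqFork_n_exact:
  assumes "A \<in> Obj (Arr_n n C)" "ext_obj n C A"
  shows "exact_n_fork n C (OMap (EqFork_n n C) A)"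
  using assms
proof (induction n arbitrary: A)
  case 0
  then show ?case by (simp add: exact_n_fork_def)
next
  case (Suc n)
  interpret F: cell_pullbacks "Fork_n n C" by (rule Fork_n_pullbacks)
  interpret A: cell_relative_maltsev "Arr_n n C" "ext_obj n C" "cubic_ext (Suc n) C"
    by (rule relative_maltsev_Arr_n)
  interpret EqFork: is_functor "Arr_n n C" "Fork_n n C" "EqFork_n n C" by (rule is_functor_EqFork_n)
  have A: "A \<in> Mor (Arr_n n C)" using Suc.prems by simp
  have E: "cubic_ext (Suc n) C A" using Suc.prems unfolding ext_obj_def by simp
  let ?f = "MMap (EqFork_n n C) A"
  have f: "?f \<in> Mor (Fork_n n C)" using A by simp
  have "exact_n_fork n C (Dom (Fork_n n C) ?f)" "exact_n_fork n C (Cod (Fork_n n C) ?f)"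
    using A Suc.IH A.E_Dom[OF E] A.E_Cod[OF E] by simp_all
  then have "fork_ext n C ?f" using fork_ext_iff_cubic_ext[OF f] arr_n_EqFork_n[OF A] E by simp
  then show ?case using F.EqFork_ob[OF f] by (simp add: exact_Suc_iff)
qed

text \<open>On objects \<open>arr_n (Suc n)\<close> is \<open>arr_n n\<close> applied to the
  morphism \<open>fork_f F\<close>, which is an extension by \<open>exact_Suc_iff\<close>.\<close>

lemma arr_n_cubic_ext:
  assumes "exact_n_fork (Suc n) C F"
  shows "cubic_ext (Suc n) C (OMap (arr_n (Suc n)) F)"
  using assms fork_ext_iff_cubic_ext unfolding exact_Suc_iff by (auto simp: fork_ext_def)

lemma adjoint_equivalence_EFork_n_Ext_n:
  assumes "n \<ge> 1"
  shows "adjoint_equivalence (EFork_n n C) (Ext_n n C) (arr_n n) (EqFork_n n C) (unit_n n C)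
    (counit_n n C)"
  unfolding EFork_n_def Ext_n_def
proof (rule adjoint_equivalence_full_sub[OF adjunction_Fork_n_Arr_n])
  interpret A: cell_pullbacks "Arr_n n C" by (rule Arr_n_pullbacks)
  fix A assume "A \<in> Obj (Arr_n n C)"
  then show "is_iso (Arr_n n C) (counit_n n C A)" by (simp add: counit_n_Idt A.iso_Idt)
next
  fix F assume "exact_n_fork n C F"
  \<comment> \<open>Positivity of \<open>n\<close> matters here, as \<open>cubic_ext 0\<close> is
    constantly false.\<close>
  moreover obtain m where "n = Suc m" using assms by (cases n) auto
  ultimately show "cubic_ext n C (OMap (arr_n n) F)" using arr_n_cubic_ext by simp
qed (use EqFork_n_exact unit_n_iso in \<open>simp_all add: ext_obj_def\<close>)

end

theorem theorem3p10:
  fixes X :: "('o, 'm) precat" and n :: nat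
  assumes "exact_maltsev_category X"
    and "n \<ge> 1"
  shows "adjunction (Fork_n n X) (Arr_n n X) (arr_n n) (EqFork_n n X) (unit_n n X) (counit_n n X)
       \<and> adjoint_equivalence (EFork_n n X) (Ext_n n X)
           (arr_n n) (EqFork_n n X) (unit_n n X) (counit_n n X)"
  using exact_maltsev_category.adjunction_Fork_n_Arr_n[OF assms(1)]
    exact_maltsev_category.adjoint_equivalence_EFork_n_Ext_n[OF assms] by simp

end
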